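(* Let $F$ be a field of characteristic zero and $W$ a unital $\mathbb{Z}_2$-graded $F$-algebra. Let $UT_2^C$ be the $\mathbb{Z}_2$-graded $W$-algebra of $2\times2$ upper triangular matrices over $F$ with the canonical grading, where $W$ acts as the algebra $C=F1_{UT_2}+Fe_{12}$ by left and right multiplication. Fix the ordered basis $\{w_i\}_{i\in\mathcal I}$ of $W$ so that $w_0=1_W$ and $w_1$ act as left and right multiplication by $1$ and $e_{12}$ respectively, and $w_i$ acts as zero for all $i\ge2$. Then $\mathrm{Id}^{\mathbb{Z}_2,W}(UT_2^C)$ is generated, as a $T_{\mathbb{Z}_2,W}$-ideal, by the polynomials $$[y_1,y_2],\quad z_1z_2,\quad yw_i,\quad w_iy,\quad zw_j,\quad w_jz$$ for all $i\ge2$ and $j\ge1$. Moreover, for all $n\ge1$, $c_n^{\mathbb{Z}_2,W}(UT_2^C)=2^{n-1}(n+2)+1$.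
   Context: The canonical grading is $UT_2^0=Fe_{11}\oplus Fe_{22}$, $UT_2^1=Fe_{12}$. "$W$ acts as a unital graded subalgebra $B\subseteq UT_2$ by left and right multiplication" means there is a surjective unital graded homomorphism $\varphi:W\to B$ with $wa=\varphi(w)a$, $aw=a\varphi(w)$; here $B=C$, and $\varphi(w_0)=1$, $\varphi(w_1)=e_{12}$, $\varphi(w_i)=0$ for $i\ge2$ (i.e. for all remaining indices). $[a,b]=ab-ba$. Let $y_1,y_2,\dots$ be variables of degree $0$ and $z_1,z_2,\dots$ of degree $1$ ($y,z$ denote one such variable). The free $\mathbb{Z}_2$-graded $W$-algebra $W\langle Y,Z\rangle$ has vector space basis the monomials $w_{i_0}u_1w_{i_1}\cdots w_{i_{n-1}}u_nw_{i_n}$, $n\ge1$, each $u_j$ a variable; product is juxtaposition followed by multiplication in $W$, $W$ acts by multiplication at the two ends, a variable $x$ is identified with $1_Wx1_W$, and for homogeneous elements of $W$ the degree of a monomial is the sum of the degrees of its factors. $\mathrm{Id}^{\mathbb{Z}_2,W}(A)$ is the set of elements vanishing under all substitutions of $y$'s by elements of $A^0$ and $z$'s by elements of $A^1$. A $T_{\mathbb{Z}_2,W}$-ideal is a two-sided ideal, closed under the left and right $W$-action, invariant under all graded $W$-algebra endomorphisms of $W\langle Y,Z\rangle$. $P_n^{\mathbb{Z}_2,W}$ is the span of all monomials $w_{i_0}u_{\sigma(1)}w_{i_1}\cdots u_{\sigma(n)}w_{i_n}$ with $\sigma\in S_n$, each $u_i\in\{y_i,z_i\}$, and $c_n^{\mathbb{Z}_2,W}(A)=\dim_F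 P_n^{\mathbb{Z}_2,W}/(P_n^{\mathbb{Z}_2,W}\cap\mathrm{Id}^{\mathbb{Z}_2,W}(A))$. *)

theory Defs
  imports
    "HOL-Analysis.Analysis"
    "HOL-Library.Poly_Mapping"
    "HOL-Library.Set_Algebras"
    "HOL-Library.Z2"
    "HOL-Combinatorics.Permutations"
begin

section \<open>The acting algebra\<close>

text \<open>
  The group of degrees is the additive group of the type \<^typ>\<open>bit\<close> (integers mod 2).
  A unital graded algebra lives on a whole type \<open>'w\<close>, with scalar multiplication \<open>s\<close> and
  homogeneous components \<open>G 0\<close>, \<open>G 1\<close>.
\<close>

locale Z2_graded_algebra = vector_space s
  for s :: "'f::field \<Rightarrow> 'w::ring_1 \<Rightarrow> 'w" +
  fixes G :: "bit \<Rightarrow> 'w set"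
  assumes mult_scale_left: "s c x * y = s c (x * y)"
    and mult_scale_right: "x * s c y = s c (x * y)"
    and subspace_component: "subspace (G d)"
    and components_span: "\<exists>x0\<in>G 0. \<exists>x1\<in>G 1. x = x0 + x1"
    and components_independent: "G 0 \<inter> G 1 = {0}"
    and mult_component: "x \<in> G d \<Longrightarrow> y \<in> G e \<Longrightarrow> x * y \<in> G (d + e)"


section \<open>Graded algebras with a left and a right action\<close>

text \<open>
  Algebras that need not have a unit and are carried by a subset of a type. Addition is that of
  the type; \<open>lact\<close> and \<open>ract\<close> are the two actions of the acting algebra \<open>'w\<close>.
\<close>

record ('f, 'w, 'a) gw_algebra =
  carr :: "'a set"
  smult :: "'f \<Rightarrow> 'a \<Rightarrow> 'a"
  mult :: "'a \<Rightarrow> 'a \<Rightarrow> 'a"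
  lact :: "'w \<Rightarrow> 'a \<Rightarrow> 'a"
  ract :: "'a \<Rightarrow> 'w \<Rightarrow> 'a"
  hcomp :: "bit \<Rightarrow> 'a set"

definition gw_endomorphism ::
    "('f, 'w, 'a::ab_group_add) gw_algebra \<Rightarrow> ('a \<Rightarrow> 'a) \<Rightarrow> bool" where
  "gw_endomorphism A \<psi> \<longleftrightarrow>
     (\<forall>x\<in>carr A. \<psi> x \<in> carr A) \<and>
     (\<forall>x\<in>carr A. \<forall>y\<in>carr A. \<psi> (x + y) = \<psi> x + \<psi> y) \<and>
     (\<forall>c. \<forall>x\<in>carr A. \<psi> (smult A c x) = smult A c (\<psi> x)) \<and>
     (\<forall>x\<in>carr A. \<forall>y\<in>carr A. \<psi> (mult A x y) = mult A (\<psi> x) (\<psi> y)) \<and>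
     (\<forall>a. \<forall>x\<in>carr A. \<psi> (lact A a x) = lact A a (\<psi> x)) \<and>
     (\<forall>a. \<forall>x\<in>carr A. \<psi> (ract A x a) = ract A (\<psi> x) a) \<and>
     (\<forall>d. \<forall>x\<in>hcomp A d. \<psi> x \<in> hcomp A d)"

definition T_ideal :: "('f, 'w, 'a::ab_group_add) gw_algebra \<Rightarrow> 'a set \<Rightarrow> bool" where
  "T_ideal A J \<longleftrightarrow>
     J \<subseteq> carr A \<and> 0 \<in> J \<and>
     (\<forall>x\<in>J. \<forall>y\<in>J. x + y \<in> J) \<and>
     (\<forall>c. \<forall>x\<in>J. smult A c x \<in> J) \<and>
     (\<forall>x\<in>J. \<forall>y\<in>carr A. mult A x y \<in> J \<and> mult A y x \<in> J) \<and>
     (\<forall>a. \<forall>x\<in>J. lact A a x \<in> J \<and> ract A x a \<in> J) \<and>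
     (\<forall>\<psi>. gw_endomorphism A \<psi> \<longrightarrow> \<psi> ` J \<subseteq> J)"

definition T_ideal_generated :: "('f, 'w, 'a::ab_group_add) gw_algebra \<Rightarrow> 'a set \<Rightarrow> 'a set" where
  "T_ideal_generated A S = \<Inter> {J. T_ideal A J \<and> S \<subseteq> J}"


section \<open>Monomials and their values\<close>

text \<open>\<open>Y i\<close> and \<open>Z i\<close> stand for the variables $y_{i+1}$ (degree 0) and $z_{i+1}$ (degree 1).\<close>

datatype gvar = Y nat | Z nat

fun vdeg :: "gvar \<Rightarrow> bit" where
  "vdeg (Y i) = 0"
| "vdeg (Z i) = 1"

text \<open>\<open>Mono a0 [(u1, a1), \<dots>, (un, an)]\<close> is the monomial $a_0 u_1 a_1 \cdots u_n a_n$.\<close>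

datatype 'w gmono = Mono 'w "(gvar \<times> 'w) list"

text \<open>
  The value of a monomial with at least one variable, given multiplication \<open>m\<close>, actions \<open>l\<close>, \<open>r\<close>
  and a substitution \<open>\<theta>\<close>; monomials without variables do not occur, and get the value 0.
\<close>

fun mono_value ::
    "('a \<Rightarrow> 'a \<Rightarrow> 'a) \<Rightarrow> ('w \<Rightarrow> 'a \<Rightarrow> 'a) \<Rightarrow> ('a \<Rightarrow> 'w \<Rightarrow> 'a) \<Rightarrow> (gvar \<Rightarrow> 'a) \<Rightarrow>
     'w gmono \<Rightarrow> 'a::zero" where
  "mono_value m l r \<theta> (Mono a []) = 0"
| "mono_value m l r \<theta> (Mono a ((u, b) # us)) =
     foldl (\<lambda>x (v, c). m x (r (\<theta> v) c)) (l a (r (\<theta> u) b)) us"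


section \<open>The free graded algebra with action\<close>

text \<open>
  Throughout, \<open>B\<close> is a basis of the acting algebra with scalar multiplication \<open>s\<close>. The free
  algebra consists of the finitely supported functions on the monomials with all \<open>ai\<close> in \<open>B\<close>.
\<close>

type_synonym ('f, 'w) wpoly = "'w gmono \<Rightarrow>\<^sub>0 'f"

definition basis_monos :: "'w set \<Rightarrow> 'w gmono set" where
  "basis_monos B = {Mono a us | a us. us \<noteq> [] \<and> a \<in> B \<and> snd ` set us \<subseteq> B}"

definition fscale :: "'f::field \<Rightarrow> ('f, 'w) wpoly \<Rightarrow> ('f, 'w) wpoly" where
  "fscale c p = Poly_Mapping.map ((*) c) p"

definition lin_ext ::
    "('w gmono \<Rightarrow> ('f, 'w) wpoly) \<Rightarrow> ('f::field, 'w) wpoly \<Rightarrow> ('f, 'w) wpoly" where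
  "lin_ext g p = (\<Sum>m\<in>Poly_Mapping.keys p. fscale (Poly_Mapping.lookup p m) (g m))"

text \<open>If $x = \sum_b x_b b$ with $b$ in \<open>B\<close>, this is the element $\sum_b x_b\, h(b)$.\<close>

definition expand ::
    "('f::field \<Rightarrow> 'w::ring_1 \<Rightarrow> 'w) \<Rightarrow> 'w set \<Rightarrow> ('w \<Rightarrow> 'w gmono) \<Rightarrow> 'w \<Rightarrow> ('f, 'w) wpoly" where
  "expand s B h x =
     (\<Sum>b | module.representation s B x b \<noteq> 0.
        Poly_Mapping.single (h b) (module.representation s B x b))"

fun lact_mono where
  "lact_mono s B x (Mono a us) = expand s B (\<lambda>b. Mono b us) (x * a)"

fun ract_mono where
  "ract_mono s B (Mono a us) x =
     expand s B (\<lambda>b. Mono a (butlast us @ [(fst (last us), b)])) (snd (last us) * x)"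

fun mult_mono where
  "mult_mono s B (Mono a us) (Mono a' vs) =
     expand s B (\<lambda>b. Mono a (butlast us @ (fst (last us), b) # vs)) (snd (last us) * a')"

definition flact ::
    "('f::field \<Rightarrow> 'w::ring_1 \<Rightarrow> 'w) \<Rightarrow> 'w set \<Rightarrow> 'w \<Rightarrow> ('f, 'w) wpoly \<Rightarrow> ('f, 'w) wpoly" where
  "flact s B x p = lin_ext (lact_mono s B x) p"

definition fract ::
    "('f::field \<Rightarrow> 'w::ring_1 \<Rightarrow> 'w) \<Rightarrow> 'w set \<Rightarrow> ('f, 'w) wpoly \<Rightarrow> 'w \<Rightarrow> ('f, 'w) wpoly" where
  "fract s B p x = lin_ext (\<lambda>m. ract_mono s B m x) p"

definition fmult ::
    "('f::field \<Rightarrow> 'w::ring_1 \<Rightarrow> 'w) \<Rightarrow> 'w set \<Rightarrow>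
     ('f, 'w) wpoly \<Rightarrow> ('f, 'w) wpoly \<Rightarrow> ('f, 'w) wpoly" where
  "fmult s B p q = lin_ext (\<lambda>m. lin_ext (mult_mono s B m) q) p"

text \<open>A variable $u$ is identified with $1 u 1$; this is used only for bases containing 1.\<close>

definition fvar :: "gvar \<Rightarrow> ('f::field, 'w::ring_1) wpoly" where
  "fvar u = Poly_Mapping.single (Mono 1 [(u, 1)]) 1"

text \<open>
  Monomials $a_0 u_1 a_1 \cdots u_n a_n$ of total degree \<open>d\<close> with arbitrary homogeneous \<open>ai\<close>. The
  basis \<open>B\<close> is not required to be homogeneous, so these need not be basis monomials.
\<close>

definition homogeneous_monos :: "(bit \<Rightarrow> 'w set) \<Rightarrow> bit \<Rightarrow> 'w gmono set" where
  "homogeneous_monos G d =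
     {Mono a us | a us. us \<noteq> [] \<and>
        (\<exists>e0 e. a \<in> G e0 \<and> (\<forall>k<length us. snd (us ! k) \<in> G (e k)) \<and>
           d = e0 + (\<Sum>k<length us. vdeg (fst (us ! k)) + e k))}"

definition free_gw ::
    "('f::field \<Rightarrow> 'w::ring_1 \<Rightarrow> 'w) \<Rightarrow> (bit \<Rightarrow> 'w set) \<Rightarrow> 'w set \<Rightarrow>
     ('f, 'w, ('f, 'w) wpoly) gw_algebra" where
  "free_gw s G B =
     \<lparr> carr = {p. Poly_Mapping.keys p \<subseteq> basis_monos B},
       smult = fscale,
       mult = fmult s B,
       lact = flact s B,
       ract = fract s B,
       hcomp = (\<lambda>d. module.span fscale
         (mono_value (fmult s B) (flact s B) (fract s B) fvar ` homogeneous_monos G d)) \<rparr>"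


section \<open>Graded identities and codimensions\<close>

definition wpoly_value ::
    "('f::field, 'w, 'a::ab_group_add) gw_algebra \<Rightarrow> (gvar \<Rightarrow> 'a) \<Rightarrow> ('f, 'w) wpoly \<Rightarrow> 'a" where
  "wpoly_value A \<theta> p =
     (\<Sum>m\<in>Poly_Mapping.keys p. smult A (Poly_Mapping.lookup p m) (mono_value (mult A) (lact A) (ract A) \<theta> m))"

definition graded_identities ::
    "'w set \<Rightarrow> ('f::field, 'w, 'a::ab_group_add) gw_algebra \<Rightarrow> ('f, 'w) wpoly set" where
  "graded_identities B A =
     {p. Poly_Mapping.keys p \<subseteq> basis_monos B \<and>
         (\<forall>\<theta>. (\<forall>u. \<theta> u \<in> hcomp A (vdeg u)) \<longrightarrow> wpoly_value A \<theta> p = 0)}"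

definition multilinear_monos :: "'w set \<Rightarrow> nat \<Rightarrow> 'w gmono set" where
  "multilinear_monos B n =
     {Mono a us | a us. a \<in> B \<and> snd ` set us \<subseteq> B \<and> length us = n \<and>
        (\<exists>\<sigma>. \<sigma> permutes {..<n} \<and> (\<forall>k<n. fst (us ! k) \<in> {Y (\<sigma> k), Z (\<sigma> k)}))}"

definition multilinear_space :: "'w set \<Rightarrow> nat \<Rightarrow> ('f::field, 'w) wpoly set" where
  "multilinear_space B n =
     module.span fscale ((\<lambda>m. Poly_Mapping.single m 1) ` multilinear_monos B n)"

text \<open>
  The quotient \<open>U / V\<close> of subspaces, as the set of cosets \<open>x +o V\<close>. Sums of cosets are
  elementwise sums of sets, with neutral element \<open>V\<close>. The summand \<open>V\<close> in a linear combination makes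
  the result a coset also when there are no terms.
\<close>

definition quotient_space :: "'a::ab_group_add set \<Rightarrow> 'a set \<Rightarrow> 'a set set" where
  "quotient_space U V = (\<lambda>x. x +o V) ` U"

definition coset_combination ::
    "('f::field \<Rightarrow> 'a::ab_group_add \<Rightarrow> 'a) \<Rightarrow> 'a set \<Rightarrow> 'a set set \<Rightarrow> ('a set \<Rightarrow> 'f) \<Rightarrow> 'a set" where
  "coset_combination sc V T c = V + (\<Sum>X\<in>T. sc (c X) ` X)"

definition quotient_basis ::
    "('f::field \<Rightarrow> 'a::ab_group_add \<Rightarrow> 'a) \<Rightarrow> 'a set \<Rightarrow> 'a set \<Rightarrow> 'a set set \<Rightarrow> bool" where
  "quotient_basis sc U V S \<longleftrightarrow>
     S \<subseteq> quotient_space U V \<and>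
     (\<forall>T c. finite T \<and> T \<subseteq> S \<and> coset_combination sc V T c = V \<longrightarrow> (\<forall>X\<in>T. c X = 0)) \<and>
     (\<forall>Q\<in>quotient_space U V. \<exists>T c. finite T \<and> T \<subseteq> S \<and> Q = coset_combination sc V T c)"

text \<open>A basis always exists; as for the library's \<open>dim\<close>, the value is 0 if it is infinite.\<close>

definition quotient_dim ::
    "('f::field \<Rightarrow> 'a::ab_group_add \<Rightarrow> 'a) \<Rightarrow> 'a set \<Rightarrow> 'a set \<Rightarrow> nat" where
  "quotient_dim sc U V = card (SOME S. quotient_basis sc U V S)"

definition graded_codimension ::
    "'w set \<Rightarrow> ('f::field, 'w, 'a::ab_group_add) gw_algebra \<Rightarrow> nat \<Rightarrow> nat" where
  "graded_codimension B A n =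
     quotient_dim fscale (multilinear_space B n)
       (multilinear_space B n \<inter> graded_identities B A)"


section \<open>Upper triangular matrices\<close>

definition mscale :: "'f::field \<Rightarrow> 'f^2^2 \<Rightarrow> 'f^2^2" where
  "mscale c A = (\<chi> i j. c * A $ i $ j)"

definition munit :: "2 \<Rightarrow> 2 \<Rightarrow> ('f::field)^2^2" where
  "munit k l = (\<chi> i j. if i = k \<and> j = l then 1 else 0)"

definition UT2 :: "(('f::field)^2^2) set" where
  "UT2 = {A. A $ 2 $ 1 = 0}"

definition UT2_comp :: "bit \<Rightarrow> (('f::field)^2^2) set" where
  "UT2_comp d =
     (if d = 0 then {mscale a (munit 1 1) + mscale b (munit 2 2) | a b. True}
      else {mscale c (munit 1 2) | c. True})"

definition C_alg :: "(('f::field)^2^2) set" where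
  "C_alg = {mscale a (mat 1) + mscale b (munit 1 2) | a b. True}"

text \<open>Surjective unital graded homomorphisms onto \<open>C\<close>, which is graded as a subalgebra of \<open>UT2\<close>.\<close>

definition graded_hom_onto_C ::
    "('f::field \<Rightarrow> 'w::ring_1 \<Rightarrow> 'w) \<Rightarrow> (bit \<Rightarrow> 'w set) \<Rightarrow> ('w \<Rightarrow> 'f^2^2) \<Rightarrow> bool" where
  "graded_hom_onto_C s G \<phi> \<longleftrightarrow>
     range \<phi> = C_alg \<and>
     (\<forall>x y. \<phi> (x + y) = \<phi> x + \<phi> y) \<and>
     (\<forall>c x. \<phi> (s c x) = mscale c (\<phi> x)) \<and>
     (\<forall>x y. \<phi> (x * y) = \<phi> x ** \<phi> y) \<and>
     \<phi> 1 = mat 1 \<and>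
     (\<forall>d. \<forall>x\<in>G d. \<phi> x \<in> C_alg \<inter> UT2_comp d)"

definition UT2C :: "('w \<Rightarrow> ('f::field)^2^2) \<Rightarrow> ('f, 'w, 'f^2^2) gw_algebra" where
  "UT2C \<phi> =
     \<lparr> carr = UT2,
       smult = mscale,
       mult = (**),
       lact = (\<lambda>x A. \<phi> x ** A),
       ract = (\<lambda>A x. A ** \<phi> x),
       hcomp = UT2_comp \<rparr>"

end

theory Submission
  imports Defs "HOL-Library.Function_Algebras"
begin

text \<open>
  In \<open>UT2\<close> the matrix unit $e_{12}$ squares to zero and absorbs every diagonal matrix up to a scalar.
  Odd variables take multiples of $e_{12}$ as values, and the acting element \<open>w1\<close> acts as $e_{12}$
  itself; so a monomial can only have a nonzero value if it contains no coefficient $w_i$ with $i \ge 2$ and at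
  most one factor among the odd variables and the coefficients \<open>w1\<close>. What remains of such a monomial is
  a normal form (\<open>nform\<close>): the multiset of its even variables if there is no such factor, and otherwise
  the factor together with the multisets of even variables to its left and to its right. The value
  of a monomial depends on its normal form only, and its nonzero entries are monomials in the matrix
  entries of the substitution: with a factor present, the entries (1,1) of the even variables to
  its left and the entries (2,2) of those to its right occur in entry (1,2) of the value.

  Distinct monomials in the entries are linearly independent functions over a field of
  characteristic zero (\<open>monomials_independent\<close>). Hence an element of the free algebra is an identity
  exactly if, for every normal form, the coefficients of the monomials having it add up to zero
  (\<open>graded_identities_iff\<close>). Both parts of the theorem rest on this.

  For the generation of the ideal, let \<open>J\<close> be any T-ideal containing the listed polynomials.
  Monomials with equal normal form are congruent modulo \<open>J\<close>, because the even variables within a block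
  commute (\<open>cong_nform\<close>). Monomials without normal form lie in \<open>J\<close> (\<open>mono_nform_class\<close>): building a
  monomial from right to left, one stays in the sum of \<open>J\<close> and one homogeneous component until a
  second odd factor or an annihilating coefficient occurs, and the result then lies in \<open>J\<close>. The element
  \<open>w1\<close> need not be homogeneous, but its even part lies in the kernel of the action, which is spanned by
  the $w_i$ with $i \ge 2$; so modulo \<open>J\<close> the element \<open>w1\<close> acts on even elements as its odd part does.
  Grouping an identity by normal forms now shows that it lies in \<open>J\<close>.

  For the codimensions, sending a polynomial to its coefficient sums is a linear map whose kernel on
  the multilinear space consists of the identities, so the codimension is the dimension of the image
  (\<open>quotient_dim_linear_image\<close>). The image has a basis indexed by the normal forms in which each of $n$
  indices occurs once: one without a factor, $2^n$ with \<open>w1\<close> (a choice of the left variables), and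
  $n 2^{n-1}$ with an odd variable.

  Substitutions extend to endomorphisms of the free algebra, and evaluations in \<open>UT2\<close> are
  homomorphisms, for one common reason: both are evaluations in an algebra satisfying the axioms of
  the locale \<open>W_algebra\<close>. That the free algebra satisfies them is checked on monomials.
\<close>

section \<open>Linear extension from monomials and from a basis\<close>

lemma lookup_fscale: "Poly_Mapping.lookup (fscale c p) m = c * Poly_Mapping.lookup p m"
  by (simp add: fscale_def Poly_Mapping.map.rep_eq when_def)

interpretation fscale: vector_space fscale
  by unfold_locales (auto intro!: poly_mapping_eqI simp: lookup_fscale lookup_add algebra_simps)

abbreviation mono_elem :: "'w gmono \<Rightarrow> ('f::field, 'w) wpoly" where
  "mono_elem m \<equiv> Poly_Mapping.single m 1"

lemma fscale_mono_elem: "fscale c (mono_elem m) = Poly_Mapping.single m c"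
  by (auto intro!: poly_mapping_eqI simp: lookup_fscale lookup_single when_def)

lemma keys_fscale: "Poly_Mapping.keys (fscale c p) \<subseteq> Poly_Mapping.keys p"
  by (auto simp: in_keys_iff lookup_fscale)

text \<open>
  Linear extensions and evaluations of polynomials are sums over the support, which changes under
  addition and scaling; passing to a common larger index set makes their linearity termwise.
\<close>

lemma sum_over_keys_superset:
  assumes "vector_space sc" "finite K" "Poly_Mapping.keys p \<subseteq> K"
  shows "(\<Sum>m\<in>Poly_Mapping.keys p. sc (Poly_Mapping.lookup p m) (g m)) =
         (\<Sum>m\<in>K. sc (Poly_Mapping.lookup p m) (g m))"
proof -
  interpret vector_space sc by fact
  show ?thesis
    using assms(2,3) by (intro sum.mono_neutral_left) (auto simp: in_keys_iff)
qed

lemma sum_over_keys_add: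
  assumes "vector_space sc"
  shows "(\<Sum>m\<in>Poly_Mapping.keys (p + q). sc (Poly_Mapping.lookup (p + q) m) (g m)) =
    (\<Sum>m\<in>Poly_Mapping.keys p. sc (Poly_Mapping.lookup p m) (g m)) +
    (\<Sum>m\<in>Poly_Mapping.keys q. sc (Poly_Mapping.lookup q m) (g m))"
proof -
  interpret vector_space sc by fact
  let ?K = "Poly_Mapping.keys p \<union> Poly_Mapping.keys q"
  have K: "finite ?K" "Poly_Mapping.keys (p + q) \<subseteq> ?K"
    "Poly_Mapping.keys p \<subseteq> ?K" "Poly_Mapping.keys q \<subseteq> ?K"
    using Poly_Mapping.keys_add[of p q] by auto
  show ?thesis
    unfolding sum_over_keys_superset[OF assms K(1) K(2)] sum_over_keys_superset[OF assms K(1) K(3)]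
      sum_over_keys_superset[OF assms K(1) K(4)]
    by (simp add: lookup_add scale_left_distrib sum.distrib)
qed

lemma sum_over_keys_fscale:
  assumes "vector_space sc"
  shows "(\<Sum>m\<in>Poly_Mapping.keys (fscale c p). sc (Poly_Mapping.lookup (fscale c p) m) (g m)) =
    sc c (\<Sum>m\<in>Poly_Mapping.keys p. sc (Poly_Mapping.lookup p m) (g m))"
proof -
  interpret vector_space sc by fact
  show ?thesis
    unfolding sum_over_keys_superset[OF assms finite_keys keys_fscale]
    by (simp add: lookup_fscale scale_sum_right)
qed

lemma lin_ext_add: "lin_ext g (p + q) = lin_ext g p + lin_ext g q"
  unfolding lin_ext_def by (rule sum_over_keys_add) unfold_locales

lemma lin_ext_fscale: "lin_ext g (fscale c p) = fscale c (lin_ext g p)"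
  unfolding lin_ext_def by (rule sum_over_keys_fscale) unfold_locales

lemma lin_ext_0: "lin_ext g 0 = 0"
  by (simp add: lin_ext_def)

lemma lin_ext_sum: "lin_ext g (sum f S) = (\<Sum>x\<in>S. lin_ext g (f x))"
  by (induction S rule: infinite_finite_induct) (auto simp: lin_ext_add lin_ext_0)

lemma lin_ext_mono_elem [simp]: "lin_ext g (mono_elem m) = g m"
  by (simp add: lin_ext_def)

lemma lin_ext_add_fun: "lin_ext (\<lambda>m. g m + h m) p = lin_ext g p + lin_ext h p"
  by (simp add: lin_ext_def fscale.scale_right_distrib sum.distrib)

lemma lin_ext_fscale_fun: "lin_ext (\<lambda>m. fscale c (g m)) p = fscale c (lin_ext g p)"
  by (simp add: lin_ext_def fscale.scale_sum_right mult.commute)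

lemma poly_eq_sum_mono_elem:
  "p = (\<Sum>m\<in>Poly_Mapping.keys p. fscale (Poly_Mapping.lookup p m) (mono_elem m))"
  by (rule poly_mapping_eqI) (auto simp: fscale_mono_elem lookup_sum lookup_single when_def in_keys_iff)

lemma linear_induct [consumes 1, case_names mono add scale]:
  assumes "Poly_Mapping.keys p \<subseteq> M"
    and "\<And>m. m \<in> M \<Longrightarrow> P (mono_elem m)"
    and "\<And>p q. P p \<Longrightarrow> P q \<Longrightarrow> P (p + q)"
    and "\<And>c p. P p \<Longrightarrow> P (fscale c p)"
    and "P 0"
  shows "P p"
proof -
  have "P (\<Sum>m\<in>K. fscale (Poly_Mapping.lookup p m) (mono_elem m))" if "finite K" "K \<subseteq> M" for K
    using that by (induction K) (auto intro: assms)
  from this[OF finite_keys assms(1)] show ?thesis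
    using poly_eq_sum_mono_elem[of p] by simp
qed

locale based_graded_algebra = Z2_graded_algebra s G
  for s :: "'f::field \<Rightarrow> 'w::ring_1 \<Rightarrow> 'w" and G +
  fixes B :: "'w set"
  assumes independent_B: "independent B" and span_B: "span B = UNIV" and one_in_B: "1 \<in> B"
begin

text \<open>
  The linear map with prescribed values \<open>k\<close> on the basis \<open>B\<close>, with values in an arbitrary vector space.
  The product of two monomials is of this form in the coefficient at which they meet.
\<close>

definition basis_ext :: "('f \<Rightarrow> 'v \<Rightarrow> 'v) \<Rightarrow> ('w \<Rightarrow> 'v) \<Rightarrow> 'w \<Rightarrow> 'v::ab_group_add" where
  "basis_ext sc k x =
     (\<Sum>b | representation B x b \<noteq> 0. sc (representation B x b) (k b))"

lemma basis_ext_superset: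
  assumes "vector_space sc" "finite K" "{b. representation B x b \<noteq> 0} \<subseteq> K"
  shows "basis_ext sc k x = (\<Sum>b\<in>K. sc (representation B x b) (k b))"
proof -
  interpret T: vector_space sc by fact
  show ?thesis
    unfolding basis_ext_def using assms(2,3) by (intro sum.mono_neutral_left) auto
qed

lemma basis_ext_add:
  assumes "vector_space sc"
  shows "basis_ext sc k (x + y) = basis_ext sc k x + basis_ext sc k y"
proof -
  interpret T: vector_space sc by fact
  let ?K = "{b. representation B x b \<noteq> 0} \<union> {b. representation B y b \<noteq> 0}"
  have rep: "representation B (x + y) b = representation B x b + representation B y b" for b
    using representation_add[OF independent_B, of y x] by (simp add: span_B)
  have K: "finite ?K" by (simp add: finite_representation)
  have sub: "{b. representation B (x + y) b \<noteq> 0} \<subseteq> ?K" by (auto simp: rep)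
  show ?thesis
    by (simp add: basis_ext_superset[OF assms K sub] basis_ext_superset[OF assms K Un_upper1]
        basis_ext_superset[OF assms K Un_upper2] rep T.scale_left_distrib sum.distrib)
qed

lemma basis_ext_scale:
  assumes "vector_space sc"
  shows "basis_ext sc k (s c x) = sc c (basis_ext sc k x)"
proof -
  interpret T: vector_space sc by fact
  have rep: "representation B (s c x) b = c * representation B x b" for b
    using representation_scale[OF independent_B, of x c] by (simp add: span_B)
  have "basis_ext sc k (s c x) =
      (\<Sum>b | representation B x b \<noteq> 0. sc (representation B (s c x) b) (k b))"
    by (rule basis_ext_superset[OF assms]) (auto simp: finite_representation rep)
  then show ?thesis by (simp add: rep basis_ext_def T.scale_sum_right)
qed

lemma basis_ext_linear:
  assumes "vector_space sc"
    and add: "\<And>x y. f (x + y) = f x + f y" and scale: "\<And>c x. f (s c x) = sc c (f x)"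
  shows "basis_ext sc f x = f x"
proof -
  interpret T: vector_space sc by fact
  have f0: "f 0 = 0" using scale[of 0 0] by simp
  have "(\<Sum>b\<in>K. sc (representation B x b) (f b)) = f (\<Sum>b\<in>K. s (representation B x b) b)"
    if "finite K" for K
    using that by (induction K) (auto simp: add scale f0)
  then show ?thesis
    using sum_nonzero_representation_eq[OF independent_B, of x]
    by (simp add: basis_ext_def finite_representation span_B)
qed

lemma basis_ext_basis:
  assumes "vector_space sc" "b \<in> B"
  shows "basis_ext sc k b = k b"
proof -
  interpret T: vector_space sc by fact
  have "{c. representation B b c \<noteq> 0} = {b}"
    using representation_basis[OF independent_B assms(2)] by auto
  then show ?thesis
    using representation_basis[OF independent_B assms(2)] by (simp add: basis_ext_def)
qed

text \<open>
  In a product of three factors both junctions are expanded in the basis; associativity amounts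
  to the independence of the order of the two expansions.
\<close>

lemma basis_ext_swap:
  assumes "vector_space sc"
  shows "basis_ext sc (\<lambda>b. basis_ext sc (k b) y) x = basis_ext sc (\<lambda>c. basis_ext sc (\<lambda>b. k b c) x) y"
proof -
  interpret T: vector_space sc by fact
  show ?thesis
    unfolding basis_ext_def T.scale_sum_right
    by (subst sum.swap) (intro sum.cong refl T.scale_left_commute)
qed

text \<open>
  Expanding a coefficient, acting by a linear map and expanding again is the same as expanding once
  at the end. This is what makes successive products at the same position associative.
\<close>

lemma basis_ext_comp:
  assumes "vector_space sc"
    and "\<And>x y. f (x + y) = f x + f y" and "\<And>c x. f (s c x) = s c (f x)"
  shows "basis_ext sc (\<lambda>b. basis_ext sc k (f b)) x = basis_ext sc k (f x)"
  by (rule basis_ext_linear) (simp_all add: assms basis_ext_add basis_ext_scale)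

lemma expand_eq_basis_ext: "expand s B h x = basis_ext fscale (\<lambda>b. mono_elem (h b)) x"
  by (simp add: expand_def basis_ext_def fscale_mono_elem)

lemma lin_ext_basis_ext:
  "lin_ext g (basis_ext fscale k x) = basis_ext fscale (\<lambda>b. lin_ext g (k b)) x"
  by (simp add: basis_ext_def lin_ext_sum lin_ext_fscale)

end

section \<open>Algebras with an action\<close>

text \<open>
  The linearity laws are imposed on the whole ambient type, the multiplicative laws on the carrier
  only: on monomials without variables the operations of the free algebra have no meaning.
\<close>

locale W_algebra = based_graded_algebra s G B + A: vector_space "smult A"
  for s :: "'f::field \<Rightarrow> 'w::ring_1 \<Rightarrow> 'w" and G B
    and A :: "('f, 'w, 'a::ab_group_add) gw_algebra" +
  assumes mult_add_left: "mult A (x + y) z = mult A x z + mult A y z"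
    and mult_add_right: "mult A z (x + y) = mult A z x + mult A z y"
    and mult_smult_left: "mult A (smult A c x) z = smult A c (mult A x z)"
    and mult_smult_right: "mult A z (smult A c x) = smult A c (mult A z x)"
    and lact_add_left: "lact A (a + b) x = lact A a x + lact A b x"
    and lact_add_right: "lact A a (x + y) = lact A a x + lact A a y"
    and lact_smult_left: "lact A (s c a) x = smult A c (lact A a x)"
    and lact_smult_right: "lact A a (smult A c x) = smult A c (lact A a x)"
    and ract_add_left: "ract A (x + y) a = ract A x a + ract A y a"
    and ract_add_right: "ract A x (a + b) = ract A x a + ract A x b"
    and ract_smult_left: "ract A (smult A c x) a = smult A c (ract A x a)"
    and ract_smult_right: "ract A x (s c a) = smult A c (ract A x a)"
    and subspace_carr: "A.subspace (carr A)"
    and mult_closed: "x \<in> carr A \<Longrightarrow> y \<in> carr A \<Longrightarrow> mult A x y \<in> carr A"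
    and lact_closed: "x \<in> carr A \<Longrightarrow> lact A a x \<in> carr A"
    and ract_closed: "x \<in> carr A \<Longrightarrow> ract A x a \<in> carr A"
    and mult_assoc_carr: "x \<in> carr A \<Longrightarrow> y \<in> carr A \<Longrightarrow> z \<in> carr A \<Longrightarrow>
          mult A (mult A x y) z = mult A x (mult A y z)"
    and lact_lact: "x \<in> carr A \<Longrightarrow> lact A a (lact A b x) = lact A (a * b) x"
    and ract_ract: "x \<in> carr A \<Longrightarrow> ract A (ract A x a) b = ract A x (a * b)"
    and lact_ract: "x \<in> carr A \<Longrightarrow> lact A a (ract A x b) = ract A (lact A a x) b"
    and lact_mult: "x \<in> carr A \<Longrightarrow> y \<in> carr A \<Longrightarrow> lact A a (mult A x y) = mult A (lact A a x) y"
    and ract_mult: "x \<in> carr A \<Longrightarrow> y \<in> carr A \<Longrightarrow> ract A (mult A x y) a = mult A x (ract A y a)"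
    and mult_ract_lact: "x \<in> carr A \<Longrightarrow> y \<in> carr A \<Longrightarrow>
          mult A (ract A x a) y = mult A x (lact A a y)"
    and lact_one: "x \<in> carr A \<Longrightarrow> lact A 1 x = x"
    and ract_one: "x \<in> carr A \<Longrightarrow> ract A x 1 = x"

context based_graded_algebra
begin

lemma flact_mono_elem: 
  "flact s B x (mono_elem (Mono a us)) = basis_ext fscale (\<lambda>b. mono_elem (Mono b us)) (x * a)"
  by (simp add: flact_def expand_eq_basis_ext)

lemma fract_mono_elem: 
  "fract s B (mono_elem (Mono a (us @ [(u, b)]))) x =
     basis_ext fscale (\<lambda>c. mono_elem (Mono a (us @ [(u, c)]))) (b * x)"
  by (simp add: fract_def expand_eq_basis_ext)

lemma fmult_mono_elem: 
  "fmult s B (mono_elem (Mono a (us @ [(u, b)]))) (mono_elem (Mono a' vs)) =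
     basis_ext fscale (\<lambda>c. mono_elem (Mono a (us @ (u, c) # vs))) (b * a')"
  by (simp add: fmult_def expand_eq_basis_ext)

text \<open>
  Variants in which the first factor is already in the form produced by an earlier product, with a
  variable and its coefficient singled out in the middle.
\<close>

lemma fmult_mono_elem': 
  "fmult s B (mono_elem (Mono a (us @ (u0, b0) # us' @ [(u, b)]))) (mono_elem (Mono a' vs)) =
     basis_ext fscale (\<lambda>c. mono_elem (Mono a (us @ (u0, b0) # us' @ (u, c) # vs))) (b * a')"
  using fmult_mono_elem[of a "us @ (u0, b0) # us'"] by simp

lemma fract_mono_elem': 
  "fract s B (mono_elem (Mono a (us @ (u0, b0) # us' @ [(u, b)]))) x =
     basis_ext fscale (\<lambda>c. mono_elem (Mono a (us @ (u0, b0) # us' @ [(u, c)]))) (b * x)"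
  using fract_mono_elem[of a "us @ (u0, b0) # us'"] by simp

lemmas basis_ext_fscale_comp = basis_ext_comp[OF fscale.vector_space_axioms]

lemma flact_basis_ext:
  "flact s B x (basis_ext fscale k y) = basis_ext fscale (\<lambda>b. flact s B x (k b)) y"
  by (simp add: flact_def lin_ext_basis_ext)

lemma fract_basis_ext:
  "fract s B (basis_ext fscale k y) x = basis_ext fscale (\<lambda>b. fract s B (k b) x) y"
  by (simp add: fract_def lin_ext_basis_ext)

lemma fmult_basis_ext_left:
  "fmult s B (basis_ext fscale k y) x = basis_ext fscale (\<lambda>b. fmult s B (k b) x) y"
  by (simp add: fmult_def lin_ext_basis_ext)

lemma fmult_add_right: "fmult s B x (y + z) = fmult s B x y + fmult s B x z"
  by (simp add: fmult_def lin_ext_add lin_ext_add_fun)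

lemma fmult_fscale_right: "fmult s B x (fscale c y) = fscale c (fmult s B x y)"
  by (simp add: fmult_def lin_ext_fscale lin_ext_fscale_fun)

lemma fmult_add_left: "fmult s B (x + y) z = fmult s B x z + fmult s B y z"
  by (simp add: fmult_def lin_ext_add)

lemma fmult_fscale_left: "fmult s B (fscale c x) y = fscale c (fmult s B x y)"
  by (simp add: fmult_def lin_ext_fscale)

lemma fmult_0_right: "fmult s B x 0 = 0"
  using fmult_fscale_right[of x 0 0] by simp

lemma fmult_basis_ext_right:
  "fmult s B x (basis_ext fscale k y) = basis_ext fscale (\<lambda>b. fmult s B x (k b)) y"
proof -
  have "fmult s B x (\<Sum>b\<in>K. fscale (c b) (k b)) = (\<Sum>b\<in>K. fscale (c b) (fmult s B x (k b)))"
    if "finite K" for K c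
    using that by (induction K) (auto simp: fmult_add_right fmult_fscale_right fmult_0_right)
  then show ?thesis by (simp add: basis_ext_def finite_representation)
qed

lemma fract_add_left: "fract s B (x + y) a = fract s B x a + fract s B y a"
  by (simp add: fract_def lin_ext_add)

lemma fract_fscale_left: "fract s B (fscale c x) a = fscale c (fract s B x a)"
  by (simp add: fract_def lin_ext_fscale)

lemma flact_add_right: "flact s B a (x + y) = flact s B a x + flact s B a y"
  by (simp add: flact_def lin_ext_add)

lemma flact_fscale_right: "flact s B a (fscale c x) = fscale c (flact s B a x)"
  by (simp add: flact_def lin_ext_fscale)

lemma flact_0 [simp]: "flact s B a 0 = 0" 
  and fract_0 [simp]: "fract s B 0 a = 0"
  and fmult_0 [simp]: "fmult s B 0 x = 0" "fmult s B x 0 = 0"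
  by (simp_all add: flact_def fract_def fmult_0_right) (simp_all add: fmult_def lin_ext_0)

abbreviation free_carrier :: "('f, 'w) wpoly set" where
  "free_carrier \<equiv> {p. Poly_Mapping.keys p \<subseteq> basis_monos B}"

lemma subspace_free_carrier: "fscale.subspace free_carrier"
  unfolding fscale.subspace_def
  using Poly_Mapping.keys_add keys_fscale by (fastforce simp: subset_iff)

lemma basis_ext_in_free_carrier:
  assumes "\<And>b. b \<in> B \<Longrightarrow> k b \<in> free_carrier"
  shows "basis_ext fscale k x \<in> free_carrier"
  unfolding basis_ext_def
proof (rule fscale.subspace_sum[OF subspace_free_carrier])
  fix b assume "b \<in> {b. representation B x b \<noteq> 0}"
  then have "b \<in> B" using representation_ne_zero by blast
  then show "fscale (representation B x b) (k b) \<in> free_carrier"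
    using assms fscale.subspace_scale[OF subspace_free_carrier] by blast
qed

lemma basis_monosE:
  assumes "m \<in> basis_monos B"
  obtains a us u b where "m = Mono a (us @ [(u, b)])" "a \<in> B" "b \<in> B" "snd ` set us \<subseteq> B"
proof -
  from assms obtain a us where m: "m = Mono a us" "us \<noteq> []" "a \<in> B" "snd ` set us \<subseteq> B"
    by (auto simp: basis_monos_def)
  then obtain us' u b where "us = us' @ [(u, b)]" by (metis rev_exhaust surj_pair)
  with m that[of a us' u b] show ?thesis by auto
qed

text \<open>
  All laws of the free algebra are linear in each argument, so they need only be checked on basis
  monomials; the last variable is exposed, since products change the coefficient following it.
\<close>

lemma free_carrier_induct [consumes 1, case_names mono add scale zero]:
  assumes "x \<in> free_carrier"
    and "\<And>a us u b. a \<in> B \<Longrightarrow> b \<in> B \<Longrightarrow> snd ` set us \<subseteq> B \<Longrightarrow> P (mono_elem (Mono a (us @ [(u, b)])))"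
    and "\<And>p q. P p \<Longrightarrow> P q \<Longrightarrow> P (p + q)"
    and "\<And>c p. P p \<Longrightarrow> P (fscale c p)"
    and "P 0"
  shows "P x"
proof (rule linear_induct[of x "basis_monos B" P])
  show "Poly_Mapping.keys x \<subseteq> basis_monos B" using assms(1) by simp
  show "P (mono_elem m)" if "m \<in> basis_monos B" for m
    using that by (elim basis_monosE) (auto intro: assms)
qed (auto intro: assms)

lemma Mono_in_basis_monos:
  "Mono a us \<in> basis_monos B \<longleftrightarrow> us \<noteq> [] \<and> a \<in> B \<and> snd ` set us \<subseteq> B"
  by (auto simp: basis_monos_def)

lemmas free_linear = fmult_add_left fmult_add_right fmult_fscale_left fmult_fscale_right
  flact_add_right flact_fscale_right fract_add_left fract_fscale_left

lemmas free_carrier_closed = fscale.subspace_add[OF subspace_free_carrier]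
  fscale.subspace_scale[OF subspace_free_carrier] fscale.subspace_0[OF subspace_free_carrier]
lemmas free_zero = flact_0 fract_0 fmult_0

lemma flact_closed: "x \<in> free_carrier \<Longrightarrow> flact s B a x \<in> free_carrier"
proof (induction x rule: free_carrier_induct)
  case (mono b us u c)
  then show ?case unfolding flact_mono_elem
    by (intro basis_ext_in_free_carrier) (auto simp: Mono_in_basis_monos)
qed (simp_all only: free_linear free_zero free_carrier_closed)

lemma fract_closed: "x \<in> free_carrier \<Longrightarrow> fract s B x a \<in> free_carrier"
proof (induction x rule: free_carrier_induct)
  case (mono b us u c)
  then show ?case unfolding fract_mono_elem
    by (intro basis_ext_in_free_carrier) (auto simp: Mono_in_basis_monos)
qed (simp_all only: free_linear free_zero free_carrier_closed)

lemma fmult_closed: "x \<in> free_carrier \<Longrightarrow> y \<in> free_carrier \<Longrightarrow> fmult s B x y \<in> free_carrier"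
proof (induction x rule: free_carrier_induct)
  case (mono a us u b)
  note x = mono(1-3)
  from mono(4) show ?case
  proof (induction y rule: free_carrier_induct)
    case (mono a' vs v c)
    with x show ?case unfolding fmult_mono_elem
      by (intro basis_ext_in_free_carrier) (auto simp: Mono_in_basis_monos)
  qed (simp_all only: free_linear free_zero free_carrier_closed)
qed (simp_all only: free_linear free_zero free_carrier_closed)

lemmas mono_elem_ops = flact_mono_elem fract_mono_elem fract_mono_elem' fmult_mono_elem
  fmult_mono_elem' flact_basis_ext fract_basis_ext fmult_basis_ext_left fmult_basis_ext_right

lemma fmult_assoc:
  assumes "x \<in> free_carrier" "y \<in> free_carrier" "z \<in> free_carrier"
  shows "fmult s B (fmult s B x y) z = fmult s B x (fmult s B y z)"
  using assms
proof (induction x rule: free_carrier_induct)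
  case (mono a1 us1 u1 b1)
  note prems1 = mono
  from prems1(4,5) show ?case
  proof (induction y rule: free_carrier_induct)
    case (mono a2 us2 u2 b2)
    from mono(4) show ?case
    proof (induction z rule: free_carrier_induct)
      case (mono a3 us3 u3 b3)
      show ?case
        by (simp add: mono_elem_ops basis_ext_swap[OF fscale.vector_space_axioms, of _ "b2 * a3" "b1 * a2"])
    qed (auto simp: free_linear)
  qed (auto simp: free_linear)
qed (auto simp: free_linear)

lemma flact_flact:
  assumes "x \<in> free_carrier"
  shows "flact s B a (flact s B b x) = flact s B (a * b) x"
  using assms
  by (induction x rule: free_carrier_induct)
    (auto simp: free_linear mono_elem_ops basis_ext_fscale_comp distrib_left mult_scale_right mult.assoc)

lemma fract_fract:
  assumes "x \<in> free_carrier"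
  shows "fract s B (fract s B x a) b = fract s B x (a * b)"
  using assms
  by (induction x rule: free_carrier_induct)
    (auto simp: free_linear mono_elem_ops basis_ext_fscale_comp distrib_right mult_scale_left mult.assoc)

lemma flact_fract:
  assumes "x \<in> free_carrier"
  shows "flact s B a (fract s B x b) = fract s B (flact s B a x) b"
  using assms
proof (induction x rule: free_carrier_induct)
  case (mono a' us u b')
  show ?case
    by (simp add: mono_elem_ops basis_ext_swap[OF fscale.vector_space_axioms, of _ "a * a'" "b' * b"])
qed (auto simp: free_linear)

lemma flact_fmult:
  assumes "x \<in> free_carrier" "y \<in> free_carrier"
  shows "flact s B a (fmult s B x y) = fmult s B (flact s B a x) y"
  using assms
proof (induction x rule: free_carrier_induct)
  case (mono a1 us1 u1 b1)
  from mono(4) show ?case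
  proof (induction y rule: free_carrier_induct)
    case (mono a2 us2 u2 b2)
    show ?case
      by (simp add: mono_elem_ops basis_ext_swap[OF fscale.vector_space_axioms, of _ "a * a1" "b1 * a2"])
  qed (auto simp: free_linear)
qed (auto simp: free_linear)

lemma fract_fmult:
  assumes "x \<in> free_carrier" "y \<in> free_carrier"
  shows "fract s B (fmult s B x y) a = fmult s B x (fract s B y a)"
  using assms
proof (induction x rule: free_carrier_induct)
  case (mono a1 us1 u1 b1)
  from mono(4) show ?case
  proof (induction y rule: free_carrier_induct)
    case (mono a2 us2 u2 b2)
    show ?case
      by (simp add: mono_elem_ops basis_ext_swap[OF fscale.vector_space_axioms, of _ "b2 * a" "b1 * a2"])
  qed (auto simp: free_linear)
qed (auto simp: free_linear)

lemma fmult_fract_flact: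
  assumes "x \<in> free_carrier" "y \<in> free_carrier"
  shows "fmult s B (fract s B x a) y = fmult s B x (flact s B a y)"
  using assms
proof (induction x rule: free_carrier_induct)
  case (mono a1 us1 u1 b1)
  from mono(4) show ?case
  proof (induction y rule: free_carrier_induct)
    case (mono a2 us2 u2 b2)
    show ?case
      by (simp add: mono_elem_ops basis_ext_fscale_comp[where f="\<lambda>c. c * a2"]
        basis_ext_fscale_comp[where f="\<lambda>c. b1 * c"]
        distrib_right distrib_left mult_scale_left mult_scale_right mult.assoc)
  qed (auto simp: free_linear)
qed (auto simp: free_linear)

lemma flact_one: "x \<in> free_carrier \<Longrightarrow> flact s B 1 x = x"
  by (induction x rule: free_carrier_induct)
    (auto simp: free_linear mono_elem_ops basis_ext_basis[OF fscale.vector_space_axioms])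

lemma fract_one: "x \<in> free_carrier \<Longrightarrow> fract s B x 1 = x"
  by (induction x rule: free_carrier_induct)
    (auto simp: free_linear mono_elem_ops basis_ext_basis[OF fscale.vector_space_axioms])

lemma flact_add_left: "flact s B (a + b) x = flact s B a x + flact s B b x"
proof -
  have "lact_mono s B (a + b) m = lact_mono s B a m + lact_mono s B b m" for m
    by (cases m) (simp add: expand_eq_basis_ext distrib_right basis_ext_add fscale.vector_space_axioms)
  then show ?thesis unfolding flact_def lin_ext_add_fun[symmetric] by presburger
qed

lemma flact_scale_left: "flact s B (s c a) x = fscale c (flact s B a x)"
proof -
  have "lact_mono s B (s c a) m = fscale c (lact_mono s B a m)" for m
    by (cases m) (simp add: expand_eq_basis_ext mult_scale_left basis_ext_scale fscale.vector_space_axioms)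
  then show ?thesis unfolding flact_def lin_ext_fscale_fun[symmetric] by presburger
qed

lemma fract_add_right: "fract s B x (a + b) = fract s B x a + fract s B x b"
proof -
  have "ract_mono s B m (a + b) = ract_mono s B m a + ract_mono s B m b" for m
    by (cases m) (simp add: expand_eq_basis_ext distrib_left basis_ext_add fscale.vector_space_axioms)
  then show ?thesis unfolding fract_def by (simp add: lin_ext_add_fun[symmetric])
qed

lemma fract_scale_right: "fract s B x (s c a) = fscale c (fract s B x a)"
proof -
  have "ract_mono s B m (s c a) = fscale c (ract_mono s B m a)" for m
    by (cases m) (simp add: expand_eq_basis_ext mult_scale_right basis_ext_scale fscale.vector_space_axioms)
  then show ?thesis unfolding fract_def by (simp add: lin_ext_fscale_fun[symmetric])
qed

lemma free_gw_simps [simp]: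
  "carr (free_gw s G B) = free_carrier" "smult (free_gw s G B) = fscale"
  "mult (free_gw s G B) = fmult s B" "lact (free_gw s G B) = flact s B"
  "ract (free_gw s G B) = fract s B"
  by (simp_all add: free_gw_def)

lemma free_W_algebra: "W_algebra s G B (free_gw s G B)"
  by unfold_locales
    (use subspace_free_carrier in \<open>simp_all add: free_linear flact_add_left flact_scale_left
      fract_add_right fract_scale_right fmult_closed[simplified] flact_closed[simplified]
      fract_closed[simplified] fmult_assoc flact_flact fract_fract flact_fract flact_fmult
      fract_fmult fmult_fract_flact flact_one fract_one fscale.scale_right_distrib
      fscale.scale_left_distrib\<close>)

end

text \<open>
  Sums of degrees are to remain sums, subject to the laws of addition, and not become bit operations.
\<close>

declare add_bit_eq_xor [simp del]

section \<open>Evaluation of monomials\<close>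

text \<open>
  The value of a monomial with its leading coefficient removed, bracketed to the right. This
  form splits at any position of the monomial, unlike the left-bracketed \<open>mono_value\<close>.
\<close>

fun tail_value :: "('a \<Rightarrow> 'a \<Rightarrow> 'a) \<Rightarrow> ('a \<Rightarrow> 'w \<Rightarrow> 'a) \<Rightarrow> (gvar \<Rightarrow> 'a) \<Rightarrow> (gvar \<times> 'w) list \<Rightarrow> 'a::zero"
  where
  "tail_value mu r \<theta> [] = 0"
| "tail_value mu r \<theta> [(u, b)] = r (\<theta> u) b"
| "tail_value mu r \<theta> ((u, b) # v # vs) = mu (r (\<theta> u) b) (tail_value mu r \<theta> (v # vs))"

context W_algebra
begin

abbreviation tv :: "(gvar \<Rightarrow> 'a) \<Rightarrow> (gvar \<times> 'w) list \<Rightarrow> 'a" where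
  "tv \<equiv> tail_value (mult A) (ract A)"

abbreviation mv :: "(gvar \<Rightarrow> 'a) \<Rightarrow> 'w gmono \<Rightarrow> 'a" where
  "mv \<equiv> mono_value (mult A) (lact A) (ract A)"

lemma tail_value_closed:
  assumes "\<And>u. \<theta> u \<in> carr A"
  shows "tv \<theta> us \<in> carr A"
  using assms A.subspace_0[OF subspace_carr]
  by (induction "mult A" "ract A" \<theta> us rule: tail_value.induct) (auto intro: mult_closed ract_closed)

lemma tail_value_Cons:
  "us \<noteq> [] \<Longrightarrow> tv \<theta> ((u, b) # us) = mult A (ract A (\<theta> u) b) (tv \<theta> us)"
  by (cases us) auto

lemma tail_value_append:
  assumes "\<And>u. \<theta> u \<in> carr A" "us \<noteq> []" "vs \<noteq> []"
  shows "tv \<theta> (us @ vs) = mult A (tv \<theta> us) (tv \<theta> vs)"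
  using assms(2)
proof (induction us)
  case (Cons x us)
  obtain u b where "x = (u, b)" by fastforce
  with Cons show ?case
    by (cases "us = []")
      (auto simp: tail_value_Cons assms(1,3) mult_assoc_carr ract_closed tail_value_closed[OF assms(1)])
qed simp

lemma tail_value_snoc:
  assumes "\<And>u. \<theta> u \<in> carr A"
  shows "tv \<theta> (us @ [(u, c * d)]) = ract A (tv \<theta> (us @ [(u, c)])) d"
  using assms
  by (cases "us = []")
    (auto simp: tail_value_append ract_ract ract_mult tail_value_closed ract_closed)

lemma mono_value_eq_tail_value:
  assumes "\<And>u. \<theta> u \<in> carr A" "us \<noteq> []"
  shows "mv \<theta> (Mono a us) = lact A a (tv \<theta> us)"
proof -
  have fold: "foldl (\<lambda>x (v, c). mult A x (ract A (\<theta> v) c)) x vs =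
      (if vs = [] then x else mult A x (tv \<theta> vs))" if "x \<in> carr A" for x vs
    using that
  proof (induction vs arbitrary: x)
    case (Cons y vs)
    obtain v c where y: "y = (v, c)" by fastforce
    have "mult A x (ract A (\<theta> v) c) \<in> carr A"
      using Cons.prems assms(1) by (simp add: mult_closed ract_closed)
    from Cons.IH[OF this] show ?case
      by (simp add: y tail_value_Cons mult_assoc_carr assms(1) Cons.prems ract_closed
          tail_value_closed[OF assms(1)])
  qed simp
  obtain u b vs where us: "us = (u, b) # vs" using assms(2) by (metis list.exhaust surj_pair)
  show ?thesis
    using fold[of "lact A a (ract A (\<theta> u) b)" vs] assms(1)
    by (auto simp: us tail_value_Cons lact_closed ract_closed lact_mult
        tail_value_closed[OF assms(1)])
qed

lemma mono_value_closed:
  assumes "\<And>u. \<theta> u \<in> carr A"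
  shows "mv \<theta> m \<in> carr A"
proof (cases m)
  case (Mono a us)
  then show ?thesis
    using assms A.subspace_0[OF subspace_carr]
    by (cases "us = []") (auto simp: mono_value_eq_tail_value lact_closed tail_value_closed)
qed

lemma mono_value_lact:
  assumes "\<And>u. \<theta> u \<in> carr A" "us \<noteq> []"
  shows "lact A x (mv \<theta> (Mono a us)) = mv \<theta> (Mono (x * a) us)"
  using assms by (simp add: mono_value_eq_tail_value lact_lact tail_value_closed)

lemma mono_value_ract:
  assumes "\<And>u. \<theta> u \<in> carr A"
  shows "ract A (mv \<theta> (Mono a (us @ [(u, b)]))) x = mv \<theta> (Mono a (us @ [(u, b * x)]))"
  using assms by (simp add: mono_value_eq_tail_value lact_ract[symmetric] tail_value_closed tail_value_snoc)

text \<open>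
  The coefficients at the junction may be multiplied in the acting algebra before evaluation. As the
  value is also linear in this coefficient, it is unaffected by the expansion in the basis that the
  free product performs; therefore evaluation is multiplicative.
\<close>

lemma mono_value_mult:
  assumes \<theta>: "\<And>u. \<theta> u \<in> carr A" and vs: "vs \<noteq> []"
  shows "mult A (mv \<theta> (Mono a (us @ [(u, b)]))) (mv \<theta> (Mono a' vs)) =
    mv \<theta> (Mono a (us @ (u, b * a') # vs))"
proof -
  have "us @ (u, b * a') # vs = (us @ [(u, b * a')]) @ vs" by simp
  then have "tv \<theta> (us @ (u, b * a') # vs) = mult A (tv \<theta> (us @ [(u, b)])) (lact A a' (tv \<theta> vs))"
    using tail_value_append[of \<theta> "us @ [(u, b * a')]" vs] \<theta> vs
    by (simp add: tail_value_snoc mult_ract_lact tail_value_closed)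
  then show ?thesis
    using \<theta> vs by (simp add: mono_value_eq_tail_value lact_mult[symmetric] tail_value_closed lact_closed)
qed

lemma mono_value_head_linear:
  assumes "\<And>u. \<theta> u \<in> carr A" "us \<noteq> []"
  shows "mv \<theta> (Mono (a + b) us) = mv \<theta> (Mono a us) + mv \<theta> (Mono b us)"
    and "mv \<theta> (Mono (s c a) us) = smult A c (mv \<theta> (Mono a us))"
  using assms by (simp_all add: mono_value_eq_tail_value lact_add_left lact_smult_left)

lemma tail_value_snoc_one:
  assumes "\<And>u. \<theta> u \<in> carr A"
  shows "tv \<theta> (us @ [(u, b)]) = ract A (tv \<theta> (us @ [(u, 1)])) b"
  using tail_value_snoc[of \<theta> us u 1 b] assms by simp

lemma mono_value_last_linear:
  assumes "\<And>u. \<theta> u \<in> carr A"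
  shows "mv \<theta> (Mono a (us @ [(u, b + b')])) = mv \<theta> (Mono a (us @ [(u, b)])) + mv \<theta> (Mono a (us @ [(u, b')]))"
    and "mv \<theta> (Mono a (us @ [(u, s c b)])) = smult A c (mv \<theta> (Mono a (us @ [(u, b)])))"
  using assms
  by (simp_all add: mono_value_eq_tail_value tail_value_snoc_one[of \<theta> us u "b + b'"]
      tail_value_snoc_one[of \<theta> us u b] tail_value_snoc_one[of \<theta> us u b']
      tail_value_snoc_one[of \<theta> us u "s c b"]
      ract_add_right ract_smult_right lact_add_right lact_smult_right)

lemma mono_value_middle_linear:
  assumes "\<And>u. \<theta> u \<in> carr A" "vs \<noteq> []"
  shows "mv \<theta> (Mono a (us @ (u, b + b') # vs)) =
      mv \<theta> (Mono a (us @ (u, b) # vs)) + mv \<theta> (Mono a (us @ (u, b') # vs))"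
    and "mv \<theta> (Mono a (us @ (u, s c b) # vs)) = smult A c (mv \<theta> (Mono a (us @ (u, b) # vs)))"
proof -
  have eq: "mv \<theta> (Mono a (us @ (u, b) # vs)) =
      mult A (mv \<theta> (Mono a (us @ [(u, b)]))) (mv \<theta> (Mono 1 vs))" for b
    using mono_value_mult[of \<theta> vs a us u b 1] assms by simp
  show "mv \<theta> (Mono a (us @ (u, b + b') # vs)) =
      mv \<theta> (Mono a (us @ (u, b) # vs)) + mv \<theta> (Mono a (us @ (u, b') # vs))"
    "mv \<theta> (Mono a (us @ (u, s c b) # vs)) = smult A c (mv \<theta> (Mono a (us @ (u, b) # vs)))"
    unfolding eq using assms(1) by (simp_all add: mono_value_last_linear mult_add_left mult_smult_left)
qed

lemma wpoly_value_add: "wpoly_value A \<theta> (p + q) = wpoly_value A \<theta> p + wpoly_value A \<theta> q"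
  unfolding wpoly_value_def by (rule sum_over_keys_add) unfold_locales

lemma wpoly_value_fscale: "wpoly_value A \<theta> (fscale c p) = smult A c (wpoly_value A \<theta> p)"
  unfolding wpoly_value_def by (rule sum_over_keys_fscale) unfold_locales

lemma wpoly_value_0: "wpoly_value A \<theta> 0 = 0"
  by (simp add: wpoly_value_def)

lemma wpoly_value_sum: "wpoly_value A \<theta> (sum f S) = (\<Sum>x\<in>S. wpoly_value A \<theta> (f x))"
  by (induction S rule: infinite_finite_induct) (auto simp: wpoly_value_add wpoly_value_0)

lemma wpoly_value_mono_elem: "wpoly_value A \<theta> (mono_elem m) = mv \<theta> m"
  by (simp add: wpoly_value_def)

lemma wpoly_value_basis_ext:
  "wpoly_value A \<theta> (basis_ext fscale k x) = basis_ext (smult A) (\<lambda>b. wpoly_value A \<theta> (k b)) x"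
  by (simp add: basis_ext_def wpoly_value_sum wpoly_value_fscale)

lemma wpoly_value_closed:
  assumes "\<And>u. \<theta> u \<in> carr A"
  shows "wpoly_value A \<theta> p \<in> carr A"
  unfolding wpoly_value_def
  by (intro A.subspace_sum[OF subspace_carr] A.subspace_scale[OF subspace_carr] mono_value_closed assms)

lemmas action_linear = mult_add_left mult_add_right mult_smult_left mult_smult_right
  lact_add_right lact_smult_right ract_add_left ract_smult_left

lemma action_zero [simp]: "mult A 0 x = 0" "mult A x 0 = 0" "lact A a 0 = 0" "ract A 0 a = 0"
  using mult_smult_left[of 0 0 x] mult_smult_right[of x 0 0] lact_smult_right[of a 0 0]
    ract_smult_left[of 0 0 a] by simp_all

lemma wpoly_value_lact:
  assumes "\<And>u. \<theta> u \<in> carr A" "p \<in> free_carrier"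
  shows "wpoly_value A \<theta> (flact s B x p) = lact A x (wpoly_value A \<theta> p)"
  using assms(2)
proof (induction p rule: free_carrier_induct)
  case (mono a us u b)
  have "basis_ext (smult A) (\<lambda>b'. mv \<theta> (Mono b' (us @ [(u, b)]))) (x * a) = mv \<theta> (Mono (x * a) (us @ [(u, b)]))"
    by (rule basis_ext_linear) (simp_all add: mono_value_head_linear assms(1) A.vector_space_axioms)
  then show ?case
    using assms(1) by (simp add: flact_mono_elem wpoly_value_basis_ext wpoly_value_mono_elem mono_value_lact)
qed (simp_all add: wpoly_value_add wpoly_value_fscale wpoly_value_0 free_linear action_linear)

lemma wpoly_value_ract:
  assumes "\<And>u. \<theta> u \<in> carr A" "p \<in> free_carrier"
  shows "wpoly_value A \<theta> (fract s B p x) = ract A (wpoly_value A \<theta> p) x"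
  using assms(2)
proof (induction p rule: free_carrier_induct)
  case (mono a us u b)
  have "basis_ext (smult A) (\<lambda>b'. mv \<theta> (Mono a (us @ [(u, b')]))) (b * x) = mv \<theta> (Mono a (us @ [(u, b * x)]))"
    by (rule basis_ext_linear) (simp_all add: mono_value_last_linear assms(1) A.vector_space_axioms)
  then show ?case
    using assms(1) by (simp add: fract_mono_elem wpoly_value_basis_ext wpoly_value_mono_elem mono_value_ract)
qed (simp_all add: wpoly_value_add wpoly_value_fscale wpoly_value_0 free_linear action_linear)

lemma wpoly_value_mult:
  assumes "\<And>u. \<theta> u \<in> carr A" "p \<in> free_carrier" "q \<in> free_carrier"
  shows "wpoly_value A \<theta> (fmult s B p q) = mult A (wpoly_value A \<theta> p) (wpoly_value A \<theta> q)"
  using assms(2,3)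
proof (induction p rule: free_carrier_induct)
  case (mono a us u b)
  from mono(4) show ?case
  proof (induction q rule: free_carrier_induct)
    case (mono a' vs v b')
    let ?vs = "vs @ [(v, b')]"
    have "basis_ext (smult A) (\<lambda>c. mv \<theta> (Mono a (us @ (u, c) # ?vs))) (b * a') =
        mv \<theta> (Mono a (us @ (u, b * a') # ?vs))"
      by (rule basis_ext_linear) (simp_all add: mono_value_middle_linear assms(1) A.vector_space_axioms)
    then show ?case
      using assms(1)
      by (simp add: fmult_mono_elem wpoly_value_basis_ext wpoly_value_mono_elem mono_value_mult)
  qed (simp_all add: wpoly_value_add wpoly_value_fscale wpoly_value_0 free_linear action_linear)
qed (simp_all add: wpoly_value_add wpoly_value_fscale wpoly_value_0 free_linear action_linear)

end


section \<open>Gradings and substitutions\<close>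

text \<open>
  The degree bookkeeping of \<open>homogeneous_monos\<close>, in a form suited to induction along the list and to
  concatenation.
\<close>

inductive homogeneous_list :: "(bit \<Rightarrow> 'w set) \<Rightarrow> (gvar \<times> 'w) list \<Rightarrow> bit \<Rightarrow> bool" for G where
  Nil: "homogeneous_list G [] 0"
| Cons: "b \<in> G e \<Longrightarrow> homogeneous_list G us d \<Longrightarrow> homogeneous_list G ((u, b) # us) (vdeg u + e + d)"

lemma homogeneous_list_iff:
  "homogeneous_list G us d \<longleftrightarrow>
     (\<exists>e. (\<forall>k<length us. snd (us ! k) \<in> G (e k)) \<and> d = (\<Sum>k<length us. vdeg (fst (us ! k)) + e k))"
proof (induction us arbitrary: d)
  case Nil
  show ?case by (auto elim: homogeneous_list.cases intro: homogeneous_list.intros)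
next
  case (Cons x us)
  obtain u b where x: "x = (u, b)" by fastforce
  have shift: "(\<Sum>k<length (x # us). vdeg (fst ((x # us) ! k)) + f k) =
      vdeg u + f 0 + (\<Sum>k<length us. vdeg (fst (us ! k)) + f (Suc k))" for f :: "nat \<Rightarrow> bit"
    unfolding list.size(4) add_0_right add_Suc_right One_nat_def sum.lessThan_Suc_shift nth_Cons_0
      nth_Cons_Suc x fst_conv ..
  show ?case (is "?L \<longleftrightarrow> ?R")
  proof
    assume ?L
    then obtain e d' where e: "b \<in> G e" "homogeneous_list G us d'" "d = vdeg u + e + d'"
      by (cases rule: homogeneous_list.cases) (auto simp: x)
    then obtain f where f: "\<forall>k<length us. snd (us ! k) \<in> G (f k)"
      "d' = (\<Sum>k<length us. vdeg (fst (us ! k)) + f k)"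
      using Cons.IH by auto
    show ?R
    proof (intro exI[of _ "case_nat e f"] conjI allI impI)
      show "snd ((x # us) ! k) \<in> G (case k of 0 \<Rightarrow> e | Suc x \<Rightarrow> f x)" if "k < length (x # us)" for k
        using that e f by (cases k) (auto simp: x)
      show "d = (\<Sum>k<length (x # us). vdeg (fst ((x # us) ! k)) + (case k of 0 \<Rightarrow> e | Suc x \<Rightarrow> f x))"
        unfolding shift e(3) f(2) by simp
    qed
  next
    assume ?R
    then obtain e where e: "\<forall>k<length (x # us). snd ((x # us) ! k) \<in> G (e k)"
      "d = (\<Sum>k<length (x # us). vdeg (fst ((x # us) ! k)) + e k)" by blast
    have "homogeneous_list G us (\<Sum>k<length us. vdeg (fst (us ! k)) + e (Suc k))"
      unfolding Cons.IH using e(1) by (intro exI[of _ "\<lambda>k. e (Suc k)"] conjI refl) force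
    moreover have "b \<in> G (e 0)" using e(1) by (force simp: x)
    ultimately show ?L
      unfolding e(2) shift using homogeneous_list.Cons[of b G "e 0" us _ u] by (simp add: x)
  qed
qed

lemma homogeneous_monos_eq:
  "homogeneous_monos G d =
     {Mono a us | a us. us \<noteq> [] \<and> (\<exists>e d'. a \<in> G e \<and> homogeneous_list G us d' \<and> d = e + d')}"
  unfolding homogeneous_monos_def homogeneous_list_iff by blast

lemma homogeneous_list_append:
  "homogeneous_list G us d \<Longrightarrow> homogeneous_list G vs e \<Longrightarrow> homogeneous_list G (us @ vs) (d + e)"
proof (induction rule: homogeneous_list.induct)
  case (Cons b e' us d u)
  then show ?case using homogeneous_list.Cons[of b G e' "us @ vs" "d + e" u] by (simp add: add.assoc)
qed simp

context Z2_graded_algebra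
begin

lemma homogeneous_list_snoc_mult:
  assumes "homogeneous_list G (us @ [(u, b)]) d" "a \<in> G e"
  shows "homogeneous_list G (us @ [(u, b * a)]) (d + e)"
  using assms
proof (induction us arbitrary: d)
  case Nil
  then obtain e' where "b \<in> G e'" "d = vdeg u + e' + 0"
    by (auto elim!: homogeneous_list.cases)
  with Nil(2) show ?case
    using homogeneous_list.Cons[of "b * a" G "e' + e" "[]" 0 u] mult_component[of b e' a e]
    by (simp add: homogeneous_list.Nil add.assoc)
next
  case (Cons x us)
  obtain v c where x: "x = (v, c)" by fastforce
  from Cons(2) obtain e' d' where "c \<in> G e'" "d = vdeg v + e' + d'" "homogeneous_list G (us @ [(u, b)]) d'"
    by (cases rule: homogeneous_list.cases) (auto simp: x)
  with Cons(1,3) show ?case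
    using homogeneous_list.Cons[of c G e' "us @ [(u, b * a)]" "d' + e" v] by (simp add: x add.assoc)
qed

text \<open>
  Right multiplication by the odd part $e_1$ of the unit maps each homogeneous $x$ to
  $x e_1 = x - x e_0$, which is both of the degree of $x$ and of the opposite degree, hence zero.
  Applied to $1 = e_0 + e_1$ this gives $e_1 = 0$.
\<close>

lemma one_in_component: "1 \<in> G 0"
proof -
  obtain e0 e1 where e: "e0 \<in> G 0" "e1 \<in> G 1" "1 = e0 + e1" using components_span by blast
  have hom: "x * e1 = 0" if "x \<in> G d" for x d
  proof -
    have 1: "x * e1 \<in> G (d + 1)" using mult_component[OF that e(2)] .
    have "x * e1 = x - x * e0" using e(3) by (metis add_diff_cancel_left' distrib_left mult.right_neutral)
    moreover have "x * e0 \<in> G d" using mult_component[OF that e(1)] by simp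
    ultimately have 2: "x * e1 \<in> G d" using that subspace_diff[OF subspace_component] by simp
    show ?thesis using 1 2 components_independent by (cases d rule: bit.exhaust) auto
  qed
  have "e1 = e0 * e1 + e1 * e1" using e(3) by (metis distrib_right mult_1)
  then have "e1 = 0" using hom[OF e(1)] hom[OF e(2)] by simp
  with e show ?thesis by simp
qed

end

locale graded_W_algebra = W_algebra +
  assumes subspace_hcomp: "A.subspace (hcomp A d)"
    and hcomp_subset: "hcomp A d \<subseteq> carr A"
    and mult_hcomp: "x \<in> hcomp A d \<Longrightarrow> y \<in> hcomp A e \<Longrightarrow> mult A x y \<in> hcomp A (d + e)"
    and lact_hcomp: "a \<in> G d \<Longrightarrow> x \<in> hcomp A e \<Longrightarrow> lact A a x \<in> hcomp A (d + e)"
    and ract_hcomp: "x \<in> hcomp A d \<Longrightarrow> a \<in> G e \<Longrightarrow> ract A x a \<in> hcomp A (d + e)"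
begin

lemma tail_value_hcomp:
  assumes "\<And>u. \<theta> u \<in> hcomp A (vdeg u)" "homogeneous_list G us d" "us \<noteq> []"
  shows "tv \<theta> us \<in> hcomp A d"
  using assms(2,3)
proof (induction rule: homogeneous_list.induct)
  case (Cons b e us d u)
  have "ract A (\<theta> u) b \<in> hcomp A (vdeg u + e)" using ract_hcomp[OF assms(1) Cons(1)] .
  moreover have "us = [] \<Longrightarrow> d = 0" using Cons(2) by (auto elim: homogeneous_list.cases)
  ultimately show ?case
    using Cons mult_hcomp by (cases "us = []") (auto simp: tail_value_Cons)
qed simp

lemma mono_value_hcomp:
  assumes "\<And>u. \<theta> u \<in> hcomp A (vdeg u)" "m \<in> homogeneous_monos G d"
  shows "mv \<theta> m \<in> hcomp A d"
proof -
  from assms(2) obtain a us e d' where m: "m = Mono a us" "us \<noteq> []" "a \<in> G e"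
      "homogeneous_list G us d'" "d = e + d'"
    by (auto simp: homogeneous_monos_eq)
  moreover have "\<theta> u \<in> carr A" for u using assms(1) hcomp_subset by blast
  ultimately show ?thesis
    using lact_hcomp[OF m(3) tail_value_hcomp[OF assms(1) m(4,2)]]
    by (simp add: mono_value_eq_tail_value)
qed

end

context based_graded_algebra
begin

abbreviation W where "W \<equiv> free_gw s G B"

lemma fvar_in_free_carrier: "fvar u \<in> free_carrier"
  using one_in_B by (auto simp: fvar_def basis_monos_def)

interpretation free: W_algebra s G B W
  by (rule free_W_algebra)

text \<open>
  The basis monomials are the products that their notation suggests; a homomorphism on the free
  algebra is therefore determined by its values on the variables.
\<close>

lemma mono_value_fvar:
  assumes "m \<in> basis_monos B"
  shows "mono_value (fmult s B) (flact s B) (fract s B) fvar m = mono_elem m"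
proof -
  have basis: "fract s B (fvar u) b = mono_elem (Mono 1 [(u, b)])" if "b \<in> B" for u b
    unfolding fvar_def using that fract_mono_elem[of 1 "[]" u 1 b]
    by (simp add: basis_ext_basis[OF fscale.vector_space_axioms])
  have tail: "tail_value (fmult s B) (fract s B) fvar us = mono_elem (Mono 1 us)"
    if "us \<noteq> []" "snd ` set us \<subseteq> B" for us
    using that
  proof (induction us)
    case (Cons x us)
    obtain u b where "x = (u, b)" by fastforce
    with Cons show ?case
      using free.tail_value_Cons[of us fvar u b] fmult_mono_elem[of 1 "[]" u b 1 us]
      by (cases "us = []") (auto simp: basis basis_ext_basis[OF fscale.vector_space_axioms])
  qed simp
  obtain a us where m: "m = Mono a us" "us \<noteq> []" "a \<in> B" "snd ` set us \<subseteq> B"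
    using assms by (auto simp: basis_monos_def)
  show ?thesis
    using free.mono_value_eq_tail_value[of fvar us a] fvar_in_free_carrier m
    by (simp add: tail flact_mono_elem basis_ext_basis[OF fscale.vector_space_axioms])
qed

lemma hcomp_free: "hcomp W d = fscale.span
    (mono_value (fmult s B) (flact s B) (fract s B) fvar ` homogeneous_monos G d)"
  by (simp add: free_gw_def)

lemma linear_span_induct2:
  assumes "x \<in> fscale.span S" and T: "fscale.subspace T"
    and f: "\<And>x. x \<in> S \<Longrightarrow> f x \<in> T" "\<And>x y. f (x + y) = f x + f y" "\<And>c x. f (fscale c x) = fscale c (f x)"
  shows "f x \<in> T"
proof -
  have "f 0 = 0" using f(3)[of 0 0] by simp
  with assms(1) show ?thesis
    by (induction x rule: fscale.span_induct_alt)
      (auto simp: f fscale.subspace_add[OF T] fscale.subspace_scale[OF T] fscale.subspace_0[OF T])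
qed

lemma free_graded_W_algebra: "graded_W_algebra s G B W"
proof (unfold_locales)
  let ?v = "mono_value (fmult s B) (flact s B) (fract s B) fvar"
  note fv = fvar_in_free_carrier
  have sub: "fscale.subspace (hcomp W d)" for d
    unfolding hcomp_free by (rule fscale.subspace_span)
  show "module.subspace (smult W) (hcomp W d)" for d
    using sub by simp
  have val: "?v m \<in> hcomp W d" if "m \<in> homogeneous_monos G d" for m d
    unfolding hcomp_free using that by (intro fscale.span_base) auto
  show "hcomp W d \<subseteq> carr W" for d
    unfolding hcomp_free free_gw_simps
    by (rule fscale.span_minimal[OF _ subspace_free_carrier])
      (use free.mono_value_closed[of fvar] fv in auto)
  have lact: "flact s B a (?v m) \<in> hcomp W (d + e)" if "a \<in> G d" "m \<in> homogeneous_monos G e" for a m d e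
  proof -
    from that(2) obtain b us f d' where m: "m = Mono b us" "us \<noteq> []" "b \<in> G f"
      "homogeneous_list G us d'" "e = f + d'"
      by (auto simp: homogeneous_monos_eq)
    then have "Mono (a * b) us \<in> homogeneous_monos G (d + e)"
      using mult_component[OF that(1) m(3)] by (auto simp: homogeneous_monos_eq add.assoc[symmetric])
    then show ?thesis
      using free.mono_value_lact[of fvar us a b] val m fv by simp
  qed
  show "lact W a x \<in> hcomp W (d + e)" if "a \<in> G d" "x \<in> hcomp W e" for a x d e
    using linear_span_induct2[of x _ _ "flact s B a", OF that(2)[unfolded hcomp_free] sub[of "d + e"]]
      lact[OF that(1)] by (auto simp: free_linear)
  have ract: "fract s B (?v m) a \<in> hcomp W (d + e)" if "a \<in> G e" "m \<in> homogeneous_monos G d" for a m d e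
  proof -
    from that(2) obtain b us f d' where m: "m = Mono b us" "us \<noteq> []" "b \<in> G f"
      "homogeneous_list G us d'" "d = f + d'"
      by (auto simp: homogeneous_monos_eq)
    obtain vs u c where us: "us = vs @ [(u, c)]" using m(2) by (metis rev_exhaust surj_pair)
    have "Mono b (vs @ [(u, c * a)]) \<in> homogeneous_monos G (d + e)"
      using homogeneous_list_snoc_mult[OF m(4)[unfolded us] that(1)] m(3,5)
      by (auto simp: homogeneous_monos_eq add.assoc)
    then show ?thesis
      using free.mono_value_ract[of fvar b vs u c a] val m us fv by simp
  qed
  show "ract W x a \<in> hcomp W (d + e)" if "x \<in> hcomp W d" "a \<in> G e" for a x d e
    using linear_span_induct2[of x _ _ "\<lambda>x. fract s B x a", OF that(1)[unfolded hcomp_free] sub[of "d + e"]]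
      ract[OF that(2)] by (auto simp: free_linear)
  have mult: "fmult s B (?v m) (?v n) \<in> hcomp W (d + e)"
    if "m \<in> homogeneous_monos G d" "n \<in> homogeneous_monos G e" for m n d e
  proof -
    from that(1) obtain b us f d' where m: "m = Mono b us" "us \<noteq> []" "b \<in> G f"
      "homogeneous_list G us d'" "d = f + d'"
      by (auto simp: homogeneous_monos_eq)
    from that(2) obtain a vs f' e' where n: "n = Mono a vs" "vs \<noteq> []" "a \<in> G f'"
      "homogeneous_list G vs e'" "e = f' + e'"
      by (auto simp: homogeneous_monos_eq)
    obtain us' u c where us: "us = us' @ [(u, c)]" using m(2) by (metis rev_exhaust surj_pair)
    have "homogeneous_list G ((us' @ [(u, c * a)]) @ vs) (d' + f' + e')"
      by (intro homogeneous_list_append homogeneous_list_snoc_mult) (use m n us in auto)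
    then have "Mono b (us' @ (u, c * a) # vs) \<in> homogeneous_monos G (d + e)"
      using m(3,5) n(5) by (auto simp: homogeneous_monos_eq add.assoc)
    then show ?thesis
      using free.mono_value_mult[of fvar vs b us' u c a] val m n us fv by simp
  qed
  have mult1: "fmult s B (?v m) y \<in> hcomp W (d + e)" if "m \<in> homogeneous_monos G d" "y \<in> hcomp W e"
    for m y d e
    using linear_span_induct2[of y _ _ "fmult s B (?v m)", OF that(2)[unfolded hcomp_free] sub[of "d + e"]]
      mult[OF that(1)] by (auto simp: free_linear)
  show "mult W x y \<in> hcomp W (d + e)" if "x \<in> hcomp W d" "y \<in> hcomp W e" for x y d e
    using linear_span_induct2[of x _ _ "\<lambda>x. fmult s B x y", OF that(1)[unfolded hcomp_free] sub[of "d + e"]]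
      mult1[OF _ that(2)] by (auto simp: free_linear)
qed

lemma fvar_hcomp: "fvar u \<in> hcomp W (vdeg u)"
proof -
  have "Mono 1 [(u, 1)] \<in> homogeneous_monos G (vdeg u)"
    using homogeneous_list.Cons[of 1 G 0, OF one_in_component homogeneous_list.Nil, of u] one_in_component
    by (fastforce simp: homogeneous_monos_eq)
  then have "mono_value (fmult s B) (flact s B) (fract s B) fvar (Mono 1 [(u, 1)]) \<in> hcomp W (vdeg u)"
    unfolding hcomp_free by (intro fscale.span_base imageI)
  then show ?thesis
    using mono_value_fvar[of "Mono 1 [(u, 1)]"] one_in_B by (simp add: Mono_in_basis_monos fvar_def)
qed

end

context graded_W_algebra
begin

lemma wpoly_value_hcomp:
  assumes \<theta>: "\<And>u. \<theta> u \<in> hcomp A (vdeg u)" and "p \<in> hcomp W d"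
  shows "wpoly_value A \<theta> p \<in> hcomp A d"
proof -
  interpret free: W_algebra s G B W
    by (rule free_W_algebra)
  have \<theta>c: "\<theta> u \<in> carr A" for u using \<theta> hcomp_subset by blast
  have val: "wpoly_value A \<theta> (mono_value (fmult s B) (flact s B) (fract s B) fvar m) = mv \<theta> m" for m
  proof (cases m)
    case (Mono a us)
    have [simp]: "wpoly_value A \<theta> (fvar u) = \<theta> u" for u
      using lact_one[OF \<theta>c] ract_one[OF \<theta>c] by (simp add: fvar_def wpoly_value_mono_elem)
    have tail: "wpoly_value A \<theta> (tail_value (fmult s B) (fract s B) fvar us) = tv \<theta> us"
    proof (induction us)
      case (Cons x us)
      obtain u b where "x = (u, b)" by fastforce
      with Cons show ?case
        using free.tail_value_Cons[of us fvar u b] free.tail_value_closed[of fvar us]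
          free.ract_closed[of "fvar u" b] fvar_in_free_carrier
        by (cases "us = []") (auto simp: wpoly_value_mult[OF \<theta>c] wpoly_value_ract[OF \<theta>c] tail_value_Cons)
    qed (simp add: wpoly_value_0)
    show ?thesis
      using tail free.mono_value_eq_tail_value[of fvar us a] free.tail_value_closed[of fvar us]
        fvar_in_free_carrier
      by (cases "us = []")
        (auto simp: Mono wpoly_value_0 mono_value_eq_tail_value[OF \<theta>c] wpoly_value_lact[OF \<theta>c])
  qed
  have "p \<in> fscale.span (mono_value (fmult s B) (flact s B) (fract s B) fvar ` homogeneous_monos G d)"
    using assms(2) by (simp add: hcomp_free)
  then show ?thesis
  proof (induction p rule: fscale.span_induct_alt)
    case base
    show ?case by (simp add: wpoly_value_0 A.subspace_0[OF subspace_hcomp])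
  next
    case (step c x y)
    then show ?case
      using mono_value_hcomp[OF \<theta>]
      by (auto simp: wpoly_value_add wpoly_value_fscale val
          intro!: A.subspace_add[OF subspace_hcomp] A.subspace_scale[OF subspace_hcomp])
  qed
qed

text \<open>
  An evaluation following an endomorphism is the evaluation at the images of the variables. As these
  are again graded, identities are invariant under endomorphisms.
\<close>

lemma wpoly_value_endomorphism:
  assumes \<psi>: "gw_endomorphism W \<psi>" and \<theta>: "\<And>u. \<theta> u \<in> hcomp A (vdeg u)" and p: "p \<in> free_carrier"
  shows "wpoly_value A \<theta> (\<psi> p) = wpoly_value A (\<lambda>u. wpoly_value A \<theta> (\<psi> (fvar u))) p"
proof -
  interpret free: graded_W_algebra s G B W
    by (rule free_graded_W_algebra)
    let ?\<theta> = "\<lambda>u. wpoly_value A \<theta> (\<psi> (fvar u))"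
    note \<psi>' = \<psi>[unfolded gw_endomorphism_def free_gw_simps]
    have \<psi>_closed: "\<psi> x \<in> free_carrier" if "x \<in> free_carrier" for x using \<psi>' that by blast
    have \<psi>_add: "\<psi> (x + y) = \<psi> x + \<psi> y" if "x \<in> free_carrier" "y \<in> free_carrier" for x y
      using \<psi>' that by blast
    have \<psi>_scale: "\<psi> (fscale c x) = fscale c (\<psi> x)" if "x \<in> free_carrier" for c x
      using \<psi>' that by blast
    have \<theta>c: "\<theta> u \<in> carr A" for u using \<theta> hcomp_subset by blast
    have \<theta>c': "?\<theta> u \<in> carr A" for u using wpoly_value_closed[OF \<theta>c] .
    have \<psi>0: "\<psi> 0 = 0" using \<psi>_scale[of 0 0] by simp
    have tail: "wpoly_value A \<theta> (\<psi> (tail_value (fmult s B) (fract s B) fvar us)) = tv ?\<theta> us" for us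
    proof (induction us)
      case (Cons x us)
      obtain u b where x: "x = (u, b)" by fastforce
      have r: "\<psi> (fract s B (fvar u) b) = fract s B (\<psi> (fvar u)) b"
        using \<psi>' fvar_in_free_carrier by blast
      have t: "tail_value (fmult s B) (fract s B) fvar us \<in> free_carrier"
        using free.tail_value_closed[of fvar us] fvar_in_free_carrier by simp
      have m: "\<psi> (fmult s B (fract s B (fvar u) b) (tail_value (fmult s B) (fract s B) fvar us)) =
          fmult s B (fract s B (\<psi> (fvar u)) b) (\<psi> (tail_value (fmult s B) (fract s B) fvar us))"
        unfolding r[symmetric] using \<psi>' t fract_closed[OF fvar_in_free_carrier] by blast
      show ?case
        using Cons free.tail_value_Cons[of us fvar u b] \<psi>_closed[OF fvar_in_free_carrier]
          \<psi>_closed[OF t] fract_closed[OF \<psi>_closed[OF fvar_in_free_carrier]]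
        by (cases "us = []")
          (auto simp: x r m wpoly_value_mult[OF \<theta>c] wpoly_value_ract[OF \<theta>c] tail_value_Cons)
    qed (simp add: \<psi>0 wpoly_value_0)
    have mono_case: "wpoly_value A \<theta> (\<psi> (mono_elem m)) = mv ?\<theta> m" if m: "m \<in> basis_monos B" for m
    proof -
      obtain a us where m': "m = Mono a us" "us \<noteq> []"
        using m by (auto simp: basis_monos_def)
      have t: "tail_value (fmult s B) (fract s B) fvar us \<in> free_carrier"
        using free.tail_value_closed[of fvar us] fvar_in_free_carrier by simp
      have l: "\<psi> (flact s B a (tail_value (fmult s B) (fract s B) fvar us)) =
          flact s B a (\<psi> (tail_value (fmult s B) (fract s B) fvar us))"
        using \<psi>' t by blast
      have "mono_elem m = flact s B a (tail_value (fmult s B) (fract s B) fvar us)"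
        using mono_value_fvar[OF m] free.mono_value_eq_tail_value[of fvar us a] m' fvar_in_free_carrier
        by simp
      then show ?thesis
        using \<psi>_closed[OF t] m'(2)
        by (simp add: l wpoly_value_lact[OF \<theta>c] tail m'(1) mono_value_eq_tail_value[OF \<theta>c'])
    qed
    have keys: "Poly_Mapping.keys p \<subseteq> basis_monos B" using p by simp
    have "wpoly_value A \<theta> (\<psi> p) = wpoly_value A ?\<theta> p \<and> p \<in> free_carrier"
      using keys
    proof (induction p rule: linear_induct)
      case (mono m)
      then show ?case by (simp add: wpoly_value_mono_elem mono_case)
    next
      case (add p q)
      then show ?case
        using free_carrier_closed(1)[of p q] by (simp only: \<psi>_add wpoly_value_add)
    next
      case (scale c p)
      then show ?case
        using free_carrier_closed(2)[of p c] by (simp only: \<psi>_scale wpoly_value_fscale)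
    qed (simp add: \<psi>0 wpoly_value_0)
    then show ?thesis by simp
qed

lemma graded_identities_T_ideal: "T_ideal W (graded_identities B A)"
proof -
  have eq: "p \<in> graded_identities B A \<longleftrightarrow>
      p \<in> free_carrier \<and> (\<forall>\<theta>. (\<forall>u. \<theta> u \<in> hcomp A (vdeg u)) \<longrightarrow> wpoly_value A \<theta> p = 0)" for p
    by (auto simp: graded_identities_def)
  have \<theta>c: "\<theta> u \<in> carr A" if "\<forall>u. \<theta> u \<in> hcomp A (vdeg u)" for \<theta> u
    using that hcomp_subset by blast
  have endo: "\<psi> p \<in> graded_identities B A"
    if \<psi>: "gw_endomorphism W \<psi>" and p: "p \<in> graded_identities B A" for \<psi> p
    unfolding eq
  proof (intro conjI allI impI)
    have pc: "p \<in> free_carrier" using p eq by blast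
    show "\<psi> p \<in> free_carrier"
      using \<psi> pc by (simp add: gw_endomorphism_def)
    fix \<theta> assume \<theta>: "\<forall>u. \<theta> u \<in> hcomp A (vdeg u)"
    have "wpoly_value A \<theta> (\<psi> (fvar u)) \<in> hcomp A (vdeg u)" for u
      using \<psi> wpoly_value_hcomp[of \<theta>] \<theta> fvar_hcomp unfolding gw_endomorphism_def by blast
    then show "wpoly_value A \<theta> (\<psi> p) = 0"
      using wpoly_value_endomorphism[OF \<psi> _ pc, of \<theta>] \<theta> p eq by auto
  qed
  have mult: "wpoly_value A \<theta> (fmult s B x y) = mult A (wpoly_value A \<theta> x) (wpoly_value A \<theta> y)"
    if "\<forall>u. \<theta> u \<in> hcomp A (vdeg u)" "x \<in> free_carrier" "y \<in> free_carrier" for \<theta> x y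
    using wpoly_value_mult[of \<theta> x y] \<theta>c[OF that(1)] that(2,3) by blast
  have act: "wpoly_value A \<theta> (flact s B a x) = lact A a (wpoly_value A \<theta> x)"
    "wpoly_value A \<theta> (fract s B x a) = ract A (wpoly_value A \<theta> x) a"
    if "\<forall>u. \<theta> u \<in> hcomp A (vdeg u)" "x \<in> free_carrier" for \<theta> x a
    using wpoly_value_lact[of \<theta> x a] wpoly_value_ract[of \<theta> x a] \<theta>c[OF that(1)] that(2) by blast+
  show ?thesis
    unfolding T_ideal_def free_gw_simps
  proof (intro conjI ballI allI impI)
    fix x y assume xy: "x \<in> graded_identities B A" "y \<in> free_carrier"
    show "fmult s B x y \<in> graded_identities B A" "fmult s B y x \<in> graded_identities B A"
      using fmult_closed[of x y] fmult_closed[of y x] mult xy unfolding eq by simp_all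
  next
    fix x a assume x: "x \<in> graded_identities B A"
    show "flact s B a x \<in> graded_identities B A" "fract s B x a \<in> graded_identities B A"
      using flact_closed[of x a] fract_closed[of x a] act x unfolding eq by simp_all
  next
    show "0 \<in> graded_identities B A" by (auto simp: eq wpoly_value_0)
  next
    fix x y assume "x \<in> graded_identities B A" "y \<in> graded_identities B A"
    then show "x + y \<in> graded_identities B A"
      using free_carrier_closed(1) by (auto simp: eq wpoly_value_add simp del: mem_Collect_eq)
  next
    fix c x assume "x \<in> graded_identities B A"
    then show "fscale c x \<in> graded_identities B A"
      using free_carrier_closed(2) by (auto simp: eq wpoly_value_fscale simp del: mem_Collect_eq)
  next
    fix \<psi> assume "gw_endomorphism W \<psi>"
    then show "\<psi> ` graded_identities B A \<subseteq> graded_identities B A" using endo by blast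
  next
    show "graded_identities B A \<subseteq> free_carrier" using eq by blast
  qed
qed


end

context based_graded_algebra
begin

text \<open>
  The freeness of the free algebra, obtained by evaluating in the free algebra itself.
\<close>

lemma substitution_endomorphism:
  assumes "\<And>u. \<theta> u \<in> hcomp W (vdeg u)"
  shows "gw_endomorphism W (wpoly_value W \<theta>)"
proof -
  interpret free: graded_W_algebra s G B W
    by (rule free_graded_W_algebra)
  have \<theta>c: "\<theta> u \<in> carr W" for u using assms free.hcomp_subset by blast
  show ?thesis
    unfolding gw_endomorphism_def
    using free.wpoly_value_closed[OF \<theta>c] free.wpoly_value_mult[OF \<theta>c] free.wpoly_value_lact[OF \<theta>c]
      free.wpoly_value_ract[OF \<theta>c] free.wpoly_value_hcomp[OF assms]
    by (simp add: free.wpoly_value_add free.wpoly_value_fscale[simplified])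
qed

lemma substitution_fvar:
  assumes "\<And>u. \<theta> u \<in> hcomp W (vdeg u)"
  shows "wpoly_value W \<theta> (fvar u) = \<theta> u"
proof -
  interpret free: graded_W_algebra s G B W
    by (rule free_graded_W_algebra)
  have "\<theta> u \<in> free_carrier" using assms free.hcomp_subset by fastforce
  then show ?thesis
    using free.wpoly_value_mono_elem[of \<theta> "Mono 1 [(u, 1)]"] flact_one fract_one by (simp add: fvar_def)
qed

end

section \<open>Upper triangular matrices as an algebra with action\<close>

lemma matrix2_eq_iff:
  "(M :: 'a^2^2) = N \<longleftrightarrow>
     M $ 1 $ 1 = N $ 1 $ 1 \<and> M $ 1 $ 2 = N $ 1 $ 2 \<and> M $ 2 $ 1 = N $ 2 $ 1 \<and> M $ 2 $ 2 = N $ 2 $ 2"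
  by (auto simp: vec_eq_iff forall_2)

lemma matrix2_mult_nth: "((M :: 'a::semiring_1^2^2) ** N) $ i $ j = M $ i $ 1 * N $ 1 $ j + M $ i $ 2 * N $ 2 $ j"
  by (simp add: matrix_matrix_mult_def sum_2)

lemma mscale_nth [simp]: "mscale c M $ i $ j = c * M $ i $ j"
  by (simp add: mscale_def)

lemma munit_nth [simp]: "munit k l $ i $ j = (if i = k \<and> j = l then 1 else 0)"
  by (simp add: munit_def)

lemma mat_1_nth [simp]: "(mat 1 :: 'a::semiring_1^'n^'n) $ i $ j = (if i = j then 1 else 0)"
  by (simp add: mat_def)

lemma UT2_comp_0: "UT2_comp 0 = {M. M $ 1 $ 2 = 0 \<and> M $ 2 $ 1 = 0}"
proof -
  have "M \<in> UT2_comp 0" if "M $ 1 $ 2 = 0" "M $ 2 $ 1 = 0" for M :: "'a^2^2"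
    unfolding UT2_comp_def using that
    by (auto simp: matrix2_eq_iff intro!: exI[of _ "M $ 1 $ 1"] exI[of _ "M $ 2 $ 2"])
  then show ?thesis by (auto simp: UT2_comp_def)
qed

lemma UT2_comp_1: "UT2_comp 1 = {M. M $ 1 $ 1 = 0 \<and> M $ 2 $ 1 = 0 \<and> M $ 2 $ 2 = 0}"
proof -
  have "M \<in> UT2_comp 1" if "M $ 1 $ 1 = 0" "M $ 2 $ 1 = 0" "M $ 2 $ 2 = 0" for M :: "'a^2^2"
    unfolding UT2_comp_def using that
    by (auto simp: matrix2_eq_iff intro!: exI[of _ "M $ 1 $ 2"])
  then show ?thesis by (auto simp: UT2_comp_def)
qed

lemma C_alg_eq: "C_alg = {M. M $ 1 $ 1 = M $ 2 $ 2 \<and> M $ 2 $ 1 = 0}"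
proof -
  have "M \<in> C_alg" if "M $ 1 $ 1 = M $ 2 $ 2" "M $ 2 $ 1 = 0" for M :: "'a^2^2"
    unfolding C_alg_def using that
    by (auto simp: matrix2_eq_iff intro!: exI[of _ "M $ 1 $ 1"] exI[of _ "M $ 1 $ 2"])
  then show ?thesis by (auto simp: C_alg_def)
qed

interpretation mscale: vector_space mscale
  by unfold_locales (auto simp: matrix2_eq_iff algebra_simps)

lemma subspace_UT2: "mscale.subspace UT2"
  by (auto simp: mscale.subspace_def UT2_def)

lemma UT2_comp_subset: "UT2_comp d \<subseteq> UT2"
  by (cases d) (auto simp: UT2_comp_0 UT2_comp_1 UT2_def)

lemma subspace_UT2_comp: "mscale.subspace (UT2_comp d)"
  by (cases d) (auto simp: mscale.subspace_def UT2_comp_0 UT2_comp_1)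

lemma mult_UT2_comp: "M \<in> UT2_comp d \<Longrightarrow> N \<in> UT2_comp e \<Longrightarrow> M ** N \<in> UT2_comp (d + e)"
  by (cases d; cases e) (auto simp: UT2_comp_0 UT2_comp_1 matrix2_mult_nth)

text \<open>
  The situation of the theorem with the indexed basis replaced by its set \<open>B\<close> of elements.
\<close>

locale C_action = based_graded_algebra s G B
  for s :: "'f::field_char_0 \<Rightarrow> 'w::ring_1 \<Rightarrow> 'w" and G B +
  fixes \<phi> :: "'w \<Rightarrow> 'f^2^2" and w1 :: 'w
  assumes hom_onto_C: "graded_hom_onto_C s G \<phi>"
    and w1_in_B: "w1 \<in> B" and \<phi>_w1: "\<phi> w1 = munit 1 2"
    and \<phi>_other: "b \<in> B \<Longrightarrow> b \<noteq> 1 \<Longrightarrow> b \<noteq> w1 \<Longrightarrow> \<phi> b = 0"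
begin

lemma \<phi>_hom: "\<phi> (x + y) = \<phi> x + \<phi> y" "\<phi> (s c x) = mscale c (\<phi> x)" "\<phi> (x * y) = \<phi> x ** \<phi> y"
    "\<phi> 1 = mat 1" "x \<in> G d \<Longrightarrow> \<phi> x \<in> UT2_comp d" "\<phi> x \<in> C_alg"
  using hom_onto_C by (auto simp: graded_hom_onto_C_def)

lemma w1_neq_1: "w1 \<noteq> 1"
proof
  assume "w1 = 1"
  then have "munit 1 2 = (mat 1 :: 'f^2^2)" using \<phi>_w1 \<phi>_hom by metis
  then show False by (simp add: matrix2_eq_iff)
qed

abbreviation UTC :: "('f, 'w, 'f^2^2) gw_algebra" where "UTC \<equiv> UT2C \<phi>"

lemma UT2C_simps [simp]: "carr UTC = UT2" "smult UTC = mscale" "mult UTC = (**)"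
  "lact UTC = (\<lambda>x A. \<phi> x ** A)" "ract UTC = (\<lambda>A x. A ** \<phi> x)" "hcomp UTC = UT2_comp"
  by (simp_all add: UT2C_def)

lemma UT2C_graded_W_algebra: "graded_W_algebra s G B UTC"
proof unfold_locales
  fix x y :: 'w and c
  have \<phi>UT: "\<phi> x \<in> UT2" using \<phi>_hom(6) by (auto simp: C_alg_eq UT2_def)
  show "lact UTC (s c x) M = smult UTC c (lact UTC x M)" for M
    by (simp add: \<phi>_hom matrix2_eq_iff matrix2_mult_nth algebra_simps)
  show "ract UTC M (s c x) = smult UTC c (ract UTC M x)" for M
    by (simp add: \<phi>_hom matrix2_eq_iff matrix2_mult_nth algebra_simps)
  show "lact UTC x M \<in> carr UTC" if "M \<in> carr UTC" for M
    using that \<phi>UT by (simp add: UT2_def matrix2_mult_nth)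
  show "ract UTC M x \<in> carr UTC" if "M \<in> carr UTC" for M
    using that \<phi>UT by (simp add: UT2_def matrix2_mult_nth)
  show "lact UTC x M \<in> hcomp UTC (d + e)" if "x \<in> G d" "M \<in> hcomp UTC e" for M d e
    using mult_UT2_comp[OF \<phi>_hom(5)[OF that(1)]] that(2) by simp
  show "ract UTC M x \<in> hcomp UTC (d + e)" if "M \<in> hcomp UTC d" "x \<in> G e" for M d e
    using mult_UT2_comp[OF _ \<phi>_hom(5)[OF that(2)]] that(1) by simp
qed (use subspace_UT2 subspace_UT2_comp UT2_comp_subset mult_UT2_comp in
    \<open>auto simp: \<phi>_hom matrix_add_ldistrib matrix_mul_assoc UT2_def
     matrix2_eq_iff matrix2_mult_nth algebra_simps\<close>)

end

section \<open>Normal forms of monomials\<close>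

text \<open>
  \<open>Pure M\<close> stands for a product of even variables, \<open>Act L R\<close> for a product with one factor \<open>w1\<close>, and
  \<open>Odd L k R\<close> for a product with one odd variable of index \<open>k\<close>; \<open>L\<close> and \<open>R\<close> collect the indices of the
  even variables before and after the special factor.
\<close>

datatype nform = Pure "nat multiset" | Act "nat multiset" "nat multiset"
  | Odd "nat multiset" nat "nat multiset"

text \<open>
  Multiplication of a normal form from the left by a basis coefficient, where \<open>e\<close> is the basis element
  acting as the matrix unit; \<open>None\<close> stands for a product that vanishes in the matrix algebra.
\<close>

definition push_coef :: "'w \<Rightarrow> 'w::one \<Rightarrow> nform \<Rightarrow> nform option" where
  "push_coef e b n =
     (if b = 1 then Some n
      else if b = e then (case n of Pure M \<Rightarrow> Some (Act {#} M) | _ \<Rightarrow> None)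
      else None)"

fun push_var :: "gvar \<Rightarrow> nform \<Rightarrow> nform option" where
  "push_var (Y i) (Pure M) = Some (Pure (add_mset i M))"
| "push_var (Y i) (Act L R) = Some (Act (add_mset i L) R)"
| "push_var (Y i) (Odd L k R) = Some (Odd (add_mset i L) k R)"
| "push_var (Z k) (Pure M) = Some (Odd {#} k M)"
| "push_var (Z k) _ = None"

fun tail_nform :: "'w \<Rightarrow> (gvar \<times> 'w::one) list \<Rightarrow> nform option" where
  "tail_nform e [] = Some (Pure {#})"
| "tail_nform e ((u, b) # us) =
     Option.bind (Option.bind (tail_nform e us) (push_coef e b)) (push_var u)"

fun mono_nform :: "'w \<Rightarrow> 'w::one gmono \<Rightarrow> nform option" where
  "mono_nform e (Mono a us) = Option.bind (tail_nform e us) (push_coef e a)"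

text \<open>
  The coordinates of a graded substitution: the two diagonal entries of each even variable and the
  off-diagonal entry of each odd variable.
\<close>

datatype entry = E11 nat | E22 nat | E12 nat

text \<open>
  A matrix value has only one free entry once the normal form is known, apart from pure ones, whose
  entry (1,1) already determines the normal form; this is the exponent of that entry.
\<close>

fun exponents :: "nform \<Rightarrow> entry multiset" where
  "exponents (Pure M) = image_mset E11 M"
| "exponents (Act L R) = image_mset E11 L + image_mset E22 R"
| "exponents (Odd L k R) = image_mset E11 L + add_mset (E12 k) (image_mset E22 R)"

fun is_Pure where
  "is_Pure (Pure M) = True"
| "is_Pure _ = False"

fun nform_value :: "(entry \<Rightarrow> 'f::field) \<Rightarrow> nform \<Rightarrow> 'f^2^2" where
  "nform_value x (Pure M) =
     mscale (\<Prod>i\<in>#M. x (E11 i)) (munit 1 1) + mscale (\<Prod>i\<in>#M. x (E22 i)) (munit 2 2)"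
| "nform_value x n = mscale (\<Prod>l\<in>#exponents n. x l) (munit 1 2)"

fun entry_subst :: "(entry \<Rightarrow> 'f::field) \<Rightarrow> gvar \<Rightarrow> 'f^2^2" where
  "entry_subst x (Y i) = mscale (x (E11 i)) (munit 1 1) + mscale (x (E22 i)) (munit 2 2)"
| "entry_subst x (Z i) = mscale (x (E12 i)) (munit 1 2)"

definition opt_value :: "(entry \<Rightarrow> 'f::field) \<Rightarrow> nform option \<Rightarrow> 'f^2^2" where
  "opt_value x n = (case n of None \<Rightarrow> 0 | Some n \<Rightarrow> nform_value x n)"

lemma count_exponents:
  "count (exponents (Act L R)) (E11 i) = count L i" "count (exponents (Act L R)) (E22 i) = count R i"
  "count (exponents (Act L R)) (E12 i) = 0"
  "count (exponents (Odd L k R)) (E11 i) = count L i" "count (exponents (Odd L k R)) (E22 i) = count R i"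
  "count (exponents (Odd L k R)) (E12 i) = of_bool (i = k)"
proof -
  have inj: "inj E11" "inj E22" by (auto intro: injI)
  have count_inj: "count (image_mset f M) (f a) = count M a" if "inj f" for f :: "nat \<Rightarrow> entry" and M a
    by (induction M) (auto simp: inj_eq[OF that])
  have no: "count (image_mset E11 M) (E22 i) = 0" "count (image_mset E22 M) (E11 i) = 0"
    "count (image_mset E11 M) (E12 i) = 0" "count (image_mset E22 M) (E12 i) = 0" for M i
    by (auto simp: count_eq_zero_iff)
  show "count (exponents (Act L R)) (E11 i) = count L i" "count (exponents (Act L R)) (E22 i) = count R i"
  "count (exponents (Act L R)) (E12 i) = 0"
  "count (exponents (Odd L k R)) (E11 i) = count L i" "count (exponents (Odd L k R)) (E22 i) = count R i"
  "count (exponents (Odd L k R)) (E12 i) = of_bool (i = k)"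
    by (auto simp: no count_inj inj)
qed

text \<open>
  \<open>Pure M\<close> and \<open>Act M {#}\<close> have the same exponents. They are told apart by the matrix entry in which
  the monomial appears, so injectivity on the two kinds separately is what is needed.
\<close>

lemma inj_on_exponents: "inj_on exponents {n. is_Pure n}" "inj_on exponents {n. \<not> is_Pure n}"
proof -
  have "inj E11" by (auto intro: injI)
  then have "inj (image_mset E11)" by (rule multiset.inj_map)
  then show "inj_on exponents {n. is_Pure n}"
    by (auto intro!: inj_onI elim!: is_Pure.elims dest: injD)
  show "inj_on exponents {n. \<not> is_Pure n}"
  proof (rule inj_onI, unfold mem_Collect_eq)
    fix m n assume "\<not> is_Pure m" "\<not> is_Pure n" and "exponents m = exponents n"
    then have "count (exponents m) l = count (exponents n) l" for l by simp
    note eq = this[of "E11 i" for i] this[of "E22 i" for i] this[of "E12 i" for i]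
    show "m = n" using eq \<open>\<not> is_Pure m\<close> \<open>\<not> is_Pure n\<close>
    proof (cases m; cases n)
      fix L k R L' k' R' assume mn: "m = Odd L k R" "n = Odd L' k' R'"
      show "m = n" using eq(1,2) eq(3)[of k] unfolding mn count_exponents
        by (auto simp: multiset_eq_iff of_bool_def split: if_splits)
    next
      fix L R L' k' R' assume mn: "m = Act L R" "n = Odd L' k' R'"
      show "m = n" using eq(3)[of k'] unfolding mn count_exponents by simp
    next
      fix L R L' k' R' assume mn: "m = Odd L' k' R'" "n = Act L R"
      show "m = n" using eq(3)[of k'] unfolding mn count_exponents by simp
    next
      fix L R L' R' assume mn: "m = Act L R" "n = Act L' R'"
      show "m = n" using eq(1,2) unfolding mn count_exponents by (auto simp: multiset_eq_iff)
    qed auto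
  qed
qed

lemma prod_mset_fun_upd:
  fixes x :: "'e \<Rightarrow> 'f::comm_monoid_mult"
  shows "(\<Prod>l\<in>#M. (x(a := t * x a)) l) = t ^ count M a * (\<Prod>l\<in>#M. x l)"
  by (induction M) (auto simp: mult.assoc mult.left_commute)

text \<open>
  As in the independence of characters: doubling one coordinate \<open>a\<close> multiplies each monomial by a power
  of 2. If two monomials differ in the exponent of \<open>a\<close>, a combination of the original and the
  doubled relation removes one of them and keeps the other with a nonzero factor.
\<close>

lemma monomials_independent:
  fixes c :: "'n \<Rightarrow> 'f::field_char_0" and e :: "'n \<Rightarrow> 'e multiset"
  assumes "finite N" "inj_on e N"
    and "\<And>x. (\<Sum>n\<in>N. c n * (\<Prod>l\<in>#e n. x l)) = 0"
    and "n \<in> N"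
  shows "c n = 0"
  using assms
proof (induction N arbitrary: c n rule: finite_psubset_induct)
  case (psubset N)
  note vanish = psubset.prems(2)
  have other: "c m = 0" if m: "m \<in> N" "m \<noteq> n" for m
  proof -
    have "e m \<noteq> e n" using m psubset.prems(1,3) by (auto dest: inj_onD)
    then obtain a where a: "count (e m) a \<noteq> count (e n) a" by (auto simp: multiset_eq_iff)
    \<comment> \<open>The relation with \<open>a\<close> doubled, minus a multiple of the original one that cancels \<open>n\<close>.\<close>
    let ?d = "\<lambda>k. c k * (2 ^ count (e k) a - 2 ^ count (e n) a)"
    have "(\<Sum>k\<in>N - {n}. ?d k * (\<Prod>l\<in>#e k. x l)) = 0" for x :: "'e \<Rightarrow> 'f"
    proof -
      have "(\<Sum>k\<in>N - {n}. ?d k * (\<Prod>l\<in>#e k. x l)) = (\<Sum>k\<in>N. ?d k * (\<Prod>l\<in>#e k. x l))"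
        using psubset.hyps psubset.prems(3) by (simp add: sum.remove)
      also have "\<dots> = (\<Sum>k\<in>N. c k * (\<Prod>l\<in>#e k. (x(a := 2 * x a)) l)) -
          2 ^ count (e n) a * (\<Sum>k\<in>N. c k * (\<Prod>l\<in>#e k. x l))"
        unfolding prod_mset_fun_upd by (simp add: algebra_simps sum_subtractf sum_distrib_left)
      also have "\<dots> = 0" unfolding vanish by simp
      finally show ?thesis .
    qed
    with m psubset.prems psubset.IH[of "N - {n}" ?d m] have "?d m = 0"
      by (auto intro: inj_on_subset)
    moreover have "(2::'f) ^ count (e m) a \<noteq> 2 ^ count (e n) a"
    proof
      assume "(2::'f) ^ count (e m) a = 2 ^ count (e n) a"
      then have "of_nat (2 ^ count (e m) a) = (of_nat (2 ^ count (e n) a) :: 'f)" by simp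
      then have "(2::nat) ^ count (e m) a = 2 ^ count (e n) a" unfolding of_nat_eq_iff .
      with a show False by simp
    qed
    ultimately show ?thesis by simp
  qed
  have "(\<Sum>k\<in>N. c k * (\<Prod>l\<in>#e k. 1)) = c n"
    using other psubset.hyps psubset.prems(3) by (simp add: sum.remove[of N n])
  with vanish[of "\<lambda>_. 1"] show ?case by simp
qed

context C_action
begin

sublocale UTC: graded_W_algebra s G B UTC
  by (rule UT2C_graded_W_algebra)

lemma opt_value_simps [simp]: "opt_value x None = 0" "opt_value x (Some n) = nform_value x n"
  by (simp_all add: opt_value_def)

lemma push_coef_value:
  assumes "b \<in> B"
  shows "opt_value x (Option.bind n (push_coef w1 b)) = \<phi> b ** opt_value x n"
proof (cases n)
  case (Some m)
  then show ?thesis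
    using assms w1_neq_1 \<phi>_other[of b]
    by (cases m; cases "b = 1"; cases "b = w1")
      (auto simp: push_coef_def \<phi>_hom \<phi>_w1 matrix2_eq_iff matrix2_mult_nth multiset.map_comp comp_def)
qed (simp add: matrix2_eq_iff matrix2_mult_nth)

lemma push_var_value:
  "opt_value x (Option.bind n (push_var u)) = entry_subst x u ** opt_value x n"
proof (cases n)
  case (Some m)
  then show ?thesis
    by (cases m; cases u)
      (auto simp: matrix2_eq_iff matrix2_mult_nth multiset.map_comp comp_def)
qed (simp add: matrix2_eq_iff matrix2_mult_nth)

lemma entry_subst_hcomp: "entry_subst x u \<in> UT2_comp (vdeg u)"
  by (cases u) (auto simp: UT2_comp_0 UT2_comp_1)

lemma entry_subst_UT2: "entry_subst x u \<in> UT2"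
  using entry_subst_hcomp UT2_comp_subset by blast

lemma tail_value_nform:
  assumes "us \<noteq> []" "snd ` set us \<subseteq> B"
  shows "tail_value (**) (\<lambda>M a. M ** \<phi> a) (entry_subst x) us = opt_value x (tail_nform w1 us)"
  using assms
proof (induction us)
  case (Cons y us)
  obtain u b where y: "y = (u, b)" by fastforce
  have one: "nform_value x (Pure {#}) = mat 1" by (simp add: matrix2_eq_iff)
  have step: "opt_value x (tail_nform w1 (y # us)) =
      entry_subst x u ** \<phi> b ** opt_value x (tail_nform w1 us)"
    using Cons.prems push_coef_value[of b x "tail_nform w1 us"]
    unfolding y tail_nform.simps push_var_value by (simp add: matrix_mul_assoc)
  have "opt_value x (tail_nform w1 []) = mat 1" using one by simp
  with step show ?case
    using Cons UTC.tail_value_Cons[of us "entry_subst x" u b]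
    by (cases "us = []") (simp_all add: y step del: nform_value.simps tail_nform.simps)
qed simp

lemma mono_value_nform:
  assumes "m \<in> basis_monos B"
  shows "mono_value (**) (\<lambda>a M. \<phi> a ** M) (\<lambda>M a. M ** \<phi> a) (entry_subst x) m =
    opt_value x (mono_nform w1 m)"
proof -
  obtain a us where m: "m = Mono a us" "us \<noteq> []" "a \<in> B" "snd ` set us \<subseteq> B"
    using assms by (auto simp: basis_monos_def)
  then show ?thesis
    using UTC.mono_value_eq_tail_value[of "entry_subst x" us a, simplified UT2C_simps, OF entry_subst_UT2 m(2)]
    by (simp add: tail_value_nform push_coef_value)
qed

definition nform_coeff :: "('f, 'w) wpoly \<Rightarrow> nform \<Rightarrow> 'f" where
  "nform_coeff p n =
     (\<Sum>m\<in>Poly_Mapping.keys p. Poly_Mapping.lookup p m * of_bool (mono_nform w1 m = Some n))"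

lemma nform_coeff_add: "nform_coeff (p + q) n = nform_coeff p n + nform_coeff q n"
  unfolding nform_coeff_def by (rule sum_over_keys_add) (unfold_locales, auto simp: algebra_simps)

lemma nform_coeff_fscale: "nform_coeff (fscale c p) n = c * nform_coeff p n"
  unfolding nform_coeff_def by (rule sum_over_keys_fscale) (unfold_locales, auto simp: algebra_simps)

lemma nform_coeff_mono_elem: "nform_coeff (mono_elem m) n = of_bool (mono_nform w1 m = Some n)"
  by (simp add: nform_coeff_def)

definition nforms :: "('f, 'w) wpoly \<Rightarrow> nform set" where
  "nforms p = {n. Some n \<in> mono_nform w1 ` Poly_Mapping.keys p}"

lemma finite_nforms: "finite (nforms p)"
proof -
  have "finite (Some ` nforms p)"
    by (rule finite_subset[of _ "mono_nform w1 ` Poly_Mapping.keys p"]) (auto simp: nforms_def)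
  then show ?thesis by (rule finite_imageD) simp
qed

text \<open>
  A sum over the monomials of \<open>p\<close> of a quantity depending on the normal form only, collected by normal
  forms.
\<close>

lemma sum_by_nform:
  fixes g :: "nform option \<Rightarrow> 'f"
  assumes "g None = 0"
  shows "(\<Sum>m\<in>Poly_Mapping.keys p. Poly_Mapping.lookup p m * g (mono_nform w1 m)) =
    (\<Sum>n\<in>nforms p. nform_coeff p n * g (Some n))"
proof -
  have "(\<Sum>n\<in>nforms p. nform_coeff p n * g (Some n)) =
      (\<Sum>m\<in>Poly_Mapping.keys p. Poly_Mapping.lookup p m *
         (\<Sum>n\<in>nforms p. of_bool (mono_nform w1 m = Some n) * g (Some n)))"
    unfolding nform_coeff_def sum_distrib_right sum_distrib_left
    by (subst sum.swap) (simp add: mult.assoc)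
  also have "\<dots> = (\<Sum>m\<in>Poly_Mapping.keys p. Poly_Mapping.lookup p m * g (mono_nform w1 m))"
  proof (rule sum.cong[OF refl])
    fix m assume m: "m \<in> Poly_Mapping.keys p"
    have "(\<Sum>n\<in>nforms p. of_bool (mono_nform w1 m = Some n) * g (Some n)) = g (mono_nform w1 m)"
    proof (cases "mono_nform w1 m")
      case (Some n')
      then have "n' \<in> nforms p" using m by (force simp: nforms_def)
      then have "(\<Sum>n\<in>nforms p. of_bool (n' = n) * g (Some n)) = g (Some n')"
        using finite_nforms[of p] by (simp add: of_bool_def if_distrib[of "\<lambda>x. x * _"] sum.delta cong: if_cong)
      then show ?thesis using Some by simp
    qed (simp add: assms)
    then show "Poly_Mapping.lookup p m * (\<Sum>n\<in>nforms p. of_bool (mono_nform w1 m = Some n) * g (Some n)) =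
      Poly_Mapping.lookup p m * g (mono_nform w1 m)" by simp
  qed
  finally show ?thesis by simp
qed

lemma wpoly_value_entry_subst:
  assumes "p \<in> free_carrier"
  shows "wpoly_value UTC (entry_subst x) p $ i $ j =
    (\<Sum>n\<in>nforms p. nform_coeff p n * nform_value x n $ i $ j)"
proof -
  have "wpoly_value UTC (entry_subst x) p $ i $ j =
      (\<Sum>m\<in>Poly_Mapping.keys p. Poly_Mapping.lookup p m * opt_value x (mono_nform w1 m) $ i $ j)"
    unfolding wpoly_value_def using assms
    by (auto simp: mono_value_nform intro!: sum.cong)
  also have "\<dots> = (\<Sum>n\<in>nforms p. nform_coeff p n * nform_value x n $ i $ j)"
    using sum_by_nform[of "\<lambda>n. opt_value x n $ i $ j" p] by simp
  finally show ?thesis .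
qed

lemma nform_coeff_not_nforms: "n \<notin> nforms p \<Longrightarrow> nform_coeff p n = 0"
  unfolding nform_coeff_def nforms_def by (intro sum.neutral) force

lemma graded_subst_entry:
  assumes "\<And>u. \<theta> u \<in> UT2_comp (vdeg u)"
  obtains x where "\<theta> = entry_subst x"
proof
  let ?x = "\<lambda>l. case l of E11 i \<Rightarrow> \<theta> (Y i) $ 1 $ 1 | E22 i \<Rightarrow> \<theta> (Y i) $ 2 $ 2 | E12 i \<Rightarrow> \<theta> (Z i) $ 1 $ 2"
  show "\<theta> = entry_subst ?x"
  proof
    fix u show "\<theta> u = entry_subst ?x u"
      using assms[of u] by (cases u) (auto simp: UT2_comp_0 UT2_comp_1 matrix2_eq_iff)
  qed
qed

text \<open>
  The pure normal forms contribute to entry (1,1) of the value and the others to entry (1,2); in both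
  entries the contributions are distinct monomials in the coordinates of the substitution.
\<close>

lemma graded_identities_iff:
  "p \<in> graded_identities B UTC \<longleftrightarrow> p \<in> free_carrier \<and> (\<forall>n. nform_coeff p n = 0)"
proof (intro iffI conjI allI)
  assume p: "p \<in> graded_identities B UTC"
  show pc: "p \<in> free_carrier" using p by (simp add: graded_identities_def)
  have "wpoly_value UTC (entry_subst x) p = 0" for x
    using p[unfolded graded_identities_def UT2C_simps] entry_subst_hcomp by blast
  then have zero: "(\<Sum>n\<in>nforms p. nform_coeff p n * nform_value x n $ i $ j) = 0" for x i j
    using wpoly_value_entry_subst[OF pc, of x i j] by simp
  have part: "nform_coeff p n = 0" if n: "n \<in> nforms p"
    and Q: "inj_on exponents {n. Q n}" "Q n"
      "\<And>(x :: entry \<Rightarrow> 'f) n. nform_value x n $ i $ j = (if Q n then \<Prod>l\<in>#exponents n. x l else 0)" for n Q i j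
  proof (rule monomials_independent[where N = "{n \<in> nforms p. Q n}" and e = exponents])
    show "(\<Sum>n | n \<in> nforms p \<and> Q n. nform_coeff p n * (\<Prod>l\<in>#exponents n. x l)) = 0" for x
    proof -
      have "(\<Sum>n | n \<in> nforms p \<and> Q n. nform_coeff p n * (\<Prod>l\<in>#exponents n. x l)) =
          (\<Sum>n\<in>nforms p. nform_coeff p n * nform_value x n $ i $ j)"
        unfolding Q(3) by (rule sum.mono_neutral_cong_left) (auto simp: finite_nforms)
      then show ?thesis using zero by simp
    qed
  qed (use finite_nforms Q n in \<open>auto intro: inj_on_subset\<close>)
  fix n show "nform_coeff p n = 0"
  proof (cases "n \<in> nforms p")
    case True
    have 1: "nform_value x n $ 1 $ 1 = (if is_Pure n then \<Prod>l\<in>#exponents n. x l else 0)"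
      and 2: "nform_value x n $ 1 $ 2 = (if \<not> is_Pure n then \<Prod>l\<in>#exponents n. x l else 0)"
      for x :: "entry \<Rightarrow> 'f" and n
      by (cases n; simp add: multiset.map_comp comp_def)+
    show ?thesis
      using part[OF True inj_on_exponents(1) _ 1] part[OF True inj_on_exponents(2) _ 2] by blast
  qed (rule nform_coeff_not_nforms)
next
  assume p: "p \<in> free_carrier \<and> (\<forall>n. nform_coeff p n = 0)"
  have "wpoly_value UTC \<theta> p = 0" if \<theta>: "\<forall>u. \<theta> u \<in> UT2_comp (vdeg u)" for \<theta>
  proof -
    obtain x where "\<theta> = entry_subst x" using graded_subst_entry[of \<theta>] \<theta> by blast
    then show ?thesis using p wpoly_value_entry_subst[of p x] by (simp add: matrix2_eq_iff)
  qed
  then show "p \<in> graded_identities B UTC" using p by (simp add: graded_identities_def)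
qed

end

section \<open>Rewriting monomials modulo the generators\<close>

text \<open>
  The list for $y_{i_1} \cdots y_{i_k} b$. A nontrivial coefficient can only follow the last
  variable, because every variable carries the coefficient to its right.
\<close>

fun y_block :: "'w::one \<Rightarrow> nat list \<Rightarrow> (gvar \<times> 'w) list" where
  "y_block b [] = []"
| "y_block b [i] = [(Y i, b)]"
| "y_block b (i # j # is) = (Y i, 1) # y_block b (j # is)"

lemma y_block_Cons: "is \<noteq> [] \<Longrightarrow> y_block b (i # is) = (Y i, 1) # y_block b is"
  by (cases "is") auto

lemma y_block_one: "y_block 1 (i # is) = (Y i, 1) # y_block 1 is"
  by (cases "is") auto

lemma snd_y_block: "snd ` set (y_block b is) \<subseteq> {1, b}"
  by (induction b "is" rule: y_block.induct) auto

text \<open>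
  The lists of variables and coefficients whose monomial, preceded by the coefficient 1, has the given
  normal form. In the second case \<open>l\<close> is nonempty: a leading \<open>w1\<close> is not stored in the list.
\<close>

fun has_shape :: "'w \<Rightarrow> (gvar \<times> 'w::one) list \<Rightarrow> nform \<Rightarrow> bool" where
  "has_shape e us (Pure M) = (\<exists>l. us = y_block 1 l \<and> mset l = M)"
| "has_shape e us (Act L R) =
     (\<exists>l r. l \<noteq> [] \<and> us = y_block e l @ y_block 1 r \<and> mset l = L \<and> mset r = R)"
| "has_shape e us (Odd L k R) =
     (\<exists>l r. us = y_block 1 l @ (Z k, 1) # y_block 1 r \<and> mset l = L \<and> mset r = R)"

lemma has_shape_Y:
  assumes "has_shape e us n"
  obtains n' where "push_var (Y i) n = Some n'" "has_shape e ((Y i, 1) # us) n'"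
proof (cases n)
  case (Pure M)
  then obtain l where "us = y_block 1 l" "mset l = M" using assms by auto
  then have "has_shape e ((Y i, 1) # us) (Pure (add_mset i M))"
    by (auto simp: y_block_one intro!: exI[of _ "i # l"])
  then show ?thesis using that Pure by simp
next
  case (Act L R)
  then obtain l r where "l \<noteq> []" "us = y_block e l @ y_block 1 r" "mset l = L" "mset r = R"
    using assms by auto
  then have "has_shape e ((Y i, 1) # us) (Act (add_mset i L) R)"
    unfolding has_shape.simps
    by - (rule exI[of _ "i # l"], rule exI[of _ r], simp add: y_block_Cons)
  then show ?thesis using that Act by simp
next
  case (Odd L k R)
  then obtain l r where "us = y_block 1 l @ (Z k, 1) # y_block 1 r" "mset l = L" "mset r = R"
    using assms by auto
  then have "has_shape e ((Y i, 1) # us) (Odd (add_mset i L) k R)"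
    unfolding has_shape.simps
    by - (rule exI[of _ "i # l"], rule exI[of _ r], simp add: y_block_one)
  then show ?thesis using that Odd by simp
qed

lemma tail_nform_shape:
  assumes "tail_nform e us = Some n" "e \<noteq> 1"
  shows "has_shape e us n"
  using assms(1)
proof (induction us arbitrary: n)
  case Nil
  then show ?case by (auto intro!: exI[of _ "[]"])
next
  case (Cons x us)
  obtain u b where x: "x = (u, b)" by fastforce
  obtain n0 n1 where n: "tail_nform e us = Some n0" "push_coef e b n0 = Some n1" "push_var u n1 = Some n"
    using Cons.prems unfolding x by (auto simp: bind_eq_Some_conv)
  note shape = Cons.IH[OF n(1)]
  show ?case
  proof (cases "b = 1")
    case True
    then have n1: "n1 = n0" using n(2) by (simp add: push_coef_def)
    show ?thesis
    proof (cases u)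
      case (Y i)
      then show ?thesis using has_shape_Y[OF shape, of i] n(3) n1 True x by auto
    next
      case (Z k)
      then obtain M where M: "n0 = Pure M" "n = Odd {#} k M"
        using n(3) n1 by (cases n0) auto
      then show ?thesis using shape by (auto simp: x Z True intro!: exI[of _ "[]"])
    qed
  next
    case False
    then obtain M where M: "n0 = Pure M" "n1 = Act {#} M" "b = e"
      using n(2) by (auto simp: push_coef_def split: if_splits nform.splits)
    then obtain i where i: "u = Y i" "n = Act {#i#} M" using n(3) by (cases u) auto
    obtain l where l: "us = y_block 1 l" "mset l = M" using shape M by auto
    show ?thesis
      unfolding i has_shape.simps
      by (rule exI[of _ "[i]"], rule exI[of _ l]) (simp add: l x M i)
  qed
qed

context C_action
begin

definition generators :: "('f, 'w) wpoly set" where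
  "generators =
     {fmult s B (fvar (Y 0)) (fvar (Y 1)) - fmult s B (fvar (Y 1)) (fvar (Y 0)),
      fmult s B (fvar (Z 0)) (fvar (Z 1))} \<union>
     (\<lambda>b. fract s B (fvar (Y 0)) b) ` (B - {1, w1}) \<union> (\<lambda>b. flact s B b (fvar (Y 0))) ` (B - {1, w1}) \<union>
     (\<lambda>b. fract s B (fvar (Z 0)) b) ` (B - {1}) \<union> (\<lambda>b. flact s B b (fvar (Z 0))) ` (B - {1})"

lemma kernel_\<phi>:
  assumes "\<phi> x = 0"
  shows "x \<in> span (B - {1, w1})"
proof -
  have zero: "\<phi> y = 0" if "y \<in> span (B - {1, w1})" for y
    using that
  proof (induction rule: span_induct_alt)
    case base
    show ?case using \<phi>_hom(2)[of 0 0] by simp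
  next
    case (step c y z)
    then show ?case using \<phi>_other[of y] by (simp add: \<phi>_hom)
  qed
  have "B = insert 1 (insert w1 (B - {1, w1}))" using one_in_B w1_in_B by auto
  then have "x \<in> span (insert 1 (insert w1 (B - {1, w1})))" using span_B by simp
  then obtain c where c: "x - s c 1 \<in> span (insert w1 (B - {1, w1}))"
    using span_breakdown_eq by blast
  then obtain d where d: "x - s c 1 - s d w1 \<in> span (B - {1, w1})"
    using span_breakdown_eq by blast
  have "\<phi> x = \<phi> (x - s c 1 - s d w1) + mscale c (mat 1) + mscale d (munit 1 2)"
    using \<phi>_hom(1)[of "x - s c 1 - s d w1" "s c 1 + s d w1"] by (simp add: \<phi>_hom \<phi>_w1 add.assoc)
  then have "mscale c (mat 1) + mscale d (munit 1 2) = 0" using zero[OF d] assms by simp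
  then have "c = 0" "d = 0" by (auto simp: matrix2_eq_iff)
  with d show ?thesis by simp
qed

text \<open>
  The even part of \<open>w1\<close> acts as an even matrix in \<open>C\<close>, that is as a scalar, and comparing diagonal
  entries with those of $e_{12}$ shows that the scalar is zero. The odd part of \<open>w1\<close> can thus take
  the role of \<open>w1\<close> in places where homogeneity matters.
\<close>

lemma w1_odd_part:
  obtains g0 g1 where "w1 = g0 + g1" "g0 \<in> span (B - {1, w1})" "g1 \<in> G 1"
proof -
  obtain g0 g1 where g: "g0 \<in> G 0" "g1 \<in> G 1" "w1 = g0 + g1" using components_span by blast
  have "\<phi> g0 \<in> UT2_comp 0" "\<phi> g1 \<in> UT2_comp 1" "\<phi> g0 \<in> C_alg" "\<phi> g0 + \<phi> g1 = munit 1 2"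
    using g \<phi>_hom \<phi>_w1 by metis+
  then have "\<phi> g0 = 0" by (auto simp: UT2_comp_0 UT2_comp_1 C_alg_eq matrix2_eq_iff)
  then show ?thesis using that g kernel_\<phi> by blast
qed

end

locale containing_T_ideal = C_action s G B \<phi> w1
  for s :: "'f::field_char_0 \<Rightarrow> 'w::ring_1 \<Rightarrow> 'w" and G B \<phi> w1 +
  fixes J :: "('f, 'w) wpoly set"
  assumes T_ideal_J: "T_ideal W J" and generators_J: "generators \<subseteq> J"
begin

sublocale free: graded_W_algebra s G B W
  by (rule free_graded_W_algebra)

lemma J_carr: "p \<in> J \<Longrightarrow> p \<in> free_carrier"
  and J_0: "0 \<in> J"
  and J_add: "p \<in> J \<Longrightarrow> q \<in> J \<Longrightarrow> p + q \<in> J"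
  and J_scale: "p \<in> J \<Longrightarrow> fscale c p \<in> J"
  and J_mult: "p \<in> J \<Longrightarrow> q \<in> free_carrier \<Longrightarrow> fmult s B p q \<in> J" 
    "p \<in> J \<Longrightarrow> q \<in> free_carrier \<Longrightarrow> fmult s B q p \<in> J"
  and J_lact: "p \<in> J \<Longrightarrow> flact s B a p \<in> J"
  and J_ract: "p \<in> J \<Longrightarrow> fract s B p a \<in> J"
  and J_endo: "gw_endomorphism W \<psi> \<Longrightarrow> p \<in> J \<Longrightarrow> \<psi> p \<in> J"
  using T_ideal_J unfolding T_ideal_def free_gw_simps by blast+

lemma J_sum: "(\<And>x. x \<in> S \<Longrightarrow> f x \<in> J) \<Longrightarrow> sum f S \<in> J"
  by (induction S rule: infinite_finite_induct) (auto simp: J_0 J_add)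

lemma fmult_diff_left: "fmult s B (p - q) r = fmult s B p r - fmult s B q r"
  and fmult_diff_right: "fmult s B r (p - q) = fmult s B r p - fmult s B r q"
  and flact_diff: "flact s B a (p - q) = flact s B a p - flact s B a q"
  and fract_diff: "fract s B (p - q) a = fract s B p a - fract s B q a"
  using fmult_add_left[of "p - q" q r] fmult_add_right[of r "p - q" q]
    flact_add_right[of a "p - q" q] fract_add_left[of "p - q" q a] by (simp_all add: algebra_simps)

text \<open>
  Two elements of the right degrees can be substituted for two variables. This turns the generators,
  which concern single variables, into rules for all homogeneous elements.
\<close>

lemma J_substitute:
  assumes "p \<in> hcomp W (vdeg u)" "q \<in> hcomp W (vdeg v)" "u \<noteq> v"
  obtains \<psi> where "\<And>r. r \<in> J \<Longrightarrow> \<psi> r \<in> J" "\<psi> (fvar u) = p" "\<psi> (fvar v) = q"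
    "\<And>x y. \<psi> (x - y) = \<psi> x - \<psi> y"
    "\<And>x y. \<psi> (fmult s B (fvar x) (fvar y)) = fmult s B (\<psi> (fvar x)) (\<psi> (fvar y))"
    "\<And>a x. \<psi> (flact s B a (fvar x)) = flact s B a (\<psi> (fvar x))"
    "\<And>a x. \<psi> (fract s B (fvar x) a) = fract s B (\<psi> (fvar x)) a"
proof
  define \<theta> where "\<theta> = fvar(u := p, v := q)"
  have graded: "\<theta> t \<in> hcomp W (vdeg t)" for t
    using assms fvar_hcomp by (auto simp: \<theta>_def)
  note endo = substitution_endomorphism[of \<theta>, OF graded]
  show "wpoly_value W \<theta> r \<in> J" if "r \<in> J" for r
    using J_endo[OF endo that] .
  show "wpoly_value W \<theta> (fvar u) = p" "wpoly_value W \<theta> (fvar v) = q"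
    using substitution_fvar[of \<theta>, OF graded] assms(3) by (simp_all add: \<theta>_def)
  show "wpoly_value W \<theta> (x - y) = wpoly_value W \<theta> x - wpoly_value W \<theta> y" for x y
    using free.wpoly_value_add[of \<theta> "x - y" y] by simp
  note hom = endo[unfolded gw_endomorphism_def free_gw_simps]
  show "wpoly_value W \<theta> (fmult s B (fvar x) (fvar y)) =
      fmult s B (wpoly_value W \<theta> (fvar x)) (wpoly_value W \<theta> (fvar y))" for x y
    using hom fvar_in_free_carrier by blast
  show "wpoly_value W \<theta> (flact s B a (fvar x)) = flact s B a (wpoly_value W \<theta> (fvar x))"
    "wpoly_value W \<theta> (fract s B (fvar x) a) = fract s B (wpoly_value W \<theta> (fvar x)) a" for a x
    using hom fvar_in_free_carrier by blast+
qed

lemma hcomp_free_carrier: "p \<in> hcomp W d \<Longrightarrow> p \<in> free_carrier"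
  using free.hcomp_subset by fastforce

lemma YZ_neq: "Y 0 \<noteq> Y 1" "Z 0 \<noteq> Z 1"
  by simp_all

lemma even_commute:
  assumes "p \<in> hcomp W 0" "q \<in> hcomp W 0"
  shows "fmult s B p q - fmult s B q p \<in> J"
proof -
  obtain \<psi> where \<psi>: "\<And>r. r \<in> J \<Longrightarrow> \<psi> r \<in> J" "\<psi> (fvar (Y 0)) = p" "\<psi> (fvar (Y 1)) = q"
    "\<And>x y. \<psi> (x - y) = \<psi> x - \<psi> y"
    "\<And>x y. \<psi> (fmult s B (fvar x) (fvar y)) = fmult s B (\<psi> (fvar x)) (\<psi> (fvar y))"
    by (rule J_substitute[of p "Y 0" q "Y 1", unfolded vdeg.simps, OF assms YZ_neq(1)]) blast
  have "fmult s B (fvar (Y 0)) (fvar (Y 1)) - fmult s B (fvar (Y 1)) (fvar (Y 0)) \<in> J"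
    using generators_J by (simp add: generators_def)
  from \<psi>(1)[OF this] show ?thesis unfolding \<psi>(2-) .
qed

lemma odd_mult:
  assumes "p \<in> hcomp W 1" "q \<in> hcomp W 1"
  shows "fmult s B p q \<in> J"
proof -
  obtain \<psi> where \<psi>: "\<And>r. r \<in> J \<Longrightarrow> \<psi> r \<in> J" "\<psi> (fvar (Z 0)) = p" "\<psi> (fvar (Z 1)) = q"
    "\<And>x y. \<psi> (fmult s B (fvar x) (fvar y)) = fmult s B (\<psi> (fvar x)) (\<psi> (fvar y))"
    by (rule J_substitute[of p "Z 0" q "Z 1", unfolded vdeg.simps, OF assms YZ_neq(2)]) blast
  have "fmult s B (fvar (Z 0)) (fvar (Z 1)) \<in> J"
    using generators_J by (simp add: generators_def)
  from \<psi>(1)[OF this] show ?thesis unfolding \<psi>(2-) .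
qed

lemma odd_act:
  assumes "p \<in> hcomp W 1" "b \<in> B - {1}"
  shows "flact s B b p \<in> J" "fract s B p b \<in> J"
proof -
  obtain \<psi> where \<psi>: "\<And>r. r \<in> J \<Longrightarrow> \<psi> r \<in> J" "\<psi> (fvar (Z 0)) = p"
    "\<And>a x. \<psi> (flact s B a (fvar x)) = flact s B a (\<psi> (fvar x))"
    "\<And>a x. \<psi> (fract s B (fvar x) a) = fract s B (\<psi> (fvar x)) a"
    by (rule J_substitute[of p "Z 0" p "Z 1", unfolded vdeg.simps, OF assms(1) assms(1) YZ_neq(2)]) blast
  have "flact s B b (fvar (Z 0)) \<in> J" "fract s B (fvar (Z 0)) b \<in> J"
    using generators_J assms(2) by (auto simp: generators_def)
  from this[THEN \<psi>(1)] show "flact s B b p \<in> J" "fract s B p b \<in> J" unfolding \<psi>(2-) .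
qed

lemma even_act:
  assumes "p \<in> hcomp W 0" "b \<in> B - {1, w1}"
  shows "flact s B b p \<in> J" "fract s B p b \<in> J"
proof -
  obtain \<psi> where \<psi>: "\<And>r. r \<in> J \<Longrightarrow> \<psi> r \<in> J" "\<psi> (fvar (Y 0)) = p"
    "\<And>a x. \<psi> (flact s B a (fvar x)) = flact s B a (\<psi> (fvar x))"
    "\<And>a x. \<psi> (fract s B (fvar x) a) = fract s B (\<psi> (fvar x)) a"
    by (rule J_substitute[of p "Y 0" p "Y 1", unfolded vdeg.simps, OF assms(1) assms(1) YZ_neq(1)]) blast
  have "flact s B b (fvar (Y 0)) \<in> J" "fract s B (fvar (Y 0)) b \<in> J"
    using generators_J assms(2) by (auto simp: generators_def)
  from this[THEN \<psi>(1)] show "flact s B b p \<in> J" "fract s B p b \<in> J" unfolding \<psi>(2-) .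
qed

lemma even_act_span:
  assumes "p \<in> hcomp W 0" "x \<in> span (B - {1, w1})"
  shows "flact s B x p \<in> J" "fract s B p x \<in> J"
proof -
  have "flact s B x p \<in> J \<and> fract s B p x \<in> J"
    using assms(2)
  proof (induction rule: span_induct_alt)
    case base
    show ?case using flact_scale_left[of 0 0 p] fract_scale_right[of p 0 0] J_0 by simp
  next
    case (step c b y)
    then show ?case
      using even_act[OF assms(1) step(1)]
      by (simp add: flact_add_left flact_scale_left fract_add_right fract_scale_right J_add J_scale)
  qed
  then show "flact s B x p \<in> J" "fract s B p x \<in> J" by auto
qed

text \<open>
  The elements that are homogeneous modulo \<open>J\<close>. Homogeneity itself is not preserved by \<open>w1\<close>.
\<close>

definition mod_class :: "bit \<Rightarrow> ('f, 'w) wpoly set" where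
  "mod_class d = {q + j | q j. q \<in> hcomp W d \<and> j \<in> J}"

text \<open>
  What the normal form of a monomial tells about its position relative to \<open>J\<close>: a special factor
  makes the monomial odd, and a missing normal form puts it into \<open>J\<close>.
\<close>

fun nform_class :: "nform option \<Rightarrow> ('f, 'w) wpoly set" where
  "nform_class None = J"
| "nform_class (Some (Pure M)) = mod_class 0"
| "nform_class (Some n) = mod_class 1"

lemma mod_classI: "q \<in> hcomp W d \<Longrightarrow> j \<in> J \<Longrightarrow> q + j \<in> mod_class d"
  by (auto simp: mod_class_def)

lemma hcomp_mod_class: "q \<in> hcomp W d \<Longrightarrow> q \<in> mod_class d"
  using mod_classI[OF _ J_0] by fastforce

lemma w1_even_mod_class:
  assumes "p \<in> hcomp W 0"
  shows "flact s B w1 p \<in> mod_class 1" "fract s B p w1 \<in> mod_class 1"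
proof -
  obtain g0 g1 where g: "w1 = g0 + g1" "g0 \<in> span (B - {1, w1})" "g1 \<in> G 1" by (rule w1_odd_part)
  have "flact s B g1 p \<in> hcomp W 1" "fract s B p g1 \<in> hcomp W 1"
    using free.lact_hcomp[OF g(3) assms] free.ract_hcomp[OF assms g(3)] by simp_all
  then show "flact s B w1 p \<in> mod_class 1" "fract s B p w1 \<in> mod_class 1"
    using even_act_span[OF assms g(2)] unfolding g(1) flact_add_left fract_add_right
    by (subst add.commute; simp add: mod_classI)+
qed

text \<open>
  The coefficient 1 changes nothing, and any other coefficient annihilates odd elements modulo \<open>J\<close>. On
  even elements \<open>w1\<close> gives odd ones modulo \<open>J\<close>, and the remaining coefficients give elements of \<open>J\<close>.
\<close>

lemma nform_class_push_coef:
  assumes "p \<in> nform_class n" "b \<in> B"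
  shows "flact s B b p \<in> nform_class (Option.bind n (push_coef w1 b))"
proof (cases n)
  case None
  then show ?thesis using assms J_lact by simp
next
  case (Some n')
  have "\<exists>d q j. p = q + j \<and> q \<in> hcomp W d \<and> j \<in> J \<and> (d = 0 \<longleftrightarrow> is_Pure n')"
    using assms(1) Some by (cases n') (auto simp: mod_class_def)
  then obtain d q j where p: "p = q + j" "q \<in> hcomp W d" "j \<in> J" "d = 0 \<longleftrightarrow> is_Pure n'"
    by blast
  consider "b = 1" | "b = w1" | "b \<noteq> 1" "b \<noteq> w1" by blast
  then show ?thesis
  proof cases
    case 1
    have "p \<in> free_carrier"
      using free_carrier_closed(1)[OF hcomp_free_carrier[OF p(2)] J_carr[OF p(3)]] p(1) by simp
    then show ?thesis using 1 assms(1) Some by (simp add: flact_one push_coef_def)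
  next
    case 2
    show ?thesis
    proof (cases "is_Pure n'")
      case True
      then obtain M where M: "n' = Pure M" by (cases n') auto
      have "flact s B w1 q \<in> mod_class 1" using w1_even_mod_class p True by simp
      then obtain q' j' where "flact s B w1 q = q' + j'" "q' \<in> hcomp W 1" "j' \<in> J"
        by (auto simp: mod_class_def)
      then have "flact s B w1 p \<in> mod_class 1"
        using p J_lact[OF p(3), of w1] by (auto simp: flact_add_right add.assoc intro!: mod_classI J_add)
      then show ?thesis using w1_neq_1 by (simp add: 2 Some M push_coef_def)
    next
      case False
      then have "d = 1" using p(4) by simp
      then have "flact s B w1 p \<in> J"
        using odd_act(1)[of q w1] p w1_in_B w1_neq_1 by (simp add: flact_add_right J_add J_lact)
      then show ?thesis using False w1_neq_1 by (cases n') (simp_all add: 2 Some push_coef_def)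
    qed
  next
    case 3
    have "flact s B b q \<in> J"
      using odd_act(1)[of q b] even_act(1)[of q b] p(2) 3 assms(2) by (cases d) auto
    then show ?thesis using 3 p by (simp add: Some push_coef_def flact_add_right J_add J_lact)
  qed
qed

lemma nform_class_push_var:
  assumes "p \<in> nform_class n"
  shows "fmult s B (fvar u) p \<in> nform_class (Option.bind n (push_var u))"
proof (cases n)
  case None
  then show ?thesis using assms J_mult fvar_in_free_carrier by simp
next
  case (Some n')
  have "\<exists>d q j. p = q + j \<and> q \<in> hcomp W d \<and> j \<in> J \<and> (d = 0 \<longleftrightarrow> is_Pure n')"
    using assms(1) Some by (cases n') (auto simp: mod_class_def)
  then obtain d q j where p: "p = q + j" "q \<in> hcomp W d" "j \<in> J" "d = 0 \<longleftrightarrow> is_Pure n'"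
    by blast
  have h: "fmult s B (fvar u) q \<in> hcomp W (vdeg u + d)"
    using free.mult_hcomp[OF fvar_hcomp p(2)] by simp
  have j: "fmult s B (fvar u) j \<in> J" using J_mult(2)[OF p(3) fvar_in_free_carrier] .
  have cls: "fmult s B (fvar u) p \<in> mod_class (vdeg u + d)"
    using h j by (simp add: p(1) fmult_add_right mod_classI)
  have odd: "fmult s B (fvar u) p \<in> J" if "vdeg u = 1" "d = 1"
    using odd_mult[of "fvar u" q] fvar_hcomp[of u] p(2) j that by (simp add: p(1) fmult_add_right J_add)
  show ?thesis
    using cls odd p(4) by (cases n'; cases u) (auto simp: Some)
qed

lemma nform_class_last:
  assumes "b \<in> B"
  shows "fract s B (fvar u) b \<in> nform_class (tail_nform w1 [(u, b)])"
proof -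
  note fv = fvar_hcomp[of u]
  consider "b = 1" | "b = w1" | "b \<noteq> 1" "b \<noteq> w1" by blast
  then show ?thesis
  proof cases
    case 1
    then show ?thesis
      using hcomp_mod_class[OF fv] fract_one[OF fvar_in_free_carrier]
      by (cases u) (simp_all add: push_coef_def)
  next
    case 2
    show ?thesis
      using w1_even_mod_class(2)[of "fvar u"] odd_act(2)[of "fvar u" w1] fv w1_in_B w1_neq_1
      by (cases u) (simp_all add: push_coef_def 2)
  next
    case 3
    then show ?thesis
      using even_act(2)[of "fvar u" b] odd_act(2)[of "fvar u" b] fv assms
      by (cases u) (simp_all add: push_coef_def)
  qed
qed

lemma flact_one_mono: "b \<in> B \<Longrightarrow> flact s B b (mono_elem (Mono 1 us)) = mono_elem (Mono b us)"
  by (simp add: flact_mono_elem basis_ext_basis[OF fscale.vector_space_axioms])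

lemma fmult_mono_mono:
  assumes "us \<noteq> []" "snd ` set us \<subseteq> B"
  shows "fmult s B (mono_elem (Mono a us)) (mono_elem (Mono 1 vs)) = mono_elem (Mono a (us @ vs))"
proof -
  obtain us' u b where us: "us = us' @ [(u, b)]" using assms(1) by (metis rev_exhaust surj_pair)
  then show ?thesis
    using assms by (simp add: fmult_mono_elem basis_ext_basis[OF fscale.vector_space_axioms])
qed

lemma fract_mono_one:
  "b \<in> B \<Longrightarrow> fract s B (mono_elem (Mono a (us @ [(u, 1)]))) b = mono_elem (Mono a (us @ [(u, b)]))"
  by (simp add: fract_mono_elem basis_ext_basis[OF fscale.vector_space_axioms])

lemma tail_nform_class:
  assumes "us \<noteq> []" "snd ` set us \<subseteq> B"
  shows "mono_elem (Mono 1 us) \<in> nform_class (tail_nform w1 us)"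
  using assms
proof (induction us)
  case (Cons x us)
  obtain u b where x: "x = (u, b)" by fastforce
  have b: "b \<in> B" using Cons.prems x by simp
  show ?case
  proof (cases "us = []")
    case True
    then show ?thesis
      using nform_class_last[OF b, of u] fract_mono_one[OF b, of 1 "[]" u] by (simp add: x fvar_def)
  next
    case False
    have "mono_elem (Mono 1 (x # us)) = fmult s B (fvar u) (flact s B b (mono_elem (Mono 1 us)))"
      using fmult_mono_elem[of 1 "[]" u 1 b us] b
      by (simp add: x flact_one_mono fvar_def basis_ext_basis[OF fscale.vector_space_axioms])
    then show ?thesis
      using nform_class_push_var[OF nform_class_push_coef[OF Cons.IH b]] False Cons.prems
      by (simp add: x)
  qed
qed simp

lemma mono_nform_class:
  assumes "m \<in> basis_monos B"
  shows "mono_elem m \<in> nform_class (mono_nform w1 m)"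
proof -
  obtain a us where m: "m = Mono a us" "us \<noteq> []" "a \<in> B" "snd ` set us \<subseteq> B"
    using assms by (auto simp: basis_monos_def)
  then show ?thesis
    using nform_class_push_coef[OF tail_nform_class[OF m(2,4)] m(3)] by (simp add: flact_one_mono)
qed

definition cong :: "('f, 'w) wpoly \<Rightarrow> ('f, 'w) wpoly \<Rightarrow> bool" where
  "cong p q \<longleftrightarrow> p - q \<in> J"

lemma cong_refl [simp]: "cong p p" by (simp add: cong_def J_0)

lemma cong_trans [trans]: "cong p q \<Longrightarrow> cong q r \<Longrightarrow> cong p r"
  using J_add[of "p - q" "q - r"] by (simp add: cong_def)

lemma cong_context:
  assumes "cong (mono_elem (Mono 1 xs)) (mono_elem (Mono 1 ys))"
    and "xs \<noteq> []" "ys \<noteq> []" "snd ` set xs \<subseteq> B" "snd ` set ys \<subseteq> B"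
    and "a \<in> B" "snd ` set us \<subseteq> B" "snd ` set vs \<subseteq> B"
  shows "cong (mono_elem (Mono a (us @ xs @ vs))) (mono_elem (Mono a (us @ ys @ vs)))"
proof -
  have 1: "cong (mono_elem (Mono 1 (xs @ vs))) (mono_elem (Mono 1 (ys @ vs)))"
  proof (cases "vs = []")
    case False
    then have "mono_elem (Mono 1 vs) \<in> free_carrier" using assms(8) one_in_B by (simp add: Mono_in_basis_monos)
    from J_mult(1)[OF assms(1)[unfolded cong_def] this] show ?thesis
      by (simp add: cong_def fmult_diff_left fmult_mono_mono assms)
  qed (use assms in simp)
  show ?thesis
  proof (cases "us = []")
    case True
    then show ?thesis
      using J_lact[OF 1[unfolded cong_def], of a] assms(6) by (simp add: cong_def flact_diff flact_one_mono)
  next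
    case False
    then have "mono_elem (Mono a us) \<in> free_carrier" using assms by (simp add: Mono_in_basis_monos)
    from J_mult(2)[OF 1[unfolded cong_def] this] False show ?thesis
      by (simp add: cong_def fmult_diff_right fmult_mono_mono assms)
  qed
qed

lemma cong_swap:
  assumes "b \<in> B"
  shows "cong (mono_elem (Mono 1 [(Y i, 1), (Y j, b)])) (mono_elem (Mono 1 [(Y j, 1), (Y i, b)]))"
proof -
  have m: "fract s B (fmult s B (fvar (Y i)) (fvar (Y j))) b = mono_elem (Mono 1 [(Y i, 1), (Y j, b)])" for i j
    using fmult_mono_mono[of "[(Y i, 1)]" 1 "[(Y j, 1)]"] fract_mono_one[OF assms, of 1 "[(Y i, 1)]" "Y j"] one_in_B
    by (simp add: fvar_def)
  have "fract s B (fmult s B (fvar (Y i)) (fvar (Y j)) - fmult s B (fvar (Y j)) (fvar (Y i))) b \<in> J"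
    using J_ract[OF even_commute] fvar_hcomp[of "Y _"] by simp
  then show ?thesis by (simp add: cong_def fract_diff m)
qed

lemma snd_y_block_B: "b \<in> B \<Longrightarrow> snd ` set (y_block b is) \<subseteq> B"
  using snd_y_block[of b "is"] one_in_B by auto

lemma cong_swap_block:
  assumes "a \<in> B" "b \<in> B" "snd ` set us \<subseteq> B" "snd ` set vs \<subseteq> B"
  shows "cong (mono_elem (Mono a (us @ y_block b (i # j # is) @ vs)))
    (mono_elem (Mono a (us @ y_block b (j # i # is) @ vs)))"
proof (cases "is")
  case Nil
  then show ?thesis using cong_context[OF cong_swap[OF assms(2), of i j], of a us vs] assms one_in_B by simp
next
  case (Cons k ks)
  then show ?thesis
    using cong_context[OF cong_swap[OF one_in_B, of i j], of a us "y_block b is @ vs"] assms one_in_B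
      snd_y_block_B[OF assms(2), of "is"] by (simp add: image_Un)
qed

text \<open>
  One step of sorting: repeated swaps of neighbours bring a chosen variable to the front of its
  block. The list \<open>us\<close> absorbs the variables in front of the block, so it varies in the induction.
\<close>

lemma cong_move_block:
  assumes "a \<in> B" "b \<in> B" "snd ` set us \<subseteq> B" "snd ` set vs \<subseteq> B"
  shows "cong (mono_elem (Mono a (us @ y_block b (is @ j # js) @ vs)))
    (mono_elem (Mono a (us @ y_block b (j # is @ js) @ vs)))"
  using assms(3)
proof (induction "is" arbitrary: us)
  case (Cons i "is")
  have "cong (mono_elem (Mono a ((us @ [(Y i, 1)]) @ y_block b (is @ j # js) @ vs)))
      (mono_elem (Mono a ((us @ [(Y i, 1)]) @ y_block b (j # is @ js) @ vs)))"
    by (rule Cons.IH) (use Cons.prems one_in_B in auto)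
  then have "cong (mono_elem (Mono a (us @ y_block b (i # is @ j # js) @ vs)))
      (mono_elem (Mono a (us @ y_block b (i # j # is @ js) @ vs)))"
    by (simp add: y_block_Cons)
  also have "cong \<dots> (mono_elem (Mono a (us @ y_block b (j # i # is @ js) @ vs)))"
    by (rule cong_swap_block) (use assms Cons.prems in auto)
  finally show ?case by simp
qed simp

lemma cong_permute_block:
  assumes "a \<in> B" "b \<in> B" "snd ` set us \<subseteq> B" "snd ` set vs \<subseteq> B" "mset is = mset js"
  shows "cong (mono_elem (Mono a (us @ y_block b is @ vs))) (mono_elem (Mono a (us @ y_block b js @ vs)))"
  using assms(3,5)
proof (induction js arbitrary: "is" us)
  case (Cons j js)
  then have "j \<in> set is" by (metis list.set_intros(1) set_mset_mset)
  then obtain is1 is2 where "is": "is = is1 @ j # is2" by (meson split_list)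
  have eq: "mset (is1 @ is2) = mset js" using Cons.prems(2) by (simp add: "is")
  have "cong (mono_elem (Mono a (us @ y_block b is @ vs)))
      (mono_elem (Mono a (us @ y_block b (j # is1 @ is2) @ vs)))"
    unfolding "is" by (rule cong_move_block) (use assms Cons.prems in auto)
  also have "cong \<dots> (mono_elem (Mono a (us @ y_block b (j # js) @ vs)))"
  proof (cases "js = []")
    case True
    then show ?thesis using eq by simp
  next
    case False
    then have "is1 @ is2 \<noteq> []" using eq by auto
    moreover have "cong (mono_elem (Mono a ((us @ [(Y j, 1)]) @ y_block b (is1 @ is2) @ vs)))
      (mono_elem (Mono a ((us @ [(Y j, 1)]) @ y_block b js @ vs)))"
      by (rule Cons.IH) (use Cons.prems one_in_B eq in auto)
    ultimately show ?thesis using False by (simp add: y_block_Cons del: append_is_Nil_conv)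
  qed
  finally show ?case .
qed simp

lemma cong_shape:
  assumes "a \<in> B" "has_shape w1 us n" "has_shape w1 us' n"
  shows "cong (mono_elem (Mono a us)) (mono_elem (Mono a us'))"
proof (cases n)
  case (Pure M)
  then show ?thesis
    using assms cong_permute_block[of a 1 "[]" "[]"] one_in_B by auto
next
  case (Act L R)
  then obtain l r l' r' where s: "us = y_block w1 l @ y_block 1 r" "us' = y_block w1 l' @ y_block 1 r'"
    "mset l = mset l'" "mset r = mset r'" using assms(2,3) by auto
  have "cong (mono_elem (Mono a us)) (mono_elem (Mono a (y_block w1 l' @ y_block 1 r)))"
    using cong_permute_block[of a w1 "[]" "y_block 1 r" l l'] assms(1) w1_in_B s
      snd_y_block_B[OF one_in_B, of r] by simp
  also have "cong \<dots> (mono_elem (Mono a us'))"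
    using cong_permute_block[of a 1 "y_block w1 l'" "[]" r r'] assms(1) one_in_B s
      snd_y_block_B[OF w1_in_B, of l'] by simp
  finally show ?thesis .
next
  case (Odd L k R)
  then obtain l r l' r' where s: "us = y_block 1 l @ (Z k, 1) # y_block 1 r"
    "us' = y_block 1 l' @ (Z k, 1) # y_block 1 r'"
    "mset l = mset l'" "mset r = mset r'" using assms(2,3) by auto
  have "cong (mono_elem (Mono a us)) (mono_elem (Mono a (y_block 1 l' @ (Z k, 1) # y_block 1 r)))"
    using cong_permute_block[of a 1 "[]" "(Z k, 1) # y_block 1 r" l l'] assms(1) one_in_B s
      snd_y_block_B[OF one_in_B, of r] by simp
  also have "cong \<dots> (mono_elem (Mono a us'))"
    using cong_permute_block[of a 1 "y_block 1 l' @ [(Z k, 1)]" "[]" r r'] assms(1) one_in_B s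
      snd_y_block_B[OF one_in_B, of l'] by simp
  finally show ?thesis .
qed

text \<open>
  Apart from the coefficient 1, a monomial can start with \<open>w1\<close>; it then continues with even variables
  only, which is the case excluded by the nonempty left block in \<open>has_shape\<close>.
\<close>

lemma mono_nform_cases:
  assumes "mono_nform w1 (Mono a us) = Some n"
  shows "a = 1 \<and> has_shape w1 us n \<or> (\<exists>M. n = Act {#} M \<and> a = w1 \<and> has_shape w1 us (Pure M))"
proof -
  obtain n0 where n0: "tail_nform w1 us = Some n0" "push_coef w1 a n0 = Some n"
    using assms by (auto simp: bind_eq_Some_conv)
  then show ?thesis
    using tail_nform_shape[OF n0(1) w1_neq_1]
    by (auto simp: push_coef_def split: if_splits nform.splits)
qed

lemma cong_nform:
  assumes "m \<in> basis_monos B" "m' \<in> basis_monos B" "mono_nform w1 m = Some n" "mono_nform w1 m' = Some n"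
  shows "cong (mono_elem m) (mono_elem m')"
proof -
  obtain a us a' us' where m: "m = Mono a us" "m' = Mono a' us'" "a \<in> B" "a' \<in> B"
    using assms(1,2) by (auto simp: basis_monos_def)
  note c = mono_nform_cases[OF assms(3)[unfolded m]] mono_nform_cases[OF assms(4)[unfolded m]]
  have "a = a' \<and> (\<exists>n. has_shape w1 us n \<and> has_shape w1 us' n)"
    using c by fastforce
  then show ?thesis using cong_shape m by auto
qed

text \<open>
  Replacing each monomial of an identity by a fixed representative of its normal form changes the
  polynomial by an element of \<open>J\<close>, and the result is zero since the coefficient sums vanish.
\<close>

lemma identities_subset_J: "graded_identities B UTC \<subseteq> J"
proof
  fix p assume "p \<in> graded_identities B UTC"
  then have p: "Poly_Mapping.keys p \<subseteq> basis_monos B" "\<And>n. nform_coeff p n = 0"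
    using graded_identities_iff by auto
  have "\<exists>m. m \<in> Poly_Mapping.keys p \<and> mono_nform w1 m = Some n" if "n \<in> nforms p" for n
    using that by (force simp: nforms_def)
  then obtain r where r: "\<And>n. n \<in> nforms p \<Longrightarrow> r n \<in> Poly_Mapping.keys p \<and> mono_nform w1 (r n) = Some n"
    by metis
  \<comment> \<open>The representative of a normal form; zero represents the monomials lying in \<open>J\<close>.\<close>
  define R :: "nform option \<Rightarrow> ('f, 'w) wpoly" where
    "R o' = (case o' of None \<Rightarrow> 0 | Some n \<Rightarrow> mono_elem (r n))" for o'
  have R: "mono_elem m - R (mono_nform w1 m) \<in> J" if m: "m \<in> Poly_Mapping.keys p" for m
  proof (cases "mono_nform w1 m")
    case None
    then show ?thesis using mono_nform_class[of m] m p by (auto simp: R_def)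
  next
    case (Some n)
    then have "n \<in> nforms p" using m by (force simp: nforms_def)
    then show ?thesis using cong_nform[of m "r n" n] r m p Some by (auto simp: R_def cong_def)
  qed
  have "(\<Sum>m\<in>Poly_Mapping.keys p. fscale (Poly_Mapping.lookup p m) (R (mono_nform w1 m))) = 0"
    (is "?S = 0")
  proof (rule poly_mapping_eqI)
    fix k
    have "Poly_Mapping.lookup ?S k = (\<Sum>n\<in>nforms p. nform_coeff p n * Poly_Mapping.lookup (R (Some n)) k)"
      using sum_by_nform[of "\<lambda>n. Poly_Mapping.lookup (R n) k" p]
      by (simp add: lookup_sum lookup_fscale R_def)
    then show "Poly_Mapping.lookup ?S k = Poly_Mapping.lookup 0 k" by (simp add: p)
  qed
  then have "p = (\<Sum>m\<in>Poly_Mapping.keys p.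
      fscale (Poly_Mapping.lookup p m) (mono_elem m - R (mono_nform w1 m)))"
    using poly_eq_sum_mono_elem[of p] by (simp add: fscale.scale_right_diff_distrib sum_subtractf)
  also have "\<dots> \<in> J" by (intro J_sum J_scale R)
  finally show "p \<in> J" .
qed

end

context C_action
begin

lemma generators_identities: "generators \<subseteq> graded_identities B UTC"
proof -
  have val: "wpoly_value UTC \<theta> (fvar u) = \<theta> u" for \<theta> u
    using UTC.wpoly_value_mono_elem[of \<theta> "Mono 1 [(u, 1)]"] by (simp add: fvar_def \<phi>_hom)
  have diff: "wpoly_value UTC \<theta> (p - q) = wpoly_value UTC \<theta> p - wpoly_value UTC \<theta> q" for \<theta> p q
    using UTC.wpoly_value_add[of \<theta> "p - q" q] by simp
  have UT: "\<theta> u \<in> UT2" if "\<forall>u. \<theta> u \<in> UT2_comp (vdeg u)" for \<theta> :: "gvar \<Rightarrow> 'f^2^2" and u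
    using that UT2_comp_subset by blast
  have comps: "\<theta> (Y i) $ 1 $ 2 = 0" "\<theta> (Y i) $ 2 $ 1 = 0" "\<theta> (Z i) $ 1 $ 1 = 0"
      "\<theta> (Z i) $ 2 $ 1 = 0" "\<theta> (Z i) $ 2 $ 2 = 0"
    if "\<forall>u. \<theta> u \<in> UT2_comp (vdeg u)" for \<theta> :: "gvar \<Rightarrow> 'f^2^2" and i
    using that[rule_format, of "Y i"] that[rule_format, of "Z i"] by (auto simp: UT2_comp_0 UT2_comp_1)
  have mult: "wpoly_value UTC \<theta> (fmult s B (fvar u) (fvar v)) = \<theta> u ** \<theta> v"
    and lact: "wpoly_value UTC \<theta> (flact s B a (fvar u)) = \<phi> a ** \<theta> u"
    and ract: "wpoly_value UTC \<theta> (fract s B (fvar u) a) = \<theta> u ** \<phi> a"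
    if "\<forall>u. \<theta> u \<in> UT2_comp (vdeg u)" for \<theta> u v a
    using UTC.wpoly_value_mult[of \<theta>, OF _ fvar_in_free_carrier fvar_in_free_carrier, of u v]
      UTC.wpoly_value_lact[of \<theta>, OF _ fvar_in_free_carrier, of a u]
      UTC.wpoly_value_ract[of \<theta>, OF _ fvar_in_free_carrier, of u a] UT[OF that] by (simp_all add: val)
  have \<phi>B: "\<phi> b $ 1 $ 1 = 0" "\<phi> b $ 2 $ 1 = 0" "\<phi> b $ 2 $ 2 = 0" if "b \<in> B" "b \<noteq> 1" for b
    using that \<phi>_other[of b] \<phi>_w1 by (cases "b = w1"; simp)+
  have carr: "generators \<subseteq> free_carrier"
    unfolding generators_def
    by (intro Un_least insert_subset[THEN iffD2] conjI empty_subsetI image_subsetI fmult_closed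
        fract_closed flact_closed fvar_in_free_carrier fscale.subspace_diff[OF subspace_free_carrier])
  have "wpoly_value UTC \<theta> g = 0" if \<theta>: "\<forall>u. \<theta> u \<in> UT2_comp (vdeg u)" and g: "g \<in> generators" for \<theta> g
    using g unfolding generators_def
    by (auto simp: \<phi>B \<phi>_other diff mult[OF \<theta>] lact[OF \<theta>] ract[OF \<theta>] matrix2_eq_iff matrix2_mult_nth comps[OF \<theta>] mult.commute)
  then show ?thesis using carr unfolding graded_identities_def by auto
qed

lemma identities_generated: "graded_identities B UTC = T_ideal_generated W generators"
proof -
  have "graded_identities B UTC \<subseteq> J" if "T_ideal W J" "generators \<subseteq> J" for J
  proof -
    interpret containing_T_ideal s G B \<phi> w1 J by unfold_locales (fact that)+
    show ?thesis by (rule identities_subset_J)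
  qed
  then show ?thesis
    using UTC.graded_identities_T_ideal generators_identities unfolding T_ideal_generated_def by auto
qed

end

section \<open>Dimensions of quotients\<close>

text \<open>
  The linear map \<open>L\<close> induces an injection \<open>\<Lambda>\<close> from the cosets of its kernel \<open>V\<close> to the image of \<open>U\<close>. It
  takes combinations of cosets to linear combinations, so it matches the bases of the quotient with
  those of the image. The existence of the former, on which the choice in \<open>quotient_dim\<close>
  depends, is inherited from the latter.
\<close>

lemma quotient_dim_linear_image:
  fixes sc :: "'f::field \<Rightarrow> 'a::ab_group_add \<Rightarrow> 'a" and sc' :: "'f \<Rightarrow> 'b::ab_group_add \<Rightarrow> 'b"
  assumes "vector_space sc" "vector_space sc'"
    and L_add: "\<And>x y. L (x + y) = L x + L y" and L_scale: "\<And>c x. L (sc c x) = sc' c (L x)"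
    and U: "module.subspace sc U" and V: "V = {x \<in> U. L x = 0}"
  shows "quotient_dim sc U V = vector_space.dim sc' (L ` U)"
proof -
  interpret A: vector_space sc by fact
  interpret A': vector_space sc' by fact
  note Us = A.subspace_add[OF U] A.subspace_scale[OF U] A.subspace_0[OF U] A.subspace_diff[OF U]
  have L0: "L 0 = 0" using L_scale[of 0 0] by simp
  have L_diff: "L (x - y) = L x - L y" for x y using L_add[of "x - y" y] by simp
  have L_sum: "L (\<Sum>X\<in>T. sc (c X) (r X)) = (\<Sum>X\<in>T. sc' (c X) (L (r X)))"
    for T :: "'a set set" and c r
    by (induction T rule: infinite_finite_induct) (auto simp: L0 L_add L_scale)
  have V_sub: "A.subspace V"
    using Us by (auto simp: V A.subspace_def L0 L_add L_scale)
  have coset_eq: "x +o V = y +o V \<longleftrightarrow> L x = L y" if "x \<in> U" "y \<in> U" for x y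
  proof
    assume "x +o V = y +o V"
    moreover have "x \<in> x +o V" using A.subspace_0[OF V_sub] by (force simp: elt_set_plus_def)
    ultimately obtain v where "v \<in> V" "x = y + v" by (auto simp: elt_set_plus_def)
    then show "L x = L y" by (simp add: V L_add)
  next
    have sub: "x +o V \<subseteq> y +o V" if "x \<in> U" "y \<in> U" "L x = L y" for x y
    proof
      fix z assume "z \<in> x +o V"
      then obtain v where "v \<in> V" "z = x + v" by (auto simp: elt_set_plus_def)
      then have z: "z = y + (x - y + v)" "x - y + v \<in> V" using that Us by (auto simp: V L_add L_diff)
      show "z \<in> y +o V" unfolding z(1) using z(2) by (rule set_plus_intro2)
    qed
    assume "L x = L y"
    then show "x +o V = y +o V" using sub[OF that] sub[OF that(2,1)] by auto
  qed
  define Q where "Q = quotient_space U V"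
  \<comment> \<open>A representative of each coset, on which the induced map is computed.\<close>
  define r where "r X = (SOME x. x \<in> U \<and> X = x +o V)" for X
  have r: "r X \<in> U" "X = r X +o V" if X: "X \<in> Q" for X
  proof -
    have "\<exists>x. x \<in> U \<and> X = x +o V" using X by (auto simp: Q_def quotient_space_def)
    from someI_ex[OF this] show "r X \<in> U" "X = r X +o V" by (auto simp: r_def)
  qed
  define \<Lambda> where "\<Lambda> X = L (r X)" for X
  have inj: "inj_on \<Lambda> Q"
    using r coset_eq by (intro inj_onI) (metis \<Lambda>_def)
  have \<Lambda>_coset: "\<Lambda> (x +o V) = L x" if "x \<in> U" for x
  proof -
    have "x +o V \<in> Q" using that by (auto simp: Q_def quotient_space_def)
    then show ?thesis using r[of "x +o V"] coset_eq that unfolding \<Lambda>_def by blast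
  qed
  have img: "\<Lambda> ` Q = L ` U"
    using \<Lambda>_coset by (auto simp: Q_def quotient_space_def image_image)
  have comb: "coset_combination sc V T c = (\<Sum>X\<in>T. sc (c X) (r X)) +o V" if "finite T" "T \<subseteq> Q" for T c
    using that
  proof (induction T)
    case empty
    show ?case by (simp add: coset_combination_def)
  next
    case (insert X T)
    let ?z = "\<Sum>X\<in>T. sc (c X) (r X)"
    have "coset_combination sc V (insert X T) c = sc (c X) ` X + coset_combination sc V T c"
      using insert.hyps by (simp add: coset_combination_def add.left_commute)
    also have "\<dots> = sc (c X) ` (r X +o V) + (?z +o V)" using insert r[of X] by simp
    also have "\<dots> = (sc (c X) (r X) + ?z) +o V"
    proof (intro set_eqI iffI)
      fix y assume "y \<in> sc (c X) ` (r X +o V) + (?z +o V)"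
      then obtain v v' where v: "v \<in> V" "v' \<in> V" "y = sc (c X) (r X + v) + (?z + v')"
        by (auto simp: set_plus_def elt_set_plus_def)
      then have "y = (sc (c X) (r X) + ?z) + (sc (c X) v + v')"
        by (simp add: A.scale_right_distrib)
      moreover have "sc (c X) v + v' \<in> V"
        using v A.subspace_add[OF V_sub] A.subspace_scale[OF V_sub] by blast
      ultimately show "y \<in> (sc (c X) (r X) + ?z) +o V" by (auto simp: elt_set_plus_def)
    next
      fix y assume "y \<in> (sc (c X) (r X) + ?z) +o V"
      then obtain v where v: "v \<in> V" "y = sc (c X) (r X) + (?z + v)"
        by (auto simp: elt_set_plus_def add.assoc)
      have "r X \<in> r X +o V" using A.subspace_0[OF V_sub] by (force simp: elt_set_plus_def)
      then show "y \<in> sc (c X) ` (r X +o V) + (?z +o V)"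
        using v by (auto simp: elt_set_plus_def intro!: set_plus_intro)
    qed
    also have "sc (c X) (r X) + ?z = (\<Sum>X\<in>insert X T. sc (c X) (r X))" using insert.hyps by simp
    finally show ?case .
  qed
  have comb_coset: "coset_combination sc V T c = x +o V \<longleftrightarrow> (\<Sum>X\<in>T. sc' (c X) (\<Lambda> X)) = L x"
    if "finite T" "T \<subseteq> Q" "x \<in> U" for T c x
  proof -
    have "(\<Sum>X\<in>T. sc (c X) (r X)) \<in> U"
      using that r(1) Us(2) by (intro A.subspace_sum[OF U]) blast
    then show ?thesis using coset_eq that by (simp add: comb L_sum \<Lambda>_def)
  qed
  have comb_V: "coset_combination sc V T c = V \<longleftrightarrow> (\<Sum>X\<in>T. sc' (c X) (\<Lambda> X)) = 0"
    if "finite T" "T \<subseteq> Q" for T c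
    using comb_coset[OF that Us(3)] by (simp add: L0)
  have indep: "(\<forall>T c. finite T \<and> T \<subseteq> S \<and> coset_combination sc V T c = V \<longrightarrow> (\<forall>X\<in>T. c X = 0)) \<longleftrightarrow>
      A'.independent (\<Lambda> ` S)" (is "?l \<longleftrightarrow> ?r") if S: "S \<subseteq> Q" for S
  proof
    assume ?l
    show ?r
      unfolding A'.dependent_explicit
    proof clarify
      fix t u b assume t: "finite t" "t \<subseteq> \<Lambda> ` S" "(\<Sum>v\<in>t. sc' (u v) v) = 0" "b \<in> t" "u b \<noteq> 0"
      obtain T where T: "T \<subseteq> S" "inj_on \<Lambda> T" "t = \<Lambda> ` T"
        using t(2) by (meson subset_image_inj)
      have "finite T" using T t(1) finite_imageD by blast
      moreover have "(\<Sum>X\<in>T. sc' (u (\<Lambda> X)) (\<Lambda> X)) = 0"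
        using t(3) T by (simp add: sum.reindex)
      ultimately have "\<forall>X\<in>T. u (\<Lambda> X) = 0"
        using \<open>?l\<close>[rule_format, of T "\<lambda>X. u (\<Lambda> X)"] comb_V[of T "\<lambda>X. u (\<Lambda> X)"] T(1) S by blast
      with t(4,5) T(3) show False by auto
    qed
  next
    assume ?r
    show ?l
    proof (intro allI impI ballI)
      fix T c X assume T: "finite T \<and> T \<subseteq> S \<and> coset_combination sc V T c = V" and X: "X \<in> T"
      have TS: "finite T" "T \<subseteq> S" using T by simp_all
      have TQ: "T \<subseteq> Q" using TS(2) S by (rule subset_trans)
      have injT: "inj_on \<Lambda> T" using inj TQ by (rule inj_on_subset)
      have "(\<Sum>X\<in>T. sc' (c X) (\<Lambda> X)) = 0" using comb_V[OF TS(1) TQ, of c] T by simp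
      then have "(\<Sum>v\<in>\<Lambda> ` T. sc' (c (inv_into T \<Lambda> v)) v) = 0"
        using injT by (simp add: sum.reindex)
      then have "c (inv_into T \<Lambda> (\<Lambda> X)) = 0"
        using A'.independentD[OF \<open>?r\<close>, of "\<Lambda> ` T" "\<lambda>v. c (inv_into T \<Lambda> v)" "\<Lambda> X"]
          image_mono[OF TS(2), of \<Lambda>] TS(1) X by simp
      then show "c X = 0" using X injT by simp
    qed
  qed
  have spanning: "(\<forall>X\<in>Q. \<exists>T c. finite T \<and> T \<subseteq> S \<and> X = coset_combination sc V T c) \<longleftrightarrow>
      L ` U \<subseteq> A'.span (\<Lambda> ` S)" if S: "S \<subseteq> Q" for S
  proof -
    have "(\<exists>T c. finite T \<and> T \<subseteq> S \<and> x +o V = coset_combination sc V T c) \<longleftrightarrow> L x \<in> A'.span (\<Lambda> ` S)"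
      (is "?l \<longleftrightarrow> ?r") if x: "x \<in> U" for x
    proof
      assume ?l
      then obtain T c where T: "finite T" "T \<subseteq> S" "(\<Sum>X\<in>T. sc' (c X) (\<Lambda> X)) = L x"
        using comb_coset[OF _ _ x] S by (metis order_trans)
      show ?r unfolding T(3)[symmetric]
        by (intro A'.span_sum A'.span_scale A'.span_base) (use T in auto)
    next
      assume ?r
      then obtain t u where t: "finite t" "t \<subseteq> \<Lambda> ` S" "L x = (\<Sum>v\<in>t. sc' (u v) v)"
        by (auto simp: A'.span_explicit)
      obtain T where T: "T \<subseteq> S" "inj_on \<Lambda> T" "t = \<Lambda> ` T"
        using t(2) by (meson subset_image_inj)
      have "finite T" using T t(1) finite_imageD by blast
      moreover have "(\<Sum>X\<in>T. sc' (u (\<Lambda> X)) (\<Lambda> X)) = L x"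
        using t(3) T by (simp add: sum.reindex)
      ultimately show ?l using comb_coset[of T x "\<lambda>X. u (\<Lambda> X)"] T(1) S x by (metis order_trans)
    qed
    then show ?thesis unfolding Q_def quotient_space_def by auto
  qed
  have basis: "quotient_basis sc U V S \<longleftrightarrow>
      S \<subseteq> Q \<and> A'.independent (\<Lambda> ` S) \<and> L ` U \<subseteq> A'.span (\<Lambda> ` S)" for S
    unfolding quotient_basis_def Q_def[symmetric] 
    by (cases "S \<subseteq> Q") (simp_all only: indep spanning simp_thms)
  obtain T where T: "T \<subseteq> L ` U" "A'.independent T" "L ` U \<subseteq> A'.span T"
    using A'.basis_exists[of "L ` U"] by metis
  have "quotient_basis sc U V {X \<in> Q. \<Lambda> X \<in> T}"
  proof -
    have "\<Lambda> ` {X \<in> Q. \<Lambda> X \<in> T} = T" using T(1) img by auto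
    then show ?thesis using T basis by auto
  qed
  then have ex: "\<exists>S. quotient_basis sc U V S" ..
  define S where "S = (SOME S. quotient_basis sc U V S)"
  have "quotient_basis sc U V S" unfolding S_def using ex by (rule someI_ex)
  then have S: "S \<subseteq> Q" "A'.independent (\<Lambda> ` S)" "L ` U \<subseteq> A'.span (\<Lambda> ` S)"
    unfolding basis by simp_all
  have "\<Lambda> ` S \<subseteq> L ` U" unfolding img[symmetric] using S(1) by (rule image_mono)
  then have "A'.span (\<Lambda> ` S) = A'.span (L ` U)"
    using S(3) by (metis A'.span_mono A'.span_span subset_antisym)
  then have "A'.dim (L ` U) = card (\<Lambda> ` S)" using S(2) by (rule A'.dim_eq_card)
  also have "\<dots> = card S" using inj S(1) by (meson card_image inj_on_subset)
  finally show ?thesis by (simp add: quotient_dim_def S_def)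
qed

interpretation fun_space: vector_space "\<lambda>(c :: 'f::field) (h :: nform \<Rightarrow> 'f) n. c * h n"
  by unfold_locales (auto simp: algebra_simps fun_eq_iff)

lemma independent_indicators:
  "fun_space.independent ((\<lambda>d n. of_bool (d = n) :: 'f::field) ` D)"
  unfolding fun_space.dependent_explicit
proof clarify
  fix t u v
  assume t: "finite t" "t \<subseteq> (\<lambda>d n. of_bool (d = n) :: 'f) ` D" and v: "v \<in> t" "u v \<noteq> 0"
    and sum: "(\<Sum>v\<in>t. (\<lambda>n. u v * v n)) = 0"
  obtain d where d: "v = (\<lambda>n. of_bool (d = n))" using t v by auto
  have other: "u v' * v' d = 0" if v': "v' \<in> t - {v}" for v'
  proof -
    obtain d' where d': "v' = (\<lambda>n. of_bool (d' = n))" using t v' by auto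
    then have "d' \<noteq> d" using v' d by auto
    then show ?thesis by (simp add: d')
  qed
  have "0 = (\<Sum>v\<in>t. (\<lambda>n. u v * v n)) d" using sum by simp
  also have "\<dots> = (\<Sum>v\<in>t. u v * v d)" using t(1) by (induction t) auto
  also have "\<dots> = u v * v d + (\<Sum>v'\<in>t - {v}. u v' * v' d)" using t(1) v(1) by (rule sum.remove)
  also have "(\<Sum>v'\<in>t - {v}. u v' * v' d) = 0" by (intro sum.neutral ballI other)
  finally show False using v d by simp
qed

section \<open>Counting normal forms of multilinear monomials\<close>

fun var_index :: "gvar \<Rightarrow> nat" where
  "var_index (Y i) = i"
| "var_index (Z i) = i"

fun nform_indices :: "nform \<Rightarrow> nat multiset" where
  "nform_indices (Pure M) = M"
| "nform_indices (Act L R) = L + R"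
| "nform_indices (Odd L k R) = add_mset k (L + R)"

definition indices :: "(gvar \<times> 'w) list \<Rightarrow> nat multiset" where
  "indices us = mset (map (\<lambda>(u, b). var_index u) us)"

lemma indices_simps [simp]: "indices [] = {#}" "indices ((u, b) # us) = add_mset (var_index u) (indices us)"
  by (simp_all add: indices_def)

text \<open>
  Listing the indices of a multilinear monomial as a permutation of $0, \dots, n-1$ means that they form
  the multiset of these numbers, a property that the normal form retains.
\<close>

lemma multilinear_monos_iff:
  "Mono a us \<in> multilinear_monos B n \<longleftrightarrow> a \<in> B \<and> snd ` set us \<subseteq> B \<and> indices us = mset_set {..<n}"
proof -
  have var: "u \<in> {Y i, Z i} \<longleftrightarrow> var_index u = i" for u i by (cases u) auto
  have "(length us = n \<and> (\<exists>\<sigma>. \<sigma> permutes {..<n} \<and> (\<forall>k<n. fst (us ! k) \<in> {Y (\<sigma> k), Z (\<sigma> k)}))) \<longleftrightarrow>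
      indices us = mset_set {..<n}" (is "?l \<longleftrightarrow> ?r")
  proof
    assume ?l
    then obtain \<sigma> where \<sigma>: "length us = n" "\<sigma> permutes {..<n}"
      "\<forall>k<n. var_index (fst (us ! k)) = \<sigma> k" unfolding var by blast
    have "map (\<lambda>(u, b). var_index u) us = map \<sigma> [0..<n]"
      by (rule nth_equalityI) (use \<sigma> in \<open>auto simp: case_prod_beta\<close>)
    then have "indices us = image_mset \<sigma> (mset_set {..<n})"
      unfolding indices_def by (metis atLeast0LessThan mset_map mset_upt)
    also have "\<dots> = mset_set {..<n}"
      using image_mset_mset_set[of \<sigma> "{..<n}"] permutes_inj_on[OF \<sigma>(2)] permutes_image[OF \<sigma>(2)] by simp
    finally show ?r .
  next
    assume r: ?r
    let ?xs = "map (\<lambda>(u, b). var_index u) us"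
    have mset: "mset ?xs = mset [0..<n]" using r by (simp add: indices_def atLeast0LessThan)
    have len: "length us = n" using mset_eq_length[OF mset] by simp
    have dist: "distinct ?xs" using mset_eq_imp_distinct_iff[OF mset] by simp
    have set: "set ?xs = {..<n}" using mset_eq_setD[OF mset] by (simp add: atLeast0LessThan)
    let ?\<sigma> = "\<lambda>k. if k < n then ?xs ! k else k"
    have "bij_betw ((!) ?xs) {..<n} {..<n}" by (rule bij_betw_nth) (use len dist set in auto)
    then have "bij_betw ?\<sigma> {..<n} {..<n}" by (rule iffD1[OF bij_betw_cong, rotated]) simp
    then have "?\<sigma> permutes {..<n}" by (rule bij_imp_permutes) simp
    moreover have "\<forall>k<n. fst (us ! k) \<in> {Y (?\<sigma> k), Z (?\<sigma> k)}"
      unfolding var using len by (simp add: case_prod_beta)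
    ultimately show ?l using len by blast
  qed
  then show ?thesis by (auto simp: multilinear_monos_def)
qed

lemma push_coef_indices: "push_coef e b n = Some n' \<Longrightarrow> nform_indices n' = nform_indices n"
  by (auto simp: push_coef_def split: if_splits nform.splits)

lemma push_var_indices: "push_var u n = Some n' \<Longrightarrow> nform_indices n' = add_mset (var_index u) (nform_indices n)"
  by (cases u; cases n) auto

lemma tail_nform_indices: "tail_nform e us = Some n \<Longrightarrow> nform_indices n = indices us"
proof (induction us arbitrary: n)
  case (Cons x us)
  then show ?case
    by (cases x) (auto simp: bind_eq_Some_conv push_coef_indices push_var_indices)
qed simp

lemma tail_nform_blocks:
  assumes "e \<noteq> 1"
  shows "tail_nform e (y_block 1 l) = Some (Pure (mset l))"
    and "tail_nform e (y_block 1 l @ (Z k, 1) # y_block 1 r) = Some (Odd (mset l) k (mset r))"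
    and "l \<noteq> [] \<Longrightarrow> tail_nform e (y_block e l @ y_block 1 r) = Some (Act (mset l) (mset r))"
proof -
  show 1: "tail_nform e (y_block 1 l) = Some (Pure (mset l))" for l
    by (induction l) (auto simp: y_block_one push_coef_def)
  show "tail_nform e (y_block 1 l @ (Z k, 1) # y_block 1 r) = Some (Odd (mset l) k (mset r))"
    by (induction l) (auto simp: y_block_one push_coef_def 1)
  show "tail_nform e (y_block e l @ y_block 1 r) = Some (Act (mset l) (mset r))" if "l \<noteq> []"
    using that
  proof (induction l)
    case (Cons i l)
    then show ?case using assms
      by (cases "l = []") (auto simp: y_block_Cons push_coef_def 1)
  qed simp
qed

lemma ex_mono_nform:
  fixes e :: "'w::one"
  assumes "e \<noteq> 1" "e \<in> B" "1 \<in> B"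
  obtains a us where "mono_nform e (Mono a us) = Some n" "a \<in> B" "snd ` set us \<subseteq> B"
    "indices us = nform_indices n"
proof (cases n)
  case (Pure M)
  obtain l where l: "mset l = M" using ex_mset by blast
  show ?thesis
  proof (rule that[of 1 "y_block (1 :: 'w) l"])
    show "indices (y_block (1 :: 'w) l) = nform_indices n"
      using tail_nform_indices[OF tail_nform_blocks(1)[OF assms(1)], of l] l Pure by simp
  qed (use assms snd_y_block[of "1 :: 'w" l] l Pure in
      \<open>auto simp: tail_nform_blocks push_coef_def\<close>)
next
  case (Act L R)
  obtain l r where l: "mset l = L" "mset r = R" using ex_mset by metis
  show ?thesis
  proof (cases "l = []")
    case True
    show ?thesis
    proof (rule that[of e "y_block 1 r"])
      show "indices (y_block (1 :: 'w) r) = nform_indices n"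
        using tail_nform_indices[OF tail_nform_blocks(1)[OF assms(1)], of r] l True Act by simp
    qed (use assms snd_y_block[of "1 :: 'w" r] l Act True in
        \<open>auto simp: tail_nform_blocks push_coef_def\<close>)
  next
    case False
    show ?thesis
    proof (rule that[of 1 "y_block e l @ y_block 1 r"])
      show "indices (y_block e l @ y_block 1 r) = nform_indices n"
        using tail_nform_indices[OF tail_nform_blocks(3)[OF assms(1) False], of r] l Act by simp
    qed (use assms snd_y_block[of e l] snd_y_block[of "1 :: 'w" r] l Act False in
        \<open>auto simp: tail_nform_blocks push_coef_def\<close>)
  qed
next
  case (Odd L k R)
  obtain l r where l: "mset l = L" "mset r = R" using ex_mset by metis
  show ?thesis
  proof (rule that[of 1 "y_block (1 :: 'w) l @ (Z k, 1) # y_block 1 r"])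
    show "indices (y_block (1 :: 'w) l @ (Z k, 1) # y_block 1 r) = nform_indices n"
      using tail_nform_indices[OF tail_nform_blocks(2)[OF assms(1)], of l k r] l Odd by simp
  qed (use assms snd_y_block[of "1 :: 'w" l] snd_y_block[of "1 :: 'w" r] l Odd in
      \<open>auto simp: tail_nform_blocks push_coef_def\<close>)
qed

lemma multiset_split_set:
  assumes "finite A"
  shows "L + R = mset_set A \<longleftrightarrow> (\<exists>S\<subseteq>A. L = mset_set S \<and> R = mset_set (A - S))"
proof
  assume eq: "L + R = mset_set A"
  have c: "count L x + count R x = of_bool (x \<in> A)" for x
    using assms by (simp flip: count_union add: eq count_mset_set')
  have split: "a = of_bool (0 < a) \<and> b = of_bool (P \<and> a = 0)" if "a + b = of_bool P" for a b :: nat and P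
    using that by (cases P; cases a) auto
  have sub: "set_mset L \<subseteq> A" using c by (metis add_is_0 count_eq_zero_iff of_bool_eq(1) subsetI)
  then have fin: "finite (set_mset L)" by simp
  have "L = mset_set (set_mset L)" "R = mset_set (A - set_mset L)"
  proof (rule_tac [!] multiset_eqI)
    fix x
    have "count (mset_set (set_mset L)) x = of_bool (0 < count L x)"
      "count (mset_set (A - set_mset L)) x = of_bool (x \<in> A \<and> count L x = 0)"
      using assms by (simp_all add: count_mset_set' count_eq_zero_iff)
    then show "count L x = count (mset_set (set_mset L)) x"
      "count R x = count (mset_set (A - set_mset L)) x"
      using split[OF c[of x]] by metis+
  qed
  then show "\<exists>S\<subseteq>A. L = mset_set S \<and> R = mset_set (A - S)" using sub by blast
next
  assume "\<exists>S\<subseteq>A. L = mset_set S \<and> R = mset_set (A - S)"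
  then obtain S where S: "S \<subseteq> A" "L = mset_set S" "R = mset_set (A - S)" by blast
  then show "L + R = mset_set A"
    using mset_set_Union[of S "A - S"] assms finite_subset[OF S(1)] by (simp add: Un_absorb1)
qed

lemma add_mset_eq_mset_set:
  assumes "finite A"
  shows "add_mset k M = mset_set A \<longleftrightarrow> k \<in> A \<and> M = mset_set (A - {k})"
proof
  assume eq: "add_mset k M = mset_set A"
  have "k \<in># mset_set A" unfolding eq[symmetric] by simp
  then have k: "k \<in> A" using assms by simp
  then show "k \<in> A \<and> M = mset_set (A - {k})" using eq mset_set.remove[OF assms k] by simp
next
  assume "k \<in> A \<and> M = mset_set (A - {k})"
  then show "add_mset k M = mset_set A" using mset_set.remove[OF assms, of k] by simp
qed

lemma card_nforms_with_indices:
  assumes "n \<ge> 1"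
  shows "card {d. nform_indices d = mset_set {..<n}} = 2 ^ (n - 1) * (n + 2) + 1"
proof -
  let ?A = "{..<n}"
  define act where "act S = Act (mset_set S) (mset_set (?A - S))" for S
  define odd where "odd = (\<lambda>(k, S). Odd (mset_set S) k (mset_set (?A - {k} - S)))"
  define P where "P = (SIGMA k:?A. Pow (?A - {k}))"
  have "{d. nform_indices d = mset_set ?A} = {Pure (mset_set ?A)} \<union> act ` Pow ?A \<union> odd ` P"
    (is "?D = ?E")
  proof (rule set_eqI)
    fix d show "d \<in> ?D \<longleftrightarrow> d \<in> ?E"
    proof (cases d)
      case (Act L R)
      then show ?thesis
        by (auto simp: act_def odd_def multiset_split_set)
    next
      case (Odd L k R)
      then show ?thesis
        by (auto simp: act_def odd_def P_def add_mset_eq_mset_set multiset_split_set image_iff)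
    qed (auto simp: act_def odd_def)
  qed
  moreover have "inj_on act (Pow ?A)"
    by (rule inj_onI) (auto simp: act_def mset_set_eq_iff finite_subset)
  then have "card (act ` Pow ?A) = 2 ^ n" by (simp add: card_image card_Pow)
  moreover have "inj_on odd P"
  proof (rule inj_onI)
    fix p q assume pq: "p \<in> P" "q \<in> P" and eq: "odd p = odd q"
    obtain k S k' S' where p: "p = (k, S)" "q = (k', S')" by fastforce
    then have "finite S" "finite S'" using pq by (auto simp: P_def intro: finite_subset)
    then show "p = q" using eq by (simp add: p odd_def mset_set_eq_iff)
  qed
  then have "card (odd ` P) = n * 2 ^ (n - 1)"
    by (simp add: card_image P_def card_SigmaI card_Pow)
  moreover have "finite (act ` Pow ?A)" "finite (odd ` P)" by (auto simp: P_def)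
  moreover have "Pure (mset_set ?A) \<notin> act ` Pow ?A" "Pure (mset_set ?A) \<notin> odd ` P"
    "act ` Pow ?A \<inter> odd ` P = {}"
    by (auto simp: act_def odd_def)
  ultimately have "card {d. nform_indices d = mset_set ?A} = Suc (2 ^ n + n * 2 ^ (n - 1))"
    by (simp add: card_Un_disjoint)
  moreover obtain k where "n = Suc k" using assms by (cases n) auto
  ultimately show ?thesis by (simp add: algebra_simps)
qed

context C_action
begin

text \<open>
  A monomial is mapped to the indicator of its normal form, or to zero. Each normal form with the
  right indices is attained, by listing the variables in an arbitrary order.
\<close>

lemma nform_coeff_image_multilinear_space:
  "nform_coeff ` multilinear_space B n =
     fun_space.span ((\<lambda>d n. of_bool (d = n)) ` {d. nform_indices d = mset_set {..<n}})"
proof -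
  let ?D = "{d. nform_indices d = mset_set {..<n}}"
  let ?ind = "\<lambda>d n. of_bool (d = n) :: 'f"
  interpret hom: module_hom fscale "\<lambda>(c :: 'f) (h :: nform \<Rightarrow> 'f) n. c * h n" nform_coeff
    by unfold_locales (auto simp: fun_eq_iff nform_coeff_add nform_coeff_fscale)
  have "nform_coeff ` multilinear_space B n =
      fun_space.span (nform_coeff ` mono_elem ` multilinear_monos B n)"
    unfolding multilinear_space_def by (rule hom.span_image[symmetric])
  also have "\<dots> = fun_space.span (?ind ` ?D)"
  proof (rule subset_antisym; rule fun_space.span_minimal[OF _ fun_space.subspace_span])
    show "nform_coeff ` mono_elem ` multilinear_monos B n \<subseteq> fun_space.span (?ind ` ?D)"
    proof clarify
      fix m assume m: "m \<in> multilinear_monos B n"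
      show "nform_coeff (mono_elem m) \<in> fun_space.span (?ind ` ?D)"
      proof (cases "mono_nform w1 m")
        case None
        then have "nform_coeff (mono_elem m) = 0" by (auto simp: fun_eq_iff nform_coeff_mono_elem)
        then show ?thesis by (simp add: fun_space.span_zero)
      next
        case (Some d)
        obtain a us where au: "m = Mono a us" by (cases m)
        have "nform_indices d = indices us"
          using Some by (auto simp: au bind_eq_Some_conv push_coef_indices tail_nform_indices)
        then have "d \<in> ?D" using m by (simp add: au multilinear_monos_iff)
        moreover have "nform_coeff (mono_elem m) = ?ind d"
          using Some by (auto simp: fun_eq_iff nform_coeff_mono_elem)
        ultimately show ?thesis by (auto intro: fun_space.span_base)
      qed
    qed
    show "?ind ` ?D \<subseteq> fun_space.span (nform_coeff ` mono_elem ` multilinear_monos B n)"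
    proof clarify
      fix d assume d: "nform_indices d = mset_set {..<n}"
      obtain a us where au: "mono_nform w1 (Mono a us) = Some d" "a \<in> B" "snd ` set us \<subseteq> B"
        "indices us = nform_indices d"
        using ex_mono_nform[OF w1_neq_1 w1_in_B one_in_B] by blast
      have "Mono a us \<in> multilinear_monos B n" using au d by (simp add: multilinear_monos_iff)
      moreover have "nform_coeff (mono_elem (Mono a us)) = ?ind d"
        using au(1) by (auto simp: fun_eq_iff nform_coeff_mono_elem)
      ultimately show "?ind d \<in> fun_space.span (nform_coeff ` mono_elem ` multilinear_monos B n)"
        by (intro fun_space.span_base) force
    qed
  qed
  finally show ?thesis .
qed

lemma codimension:
  assumes "n \<ge> 1"
  shows "graded_codimension B UTC n = 2 ^ (n - 1) * (n + 2) + 1"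
proof -
  let ?D = "{d. nform_indices d = mset_set {..<n}}"
  let ?ind = "\<lambda>d n. of_bool (d = n) :: 'f"
  have "multilinear_monos B n \<subseteq> basis_monos B"
    using assms by (auto simp: multilinear_monos_def basis_monos_def)
  then have "multilinear_space B n \<subseteq> (free_carrier :: ('f, 'w) wpoly set)"
    unfolding multilinear_space_def
    by (intro fscale.span_minimal subspace_free_carrier) auto
  then have V: "multilinear_space B n \<inter> graded_identities B UTC =
      {p \<in> multilinear_space B n. nform_coeff p = 0}"
    by (auto simp: graded_identities_iff fun_eq_iff)
  have "graded_codimension B UTC n = fun_space.dim (nform_coeff ` multilinear_space B n)"
    unfolding graded_codimension_def
    by (rule quotient_dim_linear_image[OF fscale.vector_space_axioms fun_space.vector_space_axioms _ _ _ V])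
      (auto simp: fun_eq_iff nform_coeff_add nform_coeff_fscale multilinear_space_def)
  also have "\<dots> = card (?ind ` ?D)"
    unfolding nform_coeff_image_multilinear_space
    by (rule fun_space.dim_eq_card) (simp_all add: fun_space.span_span independent_indicators)
  also have "\<dots> = card ?D"
  proof (intro card_image inj_onI)
    fix d d' :: nform assume "?ind d = ?ind d'"
    from fun_cong[OF this, of d] show "d = d'" by (simp split: if_splits)
  qed
  finally show ?thesis using card_nforms_with_indices[OF assms] by simp
qed

end

theorem theorem5p6:
  fixes s :: "'f::field_char_0 \<Rightarrow> 'w::ring_1 \<Rightarrow> 'w"
    and G :: "bit \<Rightarrow> 'w set"
    and \<phi> :: "'w \<Rightarrow> 'f^2^2"
    and w :: "'i \<Rightarrow> 'w" and I :: "'i set" and i0 i1 :: 'i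
  assumes "Z2_graded_algebra s G"
    and "graded_hom_onto_C s G \<phi>"
    and "inj_on w I" and "\<not> module.dependent s (w ` I)" and "module.span s (w ` I) = UNIV"
    and "i0 \<in> I" and "i1 \<in> I" and "i0 \<noteq> i1"
    and "w i0 = 1" and "\<phi> (w i1) = munit 1 2"
    and "\<forall>i\<in>I - {i0, i1}. \<phi> (w i) = 0"
  shows "(let W = free_gw s G (w ` I) in
      graded_identities (w ` I) (UT2C \<phi>) =
      T_ideal_generated W
        ({mult W (fvar (Y 0)) (fvar (Y 1)) - mult W (fvar (Y 1)) (fvar (Y 0)),
          mult W (fvar (Z 0)) (fvar (Z 1))} \<union>
         {ract W (fvar (Y 0)) (w i) | i. i \<in> I - {i0, i1}} \<union>
         {lact W (w i) (fvar (Y 0)) | i. i \<in> I - {i0, i1}} \<union>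
         {ract W (fvar (Z 0)) (w j) | j. j \<in> I - {i0}} \<union>
         {lact W (w j) (fvar (Z 0)) | j. j \<in> I - {i0}})) \<and>
    (\<forall>n\<ge>1. graded_codimension (w ` I) (UT2C \<phi>) n = 2 ^ (n - 1) * (n + 2) + 1)"
proof -
  have "C_action s G (w ` I) \<phi> (w i1)"
  proof (intro C_action.intro based_graded_algebra.intro based_graded_algebra_axioms.intro
      C_action_axioms.intro)
    show "1 \<in> w ` I" using assms(6,9) by force
    show "\<phi> b = 0" if "b \<in> w ` I" "b \<noteq> 1" "b \<noteq> w i1" for b
      using that assms(9,11) by auto
  qed (use assms in auto)
  then interpret C_action s G "w ` I" \<phi> "w i1" .
  have image: "w ` I - {1, w i1} = w ` (I - {i0, i1})" "w ` I - {1} = w ` (I - {i0})"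
    using assms(3,6,7,9) by (auto simp: inj_on_def)
  have gens: "{mult W (fvar (Y 0)) (fvar (Y 1)) - mult W (fvar (Y 1)) (fvar (Y 0)),
          mult W (fvar (Z 0)) (fvar (Z 1))} \<union>
         {ract W (fvar (Y 0)) (w i) | i. i \<in> I - {i0, i1}} \<union>
         {lact W (w i) (fvar (Y 0)) | i. i \<in> I - {i0, i1}} \<union>
         {ract W (fvar (Z 0)) (w j) | j. j \<in> I - {i0}} \<union>
         {lact W (w j) (fvar (Z 0)) | j. j \<in> I - {i0}} = generators"
    unfolding generators_def image image_image free_gw_simps Setcompr_eq_image ..
  show ?thesis
    unfolding Let_def gens using identities_generated codimension by blast
qed

end
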